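(* Let $M$ be the permutation representation of $\mathfrak{S}_5$ (over $\mathbb{C}$) associated to the $\mathfrak{S}_5$-set $\mathcal{M}=\{\pm s_{ij},\pm\sigma_{ij}\mid 1\le i\ne j\le3\}\subset V$ (equivalently, to the set of oriented nondegenerate combinatorial pentagons on $\{1,\dots,5\}$), and let $D$ be the permutation representation associated to the set $\mathcal{DP}$ of double combinatorial pentagons on $\{1,\dots,5\}$. Then, as representations of $\mathfrak{S}_5$: (i) $W'\cong W\oplus\epsilon\cong D\otimes\epsilon$; (ii) $M\cong V\oplus(V\otimes\epsilon)\oplus D\oplus(D\otimes\epsilon)\cong V\oplus V\oplus[(W\otimes\epsilon)\oplus\chi_1]\oplus[W\oplus\epsilon]$.
   Context: Let $Y$ be the blow-up of $\mathbb{P}^2_{\mathbb{C}}$ at $p_1=(1:0:0)$, $p_2=(0:1:0)$, $p_3=(0:0:1)$, $p_4=(1:1:1)$ (the del Pezzo surface of degree $5$). $V=H^0(Y,\mathcal{O}_Y(-K_Y))$ is identified with the 6-dimensional space of cubic forms in $x_1,x_2,x_3$ vanishing at $p_1,\dots,p_4$, by $P\mapsto P\,(dx_1\wedge dx_2\wedge dx_3)^{-1}$. For $\{i,j,k\}=\{1,2,3\}$, $s_{ij}=x_ix_j(x_j-x_k)$ (a basis of $V$) and $\sigma_{ij}=\eta\,(s_{ik}-s_{ki}-s_{jk})$, $\eta$ being the sign of the permutation $1\mapsto i,2\mapsto j,3\mapsto k$. $\operatorname{Aut}(Y)\cong\mathfrak{S}_5$, and the induced linear action on $V$ is generated by: $\tau\in\mathfrak{S}_3$: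 $s_{ij}\mapsto\operatorname{sgn}(\tau)s_{\tau(i)\tau(j)}$; $(3,4)$: $s_{12}\mapsto\sigma_{31}$, $s_{13}\mapsto s_{23}$, $s_{21}\mapsto-\sigma_{32}$, $s_{23}\mapsto s_{13}$, $s_{31}\mapsto-\sigma_{12}$, $s_{32}\mapsto\sigma_{21}$; $(4,5)$: $s_{ij}\mapsto s_{ik}$ for $\{i,j,k\}=\{1,2,3\}$. The set $\mathcal{M}$ (24 elements) is stable under this action. $W=\ker\big(\operatorname{Sym}^2(V)\to H^0(Y,\mathcal{O}_Y(-2K_Y))\big)$ (of dimension 5), and $W'\subset\operatorname{Sym}^2(V)$ is the span of the six linearly independent elements $Q_{ij}=s_{ij}\sigma_{ij}$; both are $\mathfrak{S}_5$-subrepresentations and $W\subset W'$. $\epsilon$ is the sign character and $\chi_1$ the trivial character. A nondegenerate ordered combinatorial pentagon on $\{1,\dots,5\}$ is a bijection $p:\mathbb{Z}/5\to\{1,\dots,5\}$; an oriented one is a class under $p(i)\sim p(i+a)$, $a\in\mathbb{Z}/5$; an unoriented one is a class under $p(i)\sim p(\pm i+a)$. The neighbouring pentagon of $p(i)$ is the class of $i\mapsto p(2i)$. A double combinatorial pentagon is an unordered pair of neighbouring nondegenerate unoriented pentagons. $\mathfrak{S}_5$ acts by $p\mapsto g\circ p$. As $\mathfrak{S}_5$-sets, oriented pentagons form $\mathfrak{S}_5/\langle(1,2,3,4,5)\rangle$ and double pentagons form $\mathfrak{S}_5/\operatorname{Aff}(1,\mathbb{Z}/5)$. *)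

theory Defs
  imports
    Complex_Main
    "HOL-Algebra.Sym_Groups"
    "HOL-Library.Poly_Mapping"
    "HOL-Library.Numeral_Type"
    "HOL-Library.Product_Plus"
begin

section \<open>Complex linear representations of a group\<close>

text \<open>A representation lives on a subset of an additive group type; its action is only
  meaningful for group elements in the carrier and vectors in \<open>rspace\<close>.\<close>

record ('g, 'v) rep =
  rspace :: "'v set"
  rscale :: "complex \<Rightarrow> 'v \<Rightarrow> 'v"
  ract :: "'g \<Rightarrow> 'v \<Rightarrow> 'v"

definition linear_between ::
    "('g, 'v::ab_group_add) rep \<Rightarrow> ('h, 'w::ab_group_add) rep \<Rightarrow> ('v \<Rightarrow> 'w) \<Rightarrow> bool" where
  "linear_between R S f \<longleftrightarrow>
     f ` rspace R \<subseteq> rspace S \<and>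
     (\<forall>u\<in>rspace R. \<forall>v\<in>rspace R. f (u + v) = f u + f v) \<and>
     (\<forall>c. \<forall>v\<in>rspace R. f (rscale R c v) = rscale S c (f v))"

definition is_rep :: "'g monoid \<Rightarrow> ('g, 'v::ab_group_add) rep \<Rightarrow> bool" where
  "is_rep G R \<longleftrightarrow>
     vector_space (rscale R) \<and>
     Modules.module.subspace (rscale R) (rspace R) \<and>
     (\<forall>g\<in>carrier G. linear_between R R (ract R g)) \<and>
     (\<forall>v\<in>rspace R. ract R \<one>\<^bsub>G\<^esub> v = v) \<and>
     (\<forall>g\<in>carrier G. \<forall>h\<in>carrier G. \<forall>v\<in>rspace R.
        ract R (g \<otimes>\<^bsub>G\<^esub> h) v = ract R g (ract R h v))"

definition rep_iso ::
    "'g monoid \<Rightarrow> ('g, 'v::ab_group_add) rep \<Rightarrow> ('g, 'w::ab_group_add) rep \<Rightarrow> bool" where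
  "rep_iso G R S \<longleftrightarrow>
     is_rep G R \<and> is_rep G S \<and>
     (\<exists>f. bij_betw f (rspace R) (rspace S) \<and> linear_between R S f \<and>
          (\<forall>g\<in>carrier G. \<forall>v\<in>rspace R. f (ract R g v) = ract S g (f v)))"

definition rep_sum :: "('g, 'v) rep \<Rightarrow> ('g, 'w) rep \<Rightarrow> ('g, 'v \<times> 'w) rep"
    (infixr "\<boxplus>" 65) where
  "R \<boxplus> S = \<lparr> rspace = rspace R \<times> rspace S,
     rscale = (\<lambda>c (v, w). (rscale R c v, rscale S c w)),
     ract = (\<lambda>g (v, w). (ract R g v, ract S g w)) \<rparr>"

definition char_rep :: "('g \<Rightarrow> complex) \<Rightarrow> ('g, complex) rep" where
  "char_rep \<chi> = \<lparr> rspace = UNIV, rscale = (*), ract = (\<lambda>g z. \<chi> g * z) \<rparr>"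

text \<open>The tensor product of \<open>R\<close> with the one-dimensional representation \<open>char_rep \<chi>\<close>,
  with \<open>v \<otimes> z\<close> identified with \<open>z v\<close>.\<close>

definition rep_twist :: "('g, 'v) rep \<Rightarrow> ('g \<Rightarrow> complex) \<Rightarrow> ('g, 'v) rep"
    (infixl "\<boxtimes>" 70) where
  "R \<boxtimes> \<chi> = \<lparr> rspace = rspace R, rscale = rscale R,
     ract = (\<lambda>g v. rscale R (\<chi> g) (ract R g v)) \<rparr>"

definition pscale :: "complex \<Rightarrow> ('a \<Rightarrow>\<^sub>0 complex) \<Rightarrow> ('a \<Rightarrow>\<^sub>0 complex)" where
  "pscale c = Poly_Mapping.map ((*) c)"

lemma lookup_pscale [simp]: "Poly_Mapping.lookup (pscale c p) k = c * Poly_Mapping.lookup p k"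
  by (simp add: pscale_def Poly_Mapping.map.rep_eq Poly_Mapping.when_def)

lemma vector_space_pscale: "vector_space pscale"
  by unfold_locales (auto intro!: poly_mapping_eqI simp: lookup_add algebra_simps)

text \<open>The vector space with basis \<open>X\<close>, the basis vector \<open>x\<close> being \<open>single x 1\<close>.\<close>

definition perm_rep :: "'x set \<Rightarrow> ('g \<Rightarrow> 'x \<Rightarrow> 'x) \<Rightarrow> ('g, 'x \<Rightarrow>\<^sub>0 complex) rep" where
  "perm_rep X act = \<lparr> rspace = {f. Poly_Mapping.keys f \<subseteq> X}, rscale = pscale,
     ract = (\<lambda>g f. \<Sum>x\<in>Poly_Mapping.keys f.
       Poly_Mapping.single (act g x) (Poly_Mapping.lookup f x)) \<rparr>"

definition is_gset :: "'g monoid \<Rightarrow> 'x set \<Rightarrow> ('g \<Rightarrow> 'x \<Rightarrow> 'x) \<Rightarrow> bool" where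
  "is_gset G X act \<longleftrightarrow>
     (\<forall>g\<in>carrier G. \<forall>x\<in>X. act g x \<in> X) \<and>
     (\<forall>x\<in>X. act \<one>\<^bsub>G\<^esub> x = x) \<and>
     (\<forall>g\<in>carrier G. \<forall>h\<in>carrier G. \<forall>x\<in>X. act (g \<otimes>\<^bsub>G\<^esub> h) x = act g (act h x))"

definition gset_iso ::
    "'g monoid \<Rightarrow> 'x set \<Rightarrow> ('g \<Rightarrow> 'x \<Rightarrow> 'x) \<Rightarrow> 'y set \<Rightarrow> ('g \<Rightarrow> 'y \<Rightarrow> 'y) \<Rightarrow> bool" where
  "gset_iso G X act Y act' \<longleftrightarrow>
     is_gset G X act \<and> is_gset G Y act' \<and>
     (\<exists>f. bij_betw f X Y \<and> (\<forall>g\<in>carrier G. \<forall>x\<in>X. f (act g x) = act' g (f x)))"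


section \<open>The symmetric group on five letters\<close>

abbreviation S5 :: "(nat \<Rightarrow> nat) monoid" where
  "S5 \<equiv> sym_group 5"

abbreviation rep_iso_S5 (infix "\<simeq>" 50) where
  "R \<simeq> S \<equiv> rep_iso S5 R S"

definition sgn_char :: "(nat \<Rightarrow> nat) \<Rightarrow> complex" where
  "sgn_char g = of_int (sign g)"

abbreviation eps_rep :: "(nat \<Rightarrow> nat, complex) rep" where
  "eps_rep \<equiv> char_rep sgn_char"

abbreviation triv_rep :: "(nat \<Rightarrow> nat, complex) rep" where
  "triv_rep \<equiv> char_rep (\<lambda>_. 1)"


section \<open>Polynomials\<close>

type_synonym 'x mpoly = "('x \<Rightarrow>\<^sub>0 nat) \<Rightarrow>\<^sub>0 complex"

definition pvar :: "'x \<Rightarrow> 'x mpoly" where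
  "pvar i = Poly_Mapping.single (Poly_Mapping.single i 1) 1"

definition pconst :: "complex \<Rightarrow> 'x mpoly" where
  "pconst c = Poly_Mapping.single 0 c"

text \<open>Substitution of \<open>a i\<close> for the variable \<open>i\<close>, where \<open>h\<close> embeds the coefficients into the
  target ring.\<close>

definition peval :: "(complex \<Rightarrow> 'b::comm_ring_1) \<Rightarrow> ('x \<Rightarrow> 'b) \<Rightarrow> 'x mpoly \<Rightarrow> 'b" where
  "peval h a p = (\<Sum>m\<in>Poly_Mapping.keys p. h (Poly_Mapping.lookup p m) *
     (\<Prod>i\<in>Poly_Mapping.keys m. a i ^ Poly_Mapping.lookup m i))"

definition forms :: "nat \<Rightarrow> 'x set \<Rightarrow> 'x mpoly set" where
  "forms d X = {p. \<forall>m\<in>Poly_Mapping.keys p.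
     Poly_Mapping.keys m \<subseteq> X \<and> (\<Sum>i\<in>Poly_Mapping.keys m. Poly_Mapping.lookup m i) = d}"


section \<open>The anticanonical space of the quintic del Pezzo surface\<close>

text \<open>Homogeneous coordinates of \<open>p\<^sub>1, \<dots>, p\<^sub>4\<close>.\<close>

definition base_point :: "nat \<Rightarrow> nat \<Rightarrow> complex" where
  "base_point k i = (if k = 4 \<or> i = k then 1 else 0)"

definition V_space :: "nat mpoly set" where
  "V_space = {P \<in> forms 3 {1, 2, 3}. \<forall>k\<in>{1..4}. peval id (base_point k) P = 0}"

definition idx :: "(nat \<times> nat) set" where
  "idx = {(i, j). i \<in> {1, 2, 3} \<and> j \<in> {1, 2, 3} \<and> i \<noteq> j}"

text \<open>For \<open>(i, j) \<in> idx\<close>, the element \<open>k\<close> with \<open>{i, j, k} = {1, 2, 3}\<close>.\<close>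

abbreviation third :: "nat \<Rightarrow> nat \<Rightarrow> nat" where
  "third i j \<equiv> 6 - i - j"

definition s_form :: "nat \<Rightarrow> nat \<Rightarrow> nat mpoly" where
  "s_form i j = pvar i * pvar j * (pvar j - pvar (third i j))"

definition eta :: "nat \<Rightarrow> nat \<Rightarrow> complex" where
  "eta i j = of_int (sign (id(1 := i, 2 := j, 3 := third i j)))"

definition sigma_form :: "nat \<Rightarrow> nat \<Rightarrow> nat mpoly" where
  "sigma_form i j = pscale (eta i j)
     (s_form i (third i j) - s_form (third i j) i - s_form j (third i j))"

definition V_rep :: "((nat \<Rightarrow> nat) \<Rightarrow> nat mpoly \<Rightarrow> nat mpoly) \<Rightarrow> (nat \<Rightarrow> nat, nat mpoly) rep" where
  "V_rep \<rho> = \<lparr> rspace = V_space, rscale = pscale, ract = \<rho> \<rparr>"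

text \<open>The linear action of \<open>Aut(Y) \<cong> S\<^sub>5\<close> on \<open>V\<close>. Since these permutations generate \<open>S\<^sub>5\<close>
  and the \<open>s_form i j\<close> form a basis of \<open>V\<close>, the conditions determine \<open>\<rho>\<close> on \<open>S\<^sub>5\<close> and \<open>V\<close>.\<close>

definition del_pezzo_action :: "((nat \<Rightarrow> nat) \<Rightarrow> nat mpoly \<Rightarrow> nat mpoly) \<Rightarrow> bool" where
  "del_pezzo_action \<rho> \<longleftrightarrow>
     is_rep S5 (V_rep \<rho>) \<and>
     (\<forall>\<tau>. \<tau> permutes {1, 2, 3} \<longrightarrow>
        (\<forall>(i, j)\<in>idx. \<rho> \<tau> (s_form i j) = pscale (sgn_char \<tau>) (s_form (\<tau> i) (\<tau> j)))) \<and>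
     \<rho> (transpose 3 4) (s_form 1 2) = sigma_form 3 1 \<and>
     \<rho> (transpose 3 4) (s_form 1 3) = s_form 2 3 \<and>
     \<rho> (transpose 3 4) (s_form 2 1) = - sigma_form 3 2 \<and>
     \<rho> (transpose 3 4) (s_form 2 3) = s_form 1 3 \<and>
     \<rho> (transpose 3 4) (s_form 3 1) = - sigma_form 1 2 \<and>
     \<rho> (transpose 3 4) (s_form 3 2) = sigma_form 2 1 \<and>
     (\<forall>(i, j)\<in>idx. \<rho> (transpose 4 5) (s_form i j) = s_form i (third i j))"

definition M_set :: "nat mpoly set" where
  "M_set = (\<Union>(i, j)\<in>idx. {s_form i j, - s_form i j, sigma_form i j, - sigma_form i j})"

definition M_rep ::
    "((nat \<Rightarrow> nat) \<Rightarrow> nat mpoly \<Rightarrow> nat mpoly) \<Rightarrow> (nat \<Rightarrow> nat, nat mpoly \<Rightarrow>\<^sub>0 complex) rep" where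
  "M_rep \<rho> = perm_rep M_set \<rho>"


section \<open>The symmetric square of the anticanonical space\<close>

text \<open>As the \<open>s_form i j\<close> form a basis of \<open>V\<close>, the symmetric algebra of \<open>V\<close> is the polynomial ring
  in variables indexed by \<open>idx\<close>, the variable \<open>(i, j)\<close> standing for \<open>s_form i j\<close>. Thus
  \<open>sym_mult\<close> is the multiplication of sections, and \<open>sym_lin\<close> is the
  inclusion of \<open>V\<close> into its symmetric algebra.\<close>

definition Sym2_space :: "(nat \<times> nat) mpoly set" where
  "Sym2_space = forms 2 idx"

definition sym_mult :: "(nat \<times> nat) mpoly \<Rightarrow> nat mpoly" where
  "sym_mult q = peval pconst (\<lambda>(i, j). s_form i j) q"

definition sym_lin :: "nat mpoly \<Rightarrow> (nat \<times> nat) mpoly" where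
  "sym_lin v = (THE l. l \<in> forms 1 idx \<and> sym_mult l = v)"

definition sym_act ::
    "((nat \<Rightarrow> nat) \<Rightarrow> nat mpoly \<Rightarrow> nat mpoly) \<Rightarrow>
     (nat \<Rightarrow> nat) \<Rightarrow> (nat \<times> nat) mpoly \<Rightarrow> (nat \<times> nat) mpoly" where
  "sym_act \<rho> g q = peval pconst (\<lambda>(i, j). sym_lin (\<rho> g (s_form i j))) q"

text \<open>A section \<open>P \<omega>\<^sup>-\<^sup>2\<close> of \<open>-2K\<close>, with \<open>\<omega> = dx\<^sub>1 \<and> dx\<^sub>2 \<and> dx\<^sub>3\<close>, vanishes iff the sextic
  form \<open>P\<close> does, so \<open>W\<close> is the kernel of \<open>sym_mult\<close>.\<close>

definition W_space :: "(nat \<times> nat) mpoly set" where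
  "W_space = {q \<in> Sym2_space. sym_mult q = 0}"

definition Q_elt :: "nat \<Rightarrow> nat \<Rightarrow> (nat \<times> nat) mpoly" where
  "Q_elt i j = sym_lin (s_form i j) * sym_lin (sigma_form i j)"

definition W'_space :: "(nat \<times> nat) mpoly set" where
  "W'_space = Modules.module.span pscale {Q_elt i j | i j. (i, j) \<in> idx}"

definition W_rep ::
    "((nat \<Rightarrow> nat) \<Rightarrow> nat mpoly \<Rightarrow> nat mpoly) \<Rightarrow> (nat \<Rightarrow> nat, (nat \<times> nat) mpoly) rep" where
  "W_rep \<rho> = \<lparr> rspace = W_space, rscale = pscale, ract = sym_act \<rho> \<rparr>"

definition W'_rep ::
    "((nat \<Rightarrow> nat) \<Rightarrow> nat mpoly \<Rightarrow> nat mpoly) \<Rightarrow> (nat \<Rightarrow> nat, (nat \<times> nat) mpoly) rep" where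
  "W'_rep \<rho> = \<lparr> rspace = W'_space, rscale = pscale, ract = sym_act \<rho> \<rparr>"


section \<open>Combinatorial pentagons\<close>

text \<open>The numeral type \<^typ>\<open>5\<close> is the ring of integers modulo 5.\<close>

definition pentagons :: "(5 \<Rightarrow> nat) set" where
  "pentagons = {p. bij_betw p UNIV {1..5}}"

definition oriented :: "(5 \<Rightarrow> nat) \<Rightarrow> (5 \<Rightarrow> nat) set" where
  "oriented p = {(\<lambda>i. p (i + a)) | a. True}"

definition unoriented :: "(5 \<Rightarrow> nat) \<Rightarrow> (5 \<Rightarrow> nat) set" where
  "unoriented p = {(\<lambda>i. p (i + a)) | a. True} \<union> {(\<lambda>i. p (- i + a)) | a. True}"

definition oriented_pentagons :: "(5 \<Rightarrow> nat) set set" where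
  "oriented_pentagons = oriented ` pentagons"

definition oriented_act :: "(nat \<Rightarrow> nat) \<Rightarrow> (5 \<Rightarrow> nat) set \<Rightarrow> (5 \<Rightarrow> nat) set" where
  "oriented_act g P = (\<lambda>p. g \<circ> p) ` P"

definition double_pentagons :: "(5 \<Rightarrow> nat) set set set" where
  "double_pentagons = {{unoriented p, unoriented (\<lambda>i. p (2 * i))} | p. p \<in> pentagons}"

definition double_act :: "(nat \<Rightarrow> nat) \<Rightarrow> (5 \<Rightarrow> nat) set set \<Rightarrow> (5 \<Rightarrow> nat) set set" where
  "double_act g D = (\<lambda>P. (\<lambda>p. g \<circ> p) ` P) ` D"

definition D_rep :: "(nat \<Rightarrow> nat, (5 \<Rightarrow> nat) set set \<Rightarrow>\<^sub>0 complex) rep" where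
  "D_rep = perm_rep double_pentagons double_act"

end

theory Submission
  imports Defs
begin

text \<open>The stabiliser of \<open>s\<^sub>1\<^sub>2\<close> in \<open>S\<^sub>5\<close> is generated by a 5-cycle, so \<open>\<M> = S\<^sub>5 / C\<^sub>5\<close>. A generator of
  \<open>Aff(1, \<int>/5)\<close> modulo translations maps \<open>s\<^sub>1\<^sub>2 \<mapsto> \<sigma>\<^sub>1\<^sub>2 \<mapsto> -s\<^sub>1\<^sub>2\<close>, and \<open>S\<^sub>3\<close> is a transversal of
  \<open>Aff(1, \<int>/5)\<close>: the 120 products are distinct because the 24 elements of \<open>\<M>\<close> are. Hence double
  pentagons correspond to the sets \<open>{\<plusminus>s\<^sub>i\<^sub>j, \<plusminus>\<sigma>\<^sub>i\<^sub>j}\<close>, and the elements \<open>Q\<^sub>i\<^sub>j\<close> of \<open>W'\<close> are permuted, up to the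
  sign character, like double pentagons. All \<open>Q\<^sub>i\<^sub>j\<close> restrict to the same section of \<open>-2K\<close> (the sum of
  the ten lines), so \<open>W\<close> is the kernel of the sum of coefficients on \<open>W'\<close>, complemented by \<open>\<Sum> Q\<^sub>i\<^sub>j\<close>.
  The decomposition of \<open>M\<close> is the map \<open>[m] \<mapsto> (m, \<plusminus>m, [d], \<plusminus>[d])\<close>, where \<open>d\<close> is the double pentagon of
  \<open>m = g s\<^sub>1\<^sub>2\<close> and the sign is that of \<open>g\<close>.\<close>

section \<open>Polynomials\<close>

text \<open>Right multiplication by the generator of Aff(1, Z/5) modulo translations acts on S5/C5
  with order 4 and commutes with the left action; this is why \<open>M\<close> splits. Its
  eigenvalue 1 yields the coefficient functions constant on double pentagons, its eigenvalue -1
  their twist by the sign, since the generator is odd. Where its square is -1, the functions are odd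
  under negation of \<open>m\<close>; this part has dimension 12. That it is \<open>V\<close> plus
  the twist of \<open>V\<close> is not formal: it is settled by a linear system in the coordinates
  with respect to the \<open>s_form i j\<close>. Replacing the twist of \<open>V\<close> by
  \<open>V\<close> itself then needs an explicit intertwiner. The action is given only by values on
  generators, and none is given on sextic forms. So a general permutation is handled through a
  normal form of S5 and the images of \<open>s_form 1 2\<close> and \<open>sigma_form 1 2\<close>
  under it, and the stability of \<open>W\<close> is deduced from explicit formulas on
  \<open>W'\<close>.\<close>

lemma sum_single_lookup:
  "(p :: 'a \<Rightarrow>\<^sub>0 'b::comm_monoid_add) = (\<Sum>m\<in>Poly_Mapping.keys p. Poly_Mapping.single m (Poly_Mapping.lookup p m))"
proof (rule poly_mapping_eqI)
  fix k
  have "Poly_Mapping.lookup (\<Sum>m\<in>Poly_Mapping.keys p. Poly_Mapping.single m (Poly_Mapping.lookup p m)) k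
      = (\<Sum>m\<in>Poly_Mapping.keys p. if k = m then Poly_Mapping.lookup p m else 0)"
    by (simp add: lookup_sum lookup_single when_def eq_commute)
  also have "\<dots> = Poly_Mapping.lookup p k"
    by (simp add: sum.delta in_keys_iff)
  finally show "Poly_Mapping.lookup p k = Poly_Mapping.lookup
      (\<Sum>m\<in>Poly_Mapping.keys p. Poly_Mapping.single m (Poly_Mapping.lookup p m)) k" by simp
qed

lemma pscale_eq_mult: "pscale c p = pconst c * p" for p :: "'x mpoly"
  unfolding pscale_def pconst_def by (rule mult_map_scale_conv_mult)

lemma pconst_0 [simp]: "pconst 0 = 0"
  and pconst_1 [simp]: "pconst 1 = 1"
  by (simp_all add: pconst_def)

lemma pconst_add: "pconst (a + b) = pconst a + pconst b"
  and pconst_mult: "pconst (a * b) = pconst a * pconst b"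
  and pconst_uminus: "pconst (- a) = - pconst a"
  by (simp_all add: pconst_def single_add mult_single single_uminus)

lemma pconst_numeral: "pconst (numeral n) = numeral n"
  by (simp add: pconst_def)

section \<open>Evaluation homomorphisms\<close>

definition ring_hom_fun :: "('a::comm_ring_1 \<Rightarrow> 'b::comm_ring_1) \<Rightarrow> bool" where
  "ring_hom_fun h \<longleftrightarrow>
     h 0 = 0 \<and> h 1 = 1 \<and> (\<forall>a b. h (a + b) = h a + h b) \<and> (\<forall>a b. h (a * b) = h a * h b)"

lemma ring_hom_fun_id: "ring_hom_fun id"
  by (simp add: ring_hom_fun_def)

lemma ring_hom_fun_pconst: "ring_hom_fun pconst"
  by (simp add: ring_hom_fun_def pconst_add pconst_mult)

lemma ring_hom_fun_sum:
  assumes "ring_hom_fun h" shows "h (\<Sum>x\<in>A. f x) = (\<Sum>x\<in>A. h (f x))"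
  using assms by (induction A rule: infinite_finite_induct) (auto simp: ring_hom_fun_def)

lemma ring_hom_fun_prod:
  assumes "ring_hom_fun h" shows "h (\<Prod>x\<in>A. f x) = (\<Prod>x\<in>A. h (f x))"
  using assms by (induction A rule: infinite_finite_induct) (auto simp: ring_hom_fun_def)

lemma ring_hom_fun_power:
  assumes "ring_hom_fun h" shows "h (x ^ n) = h x ^ n"
  using assms by (induction n) (auto simp: ring_hom_fun_def)

definition monom_val :: "('x \<Rightarrow> 'b::comm_ring_1) \<Rightarrow> ('x \<Rightarrow>\<^sub>0 nat) \<Rightarrow> 'b" where
  "monom_val a m = (\<Prod>i\<in>Poly_Mapping.keys m. a i ^ Poly_Mapping.lookup m i)"

lemma monom_val_superset:
  assumes "finite K" "Poly_Mapping.keys m \<subseteq> K"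
  shows "monom_val a m = (\<Prod>i\<in>K. a i ^ Poly_Mapping.lookup m i)"
  unfolding monom_val_def
  by (rule prod.mono_neutral_left) (use assms in \<open>auto simp: in_keys_iff\<close>)

lemma monom_val_add: "monom_val a (m + n) = monom_val a m * monom_val a n"
proof -
  let ?K = "Poly_Mapping.keys m \<union> Poly_Mapping.keys n"
  have "Poly_Mapping.keys (m + n) \<subseteq> ?K" by (rule Poly_Mapping.keys_add)
  then show ?thesis
    by (simp add: monom_val_superset[of ?K] lookup_add power_add prod.distrib)
qed

text \<open>Coefficients may cancel in a sum, so its keys are only contained in the union of the
  keys. Over a common finite superset all sums run over the same monomials, the extra terms
  vanishing because \<open>h 0 = 0\<close>.\<close>

lemma peval_superset:
  assumes "ring_hom_fun h" "finite K" "Poly_Mapping.keys p \<subseteq> K"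
  shows "peval h a p = (\<Sum>m\<in>K. h (Poly_Mapping.lookup p m) * monom_val a m)"
  unfolding peval_def monom_val_def[symmetric]
  by (rule sum.mono_neutral_left) (use assms in \<open>auto simp: in_keys_iff ring_hom_fun_def\<close>)

lemma peval_single:
  assumes "ring_hom_fun h"
  shows "peval h a (Poly_Mapping.single m c) = h c * monom_val a m"
  by (subst peval_superset[OF assms, of "{m}"]) (auto simp: assms)

lemma peval_0 [simp]: "peval h a 0 = 0"
  by (simp add: peval_def)

lemma peval_add:
  assumes "ring_hom_fun h"
  shows "peval h a (p + q) = peval h a p + peval h a q"
proof -
  let ?K = "Poly_Mapping.keys p \<union> Poly_Mapping.keys q"
  have "Poly_Mapping.keys (p + q) \<subseteq> ?K" by (rule Poly_Mapping.keys_add)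
  then show ?thesis
    using assms unfolding ring_hom_fun_def
    by (simp add: peval_superset[OF assms, of ?K] lookup_add sum.distrib ring_distribs)
qed

lemma peval_sum:
  assumes "ring_hom_fun h"
  shows "peval h a (\<Sum>x\<in>A. f x) = (\<Sum>x\<in>A. peval h a (f x))"
  by (induction A rule: infinite_finite_induct) (auto simp: peval_add[OF assms])

lemma peval_mult:
  assumes "ring_hom_fun h"
  shows "peval h a (p * q) = peval h a p * peval h a q"
proof -
  let ?s = "\<lambda>p m. Poly_Mapping.single m (Poly_Mapping.lookup p m)"
  have "p * q = (\<Sum>m\<in>Poly_Mapping.keys p. \<Sum>n\<in>Poly_Mapping.keys q. ?s p m * ?s q n)"
    by (subst (1) sum_single_lookup[of p], subst (1) sum_single_lookup[of q]) (rule sum_product)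
  moreover have "peval h a (?s p m * ?s q n) = peval h a (?s p m) * peval h a (?s q n)" for m n
    using assms by (simp add: mult_single peval_single monom_val_add ring_hom_fun_def algebra_simps)
  ultimately have "peval h a (p * q) = (\<Sum>m\<in>Poly_Mapping.keys p. \<Sum>n\<in>Poly_Mapping.keys q.
      peval h a (?s p m) * peval h a (?s q n))"
    by (simp add: peval_sum[OF assms])
  also have "\<dots> = peval h a (\<Sum>m\<in>Poly_Mapping.keys p. ?s p m) * peval h a (\<Sum>n\<in>Poly_Mapping.keys q. ?s q n)"
    by (simp add: peval_sum[OF assms] sum_product)
  finally show ?thesis by (simp flip: sum_single_lookup)
qed

lemma peval_pconst [simp]:
  assumes "ring_hom_fun h" shows "peval h a (pconst c) = h c"
  using assms by (simp add: pconst_def peval_single monom_val_def)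

lemma peval_pvar [simp]:
  assumes "ring_hom_fun h" shows "peval h a (pvar i) = a i"
  using assms by (simp add: pvar_def peval_single monom_val_def ring_hom_fun_def)

lemma peval_1 [simp]:
  assumes "ring_hom_fun h" shows "peval h a 1 = 1"
  using peval_pconst[OF assms, of a 1] assms by (simp add: ring_hom_fun_def)

lemma ring_hom_fun_peval:
  assumes "ring_hom_fun h" shows "ring_hom_fun (peval h a)"
  using assms by (simp add: ring_hom_fun_def peval_add[OF assms] peval_mult[OF assms])

lemma ring_hom_fun_uminus:
  assumes "ring_hom_fun h" shows "h (- x) = - h x"
proof -
  have "h (- x) + h x = 0"
    using assms unfolding ring_hom_fun_def by (metis add.left_inverse)
  then show ?thesis by (simp add: eq_neg_iff_add_eq_0)
qed

lemma ring_hom_fun_diff: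
  assumes "ring_hom_fun h" shows "h (x - y) = h x - h y"
  using assms ring_hom_fun_uminus[OF assms, of y] unfolding ring_hom_fun_def
  by (metis add_uminus_conv_diff)

text \<open>Substitution followed by evaluation. With \<open>h = id\<close> it turns the value of
  \<open>sym_mult q\<close> at a point of the plane into the value of the quadratic form
  \<open>q\<close> at the vector of values of the \<open>s_form i j\<close> at that point.\<close>

lemma peval_peval:
  assumes "ring_hom_fun h"
  shows "peval h x (peval pconst a q) = peval h (\<lambda>i. peval h x (a i)) q"
proof -
  note hom = ring_hom_fun_peval[OF assms, of x]
  have "peval h x (p * q) = peval h x p * peval h x q" for p q
    by (rule peval_mult[OF assms])
  then show ?thesis
    unfolding peval_def[of pconst] peval_def[of h "\<lambda>i. peval h x (a i)"]
    by (simp add: ring_hom_fun_sum[OF hom] ring_hom_fun_prod[OF hom] ring_hom_fun_power[OF hom] assms)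
qed

lemmas peval_id_simps =
  peval_add[OF ring_hom_fun_id] peval_mult[OF ring_hom_fun_id] peval_pvar[OF ring_hom_fun_id]
  peval_pconst[OF ring_hom_fun_id] ring_hom_fun_diff[OF ring_hom_fun_peval[OF ring_hom_fun_id]]
  ring_hom_fun_uminus[OF ring_hom_fun_peval[OF ring_hom_fun_id]] peval_1[OF ring_hom_fun_id]
  peval_sum[OF ring_hom_fun_id]

lemmas peval_pconst_simps =
  peval_add[OF ring_hom_fun_pconst] peval_mult[OF ring_hom_fun_pconst]
  peval_pvar[OF ring_hom_fun_pconst] peval_pconst[OF ring_hom_fun_pconst]
  ring_hom_fun_diff[OF ring_hom_fun_peval[OF ring_hom_fun_pconst]]
  ring_hom_fun_uminus[OF ring_hom_fun_peval[OF ring_hom_fun_pconst]]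
  peval_1[OF ring_hom_fun_pconst] peval_sum[OF ring_hom_fun_pconst]

section \<open>Degrees of monomials and spaces of forms\<close>

definition mdeg :: "('x \<Rightarrow>\<^sub>0 nat) \<Rightarrow> nat" where
  "mdeg m = (\<Sum>i\<in>Poly_Mapping.keys m. Poly_Mapping.lookup m i)"

lemma mdeg_superset:
  assumes "finite K" "Poly_Mapping.keys m \<subseteq> K"
  shows "mdeg m = (\<Sum>i\<in>K. Poly_Mapping.lookup m i)"
  unfolding mdeg_def
  by (rule sum.mono_neutral_left) (use assms in \<open>auto simp: in_keys_iff\<close>)

lemma mdeg_add: "mdeg (m + n) = mdeg m + mdeg n"
proof -
  let ?K = "Poly_Mapping.keys m \<union> Poly_Mapping.keys n"
  have "Poly_Mapping.keys (m + n) \<subseteq> ?K" by (rule Poly_Mapping.keys_add)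
  then show ?thesis
    by (simp add: mdeg_superset[of ?K] lookup_add sum.distrib)
qed

lemma mdeg_single [simp]: "mdeg (Poly_Mapping.single i k) = k"
  by (simp add: mdeg_def)

lemma forms_iff:
  "p \<in> forms d X \<longleftrightarrow> (\<forall>m\<in>Poly_Mapping.keys p. Poly_Mapping.keys m \<subseteq> X \<and> mdeg m = d)"
  by (simp add: forms_def mdeg_def)

lemma forms_0 [simp]: "0 \<in> forms d X"
  by (simp add: forms_iff)

lemma forms_add: "p \<in> forms d X \<Longrightarrow> q \<in> forms d X \<Longrightarrow> p + q \<in> forms d X"
  using Poly_Mapping.keys_add[of p q] unfolding forms_iff by blast

lemma forms_uminus: "p \<in> forms d X \<Longrightarrow> - p \<in> forms d X"
  by (simp add: forms_iff in_keys_iff)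

lemma forms_diff: "p \<in> forms d X \<Longrightarrow> q \<in> forms d X \<Longrightarrow> p - q \<in> forms d X"
  using forms_add[of p d X "- q"] forms_uminus[of q d X] by simp

lemma forms_sum: "(\<And>x. x \<in> A \<Longrightarrow> f x \<in> forms d X) \<Longrightarrow> (\<Sum>x\<in>A. f x) \<in> forms d X"
  by (induction A rule: infinite_finite_induct) (auto intro: forms_add)

lemma forms_pscale: "p \<in> forms d X \<Longrightarrow> pscale c p \<in> forms d X"
  by (auto simp: forms_iff in_keys_iff)

lemma forms_mult:
  assumes "p \<in> forms d X" "q \<in> forms e X" shows "p * q \<in> forms (d + e) X"
  unfolding forms_iff
proof
  fix k assume "k \<in> Poly_Mapping.keys (p * q)"
  then obtain m n where k: "k = m + n" "m \<in> Poly_Mapping.keys p" "n \<in> Poly_Mapping.keys q"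
    using keys_mult[of p q] by auto
  then show "Poly_Mapping.keys k \<subseteq> X \<and> mdeg k = d + e"
    using assms Poly_Mapping.keys_add[of m n] unfolding forms_iff by (simp add: mdeg_add) blast
qed

lemma forms_pvar: "i \<in> X \<Longrightarrow> pvar i \<in> forms 1 X"
  by (simp add: pvar_def forms_iff)

lemma forms_0_pconst: "p \<in> forms 0 X \<Longrightarrow> \<exists>c. p = pconst c"
proof -
  assume p: "p \<in> forms 0 X"
  have "Poly_Mapping.keys p \<subseteq> {0}"
  proof
    fix m assume "m \<in> Poly_Mapping.keys p"
    then have "mdeg m = 0" using p by (simp add: forms_iff)
    then have "Poly_Mapping.keys m = {}" by (fastforce simp: mdeg_def simp flip: in_keys_iff)
    then show "m \<in> {0}" by (simp only: keys_eq_empty singleton_iff)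
  qed
  then have "p = pconst (Poly_Mapping.lookup p 0)"
    by (intro poly_mapping_eqI) (auto simp: pconst_def lookup_single when_def in_keys_iff)
  then show ?thesis by blast
qed

text \<open>The polynomials that admit such an expression are closed under sums, so it suffices to
  split a variable off a single monomial. Iterated, this replaces an abstract form of degree 2 or 3
  by finitely many scalars on which one can compute.\<close>

lemma forms_Suc:
  assumes "finite X" and p: "p \<in> forms (Suc d) X"
  shows "\<exists>q. (\<forall>i\<in>X. q i \<in> forms d X) \<and> p = (\<Sum>i\<in>X. pvar i * q i)"
proof -
  define G where "G = {p. \<exists>q. (\<forall>i\<in>X. q i \<in> forms d X) \<and> p = (\<Sum>i\<in>X. pvar i * q i)}"
  have G_add: "p + p' \<in> G" if p: "p \<in> G" and p': "p' \<in> G" for p p'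
  proof -
    obtain q q' where "\<forall>i\<in>X. q i \<in> forms d X" "p = (\<Sum>i\<in>X. pvar i * q i)"
        "\<forall>i\<in>X. q' i \<in> forms d X" "p' = (\<Sum>i\<in>X. pvar i * q' i)"
      using p p' unfolding G_def by blast
    then show ?thesis
      unfolding G_def by (intro CollectI exI[of _ "\<lambda>i. q i + q' i"])
        (auto simp: forms_add ring_distribs sum.distrib)
  qed
  have G_0: "0 \<in> G" unfolding G_def by (intro CollectI exI[of _ "\<lambda>_. 0"]) auto
  have G_sum: "(\<Sum>x\<in>A. f x) \<in> G" if "\<And>x. x \<in> A \<Longrightarrow> f x \<in> G" for A and f :: "('a \<Rightarrow>\<^sub>0 nat) \<Rightarrow> _"
    using that by (induction A rule: infinite_finite_induct) (auto intro: G_add G_0)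
  have "Poly_Mapping.single m c \<in> G" if m: "Poly_Mapping.keys m \<subseteq> X" "mdeg m = Suc d" for m c
  proof -
    obtain i where i: "i \<in> Poly_Mapping.keys m" using m(2) by (fastforce simp: mdeg_def)
    \<comment> \<open>The truncated subtraction of exponents is exact because \<open>i\<close>
      occurs in \<open>m\<close>.\<close>
    define n where "n = m - Poly_Mapping.single i 1"
    have n: "m = Poly_Mapping.single i 1 + n"
    proof (rule poly_mapping_eqI)
      fix k show "Poly_Mapping.lookup m k = Poly_Mapping.lookup (Poly_Mapping.single i 1 + n) k"
        using i by (auto simp: n_def lookup_add lookup_minus lookup_single when_def in_keys_iff)
    qed
    have "Poly_Mapping.keys n \<subseteq> X"
      using m(1) by (auto simp: n_def in_keys_iff lookup_minus)
    moreover have "mdeg n = d" using m(2) by (simp add: n mdeg_add)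
    ultimately have "Poly_Mapping.single n c \<in> forms d X" by (simp add: forms_iff)
    moreover have "Poly_Mapping.single m c = (\<Sum>j\<in>X. pvar j * (if j = i then Poly_Mapping.single n c else 0))"
      using i m(1) \<open>finite X\<close>
      by (subst n) (auto simp: pvar_def mult_single if_distrib[of "(*) _"] sum.delta cong: if_cong)
    ultimately show ?thesis
      unfolding G_def by (intro CollectI exI[of _ "\<lambda>j. if j = i then Poly_Mapping.single n c else 0"]) auto
  qed
  then have "(\<Sum>m\<in>Poly_Mapping.keys p. Poly_Mapping.single m (Poly_Mapping.lookup p m)) \<in> G"
    using p by (intro G_sum) (auto simp: forms_iff)
  then show ?thesis by (simp add: G_def flip: sum_single_lookup)
qed

section \<open>Representations\<close>

lemma is_repD:
  assumes "is_rep G R"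
  shows "vector_space (rscale R)" "Modules.module.subspace (rscale R) (rspace R)"
    "\<And>g. g \<in> carrier G \<Longrightarrow> linear_between R R (ract R g)"
    "\<And>v. v \<in> rspace R \<Longrightarrow> ract R \<one>\<^bsub>G\<^esub> v = v"
    "\<And>g h v. g \<in> carrier G \<Longrightarrow> h \<in> carrier G \<Longrightarrow> v \<in> rspace R \<Longrightarrow>
        ract R (g \<otimes>\<^bsub>G\<^esub> h) v = ract R g (ract R h v)"
  using assms unfolding is_rep_def by auto

lemma is_repI:
  assumes "vector_space (rscale R)" "Modules.module.subspace (rscale R) (rspace R)"
    "\<And>g. g \<in> carrier G \<Longrightarrow> linear_between R R (ract R g)"
    "\<And>v. v \<in> rspace R \<Longrightarrow> ract R \<one>\<^bsub>G\<^esub> v = v"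
    "\<And>g h v. g \<in> carrier G \<Longrightarrow> h \<in> carrier G \<Longrightarrow> v \<in> rspace R \<Longrightarrow>
        ract R (g \<otimes>\<^bsub>G\<^esub> h) v = ract R g (ract R h v)"
  shows "is_rep G R"
  using assms unfolding is_rep_def by auto

lemma linear_betweenD:
  assumes "linear_between R S f"
  shows "\<And>v. v \<in> rspace R \<Longrightarrow> f v \<in> rspace S"
    "\<And>u v. u \<in> rspace R \<Longrightarrow> v \<in> rspace R \<Longrightarrow> f (u + v) = f u + f v"
    "\<And>c v. v \<in> rspace R \<Longrightarrow> f (rscale R c v) = rscale S c (f v)"
  using assms unfolding linear_between_def by auto

lemma linear_betweenI:
  assumes "\<And>v. v \<in> rspace R \<Longrightarrow> f v \<in> rspace S"
    "\<And>u v. u \<in> rspace R \<Longrightarrow> v \<in> rspace R \<Longrightarrow> f (u + v) = f u + f v"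
    "\<And>c v. v \<in> rspace R \<Longrightarrow> f (rscale R c v) = rscale S c (f v)"
  shows "linear_between R S f"
  using assms unfolding linear_between_def by auto

lemma subspace_iff:
  assumes "vector_space s"
  shows "Modules.module.subspace s S \<longleftrightarrow>
    0 \<in> S \<and> (\<forall>x\<in>S. \<forall>y\<in>S. x + y \<in> S) \<and> (\<forall>c. \<forall>x\<in>S. s c x \<in> S)"
  using assms by (simp add: module.subspace_def module_iff_vector_space)

lemma vector_space_simps:
  assumes "vector_space s"
  shows "s a (x + y) = s a x + s a y" "s (a + b) x = s a x + s b x"
    "s a (s b x) = s (a * b) x" "s 1 x = x" "s a 0 = 0" "s 0 x = 0" "s (- 1) x = - x"
proof -
  interpret vector_space s by fact
  show "s a (x + y) = s a x + s a y" "s (a + b) x = s a x + s b x"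
    "s a (s b x) = s (a * b) x" "s 1 x = x" "s a 0 = 0" "s 0 x = 0" "s (- 1) x = - x"
    by (simp_all add: scale_right_distrib scale_left_distrib)
qed

lemma rep_space_closed:
  assumes "is_rep G R"
  shows "0 \<in> rspace R" "\<And>x y. x \<in> rspace R \<Longrightarrow> y \<in> rspace R \<Longrightarrow> x + y \<in> rspace R"
    "\<And>c x. x \<in> rspace R \<Longrightarrow> rscale R c x \<in> rspace R"
    "\<And>g x. g \<in> carrier G \<Longrightarrow> x \<in> rspace R \<Longrightarrow> ract R g x \<in> rspace R"
  using is_repD[OF assms] by (auto simp: subspace_iff dest: linear_betweenD)

lemma linear_between_0:
  assumes "vector_space (rscale R)" "vector_space (rscale S)" "linear_between R S f" "0 \<in> rspace R"
  shows "f 0 = 0"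
  using linear_betweenD(3)[OF assms(3,4), of 0] assms(1,2)
  by (simp add: vector_space_simps)

text \<open>Of \<open>S\<close> only the vector space structure is assumed: the subspace, linearity
  and action laws are carried over along \<open>f\<close>. In this way twists and
  \<open>W'_rep\<close> become representations as images of known ones.\<close>

lemma rep_iso_transport:
  fixes R :: "('g, 'v::ab_group_add) rep" and S :: "('g, 'w::ab_group_add) rep"
  assumes G: "group G" and R: "is_rep G R" and S: "vector_space (rscale S)"
    and bij: "bij_betw f (rspace R) (rspace S)" and lin: "linear_between R S f"
    and eq: "\<And>g v. g \<in> carrier G \<Longrightarrow> v \<in> rspace R \<Longrightarrow> f (ract R g v) = ract S g (f v)"
  shows "rep_iso G R S"
proof -
  note clR = rep_space_closed[OF R] and linD = linear_betweenD[OF lin]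
  have img: "\<exists>v\<in>rspace R. w = f v" if "w \<in> rspace S" for w
    using bij that by (auto simp: bij_betw_def)
  have mult: "g \<otimes>\<^bsub>G\<^esub> h \<in> carrier G" if "g \<in> carrier G" "h \<in> carrier G" for g h
    using G that by (simp add: group_def monoid.m_closed)
  have one: "\<one>\<^bsub>G\<^esub> \<in> carrier G" using G by (simp add: group_def monoid.one_closed)
  have sum_S: "x + y \<in> rspace S" if "x \<in> rspace S" "y \<in> rspace S" for x y
    using img[OF that(1)] img[OF that(2)] linD clR by metis
  have scale_S: "rscale S c x \<in> rspace S" if "x \<in> rspace S" for c x
    using img[OF that] linD clR by metis
  have f0: "f 0 = 0"
    using linear_between_0[OF is_repD(1)[OF R] S lin] clR by blast
  have "is_rep G S"
  proof (rule is_repI)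
    show "Modules.module.subspace (rscale S) (rspace S)"
      unfolding subspace_iff[OF S] using sum_S scale_S f0 linD(1)[OF clR(1)] by auto
  next
    fix g assume g: "g \<in> carrier G"
    note linR = linear_betweenD[OF is_repD(3)[OF R g]]
    show "linear_between S S (ract S g)"
    proof (rule linear_betweenI)
      fix v assume "v \<in> rspace S"
      then obtain v' where v': "v' \<in> rspace R" "v = f v'" using img by blast
      then show "ract S g v \<in> rspace S"
        using eq[OF g v'(1)] linD clR g by metis
      fix c show "ract S g (rscale S c v) = rscale S c (ract S g v)"
        using v' eq[OF g] linD(3) linR clR by metis
      fix w assume "w \<in> rspace S"
      then obtain w' where w': "w' \<in> rspace R" "w = f w'" using img by blast
      then show "ract S g (v + w) = ract S g v + ract S g w"
        using v' eq[OF g] linD(2) linR clR by metis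
    qed
  next
    fix v assume "v \<in> rspace S"
    then obtain v' where v': "v' \<in> rspace R" "v = f v'" using img by blast
    then show "ract S \<one>\<^bsub>G\<^esub> v = v" using eq[OF one v'(1)] is_repD(4)[OF R] by simp
    fix g h assume gh: "g \<in> carrier G" "h \<in> carrier G"
    have "ract R h v' \<in> rspace R" using v' gh clR by simp
    then show "ract S (g \<otimes>\<^bsub>G\<^esub> h) v = ract S g (ract S h v)"
      using v' gh eq[OF mult[OF gh] v'(1)] eq[of g "ract R h v'"] eq[of h v'] is_repD(5)[OF R gh v'(1)]
      by simp
  qed (fact S)
  then show ?thesis using R bij lin eq unfolding rep_iso_def by blast
qed

lemma rep_iso_refl: "is_rep G R \<Longrightarrow> rep_iso G R R"
  unfolding rep_iso_def linear_between_def by (auto intro!: exI[of _ id])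

lemma rep_iso_sym:
  assumes "rep_iso G R S" shows "rep_iso G S R"
proof -
  obtain f where R: "is_rep G R" and S: "is_rep G S" and bij: "bij_betw f (rspace R) (rspace S)"
    and lin: "linear_between R S f"
    and eq: "\<And>g v. g \<in> carrier G \<Longrightarrow> v \<in> rspace R \<Longrightarrow> f (ract R g v) = ract S g (f v)"
    using assms unfolding rep_iso_def by blast
  note linD = linear_betweenD[OF lin]
  define f' where "f' = inv_into (rspace R) f"
  have bij': "bij_betw f' (rspace S) (rspace R)"
    unfolding f'_def by (rule bij_betw_inv_into[OF bij])
  have f'f: "f' (f v) = v" if "v \<in> rspace R" for v
    using bij that by (simp add: f'_def bij_betw_def)
  have img: "\<exists>v\<in>rspace R. w = f v" if "w \<in> rspace S" for w
    using bij that by (auto simp: bij_betw_def)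
  have "linear_between S R f'"
  proof (rule linear_betweenI)
    fix v assume "v \<in> rspace S"
    then obtain v' where v': "v' \<in> rspace R" "v = f v'" using img by blast
    then show "f' v \<in> rspace R" by (simp add: f'f)
    fix c show "f' (rscale S c v) = rscale R c (f' v)"
      using v' f'f linD(3) rep_space_closed[OF R] by metis
    fix w assume "w \<in> rspace S"
    then obtain w' where w': "w' \<in> rspace R" "w = f w'" using img by blast
    then show "f' (v + w) = f' v + f' w"
      using v' f'f linD(2) rep_space_closed[OF R] by metis
  qed
  moreover have "f' (ract S g v) = ract R g (f' v)" if g: "g \<in> carrier G" and v: "v \<in> rspace S" for g v
  proof -
    obtain v' where v': "v' \<in> rspace R" "v = f v'" using img[OF v] by blast
    then show ?thesis using eq[OF g v'(1)] f'f rep_space_closed(4)[OF R g v'(1)] by metis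
  qed
  ultimately show ?thesis using R S bij' unfolding rep_iso_def by blast
qed

lemma rep_iso_trans [trans]:
  assumes "rep_iso G R S" "rep_iso G S T" shows "rep_iso G R T"
proof -
  obtain f where R: "is_rep G R" and bij: "bij_betw f (rspace R) (rspace S)"
    and lin: "linear_between R S f"
    and eq: "\<And>g v. g \<in> carrier G \<Longrightarrow> v \<in> rspace R \<Longrightarrow> f (ract R g v) = ract S g (f v)"
    using assms(1) unfolding rep_iso_def by blast
  obtain f' where T: "is_rep G T" and bij': "bij_betw f' (rspace S) (rspace T)"
    and lin': "linear_between S T f'"
    and eq': "\<And>g v. g \<in> carrier G \<Longrightarrow> v \<in> rspace S \<Longrightarrow> f' (ract S g v) = ract T g (f' v)"
    using assms(2) unfolding rep_iso_def by blast
  have "linear_between R T (f' \<circ> f)"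
    using linear_betweenD[OF lin] linear_betweenD[OF lin'] by (intro linear_betweenI) auto
  moreover have "(f' \<circ> f) (ract R g v) = ract T g ((f' \<circ> f) v)"
    if "g \<in> carrier G" "v \<in> rspace R" for g v
    using that eq[OF that] eq' linear_betweenD(1)[OF lin] by simp
  ultimately show ?thesis
    using R T bij_betw_trans[OF bij bij'] unfolding rep_iso_def by blast
qed

lemma rep_iso_is_rep: "rep_iso G R S \<Longrightarrow> is_rep G R" "rep_iso G R S \<Longrightarrow> is_rep G S"
  by (auto simp: rep_iso_def)

section \<open>Direct sums, twists and subrepresentations\<close>

lemma rep_sum_sel [simp]:
  "rspace (R \<boxplus> S) = rspace R \<times> rspace S"
  "rscale (R \<boxplus> S) c x = (rscale R c (fst x), rscale S c (snd x))"
  "ract (R \<boxplus> S) g x = (ract R g (fst x), ract S g (snd x))"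
  by (auto simp: rep_sum_def split: prod.split)

lemma rep_twist_sel [simp]:
  "rspace (R \<boxtimes> \<chi>) = rspace R" "rscale (R \<boxtimes> \<chi>) = rscale R"
  "ract (R \<boxtimes> \<chi>) g x = rscale R (\<chi> g) (ract R g x)"
  by (auto simp: rep_twist_def)

lemma is_rep_sum:
  assumes R: "is_rep G R" and S: "is_rep G S" shows "is_rep G (R \<boxplus> S)"
proof -
  note vR = vector_space_simps[OF is_repD(1)[OF R]] and vS = vector_space_simps[OF is_repD(1)[OF S]]
  have vs: "vector_space (rscale (R \<boxplus> S))"
    by unfold_locales (auto simp: vR vS)
  show ?thesis
  proof (rule is_repI)
    show "Modules.module.subspace (rscale (R \<boxplus> S)) (rspace (R \<boxplus> S))"
      unfolding subspace_iff[OF vs]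
      using rep_space_closed[OF R] rep_space_closed[OF S] by (auto simp: zero_prod_def)
  next
    fix g assume g: "g \<in> carrier G"
    show "linear_between (R \<boxplus> S) (R \<boxplus> S) (ract (R \<boxplus> S) g)"
      using linear_betweenD[OF is_repD(3)[OF R g]] linear_betweenD[OF is_repD(3)[OF S g]]
      by (intro linear_betweenI) auto
  qed (use vs is_repD(4,5)[OF R] is_repD(4,5)[OF S] in auto)
qed

lemma rep_iso_sum:
  assumes "rep_iso G R R'" "rep_iso G S S'" shows "rep_iso G (R \<boxplus> S) (R' \<boxplus> S')"
proof -
  obtain f where R: "is_rep G R" "is_rep G R'" and bij: "bij_betw f (rspace R) (rspace R')"
    and lin: "linear_between R R' f"
    and eq: "\<And>g v. g \<in> carrier G \<Longrightarrow> v \<in> rspace R \<Longrightarrow> f (ract R g v) = ract R' g (f v)"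
    using assms(1) unfolding rep_iso_def by blast
  obtain f' where S: "is_rep G S" "is_rep G S'" and bij': "bij_betw f' (rspace S) (rspace S')"
    and lin': "linear_between S S' f'"
    and eq': "\<And>g v. g \<in> carrier G \<Longrightarrow> v \<in> rspace S \<Longrightarrow> f' (ract S g v) = ract S' g (f' v)"
    using assms(2) unfolding rep_iso_def by blast
  have "linear_between (R \<boxplus> S) (R' \<boxplus> S') (map_prod f f')"
    using linear_betweenD[OF lin] linear_betweenD[OF lin'] by (intro linear_betweenI) auto
  then show ?thesis
    using is_rep_sum[OF R(1) S(1)] is_rep_sum[OF R(2) S(2)] bij_betw_map_prod[OF bij bij'] eq eq'
    unfolding rep_iso_def by (auto intro!: exI[of _ "map_prod f f'"])
qed

definition is_char :: "'g monoid \<Rightarrow> ('g \<Rightarrow> complex) \<Rightarrow> bool" where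
  "is_char G \<chi> \<longleftrightarrow> \<chi> \<one>\<^bsub>G\<^esub> = 1 \<and>
     (\<forall>g\<in>carrier G. \<forall>h\<in>carrier G. \<chi> (g \<otimes>\<^bsub>G\<^esub> h) = \<chi> g * \<chi> h)"

lemma is_rep_twist:
  assumes R: "is_rep G R" and \<chi>: "is_char G \<chi>" shows "is_rep G (R \<boxtimes> \<chi>)"
proof (rule is_repI)
  note vR = vector_space_simps[OF is_repD(1)[OF R]]
  fix g assume g: "g \<in> carrier G"
  note linR = linear_betweenD[OF is_repD(3)[OF R g]]
  show "linear_between (R \<boxtimes> \<chi>) (R \<boxtimes> \<chi>) (ract (R \<boxtimes> \<chi>) g)"
    using linR rep_space_closed[OF R] by (intro linear_betweenI) (auto simp: vR mult.commute)
  fix h v assume h: "h \<in> carrier G" and v: "v \<in> rspace (R \<boxtimes> \<chi>)"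
  show "ract (R \<boxtimes> \<chi>) (g \<otimes>\<^bsub>G\<^esub> h) v = ract (R \<boxtimes> \<chi>) g (ract (R \<boxtimes> \<chi>) h v)"
    using g h v \<chi> is_repD(5)[OF R g h, of v] linR(3)[of "ract R h v"] rep_space_closed[OF R]
    by (simp add: is_char_def vR)
qed (use is_repD[OF R] \<chi> in \<open>auto simp: is_char_def vector_space_simps\<close>)

lemma rep_iso_twist:
  assumes "rep_iso G R S" and \<chi>: "is_char G \<chi>" shows "rep_iso G (R \<boxtimes> \<chi>) (S \<boxtimes> \<chi>)"
proof -
  obtain f where R: "is_rep G R" and S: "is_rep G S" and bij: "bij_betw f (rspace R) (rspace S)"
    and lin: "linear_between R S f"
    and eq: "\<And>g v. g \<in> carrier G \<Longrightarrow> v \<in> rspace R \<Longrightarrow> f (ract R g v) = ract S g (f v)"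
    using assms unfolding rep_iso_def by blast
  have "linear_between (R \<boxtimes> \<chi>) (S \<boxtimes> \<chi>) f" using lin by (simp add: linear_between_def)
  then show ?thesis
    using is_rep_twist[OF R \<chi>] is_rep_twist[OF S \<chi>] bij eq linear_betweenD[OF lin]
      rep_space_closed[OF R]
    unfolding rep_iso_def by (auto intro!: exI[of _ f])
qed

lemma rep_sum_twist: "(R \<boxplus> S) \<boxtimes> \<chi> = (R \<boxtimes> \<chi>) \<boxplus> (S \<boxtimes> \<chi>)"
  by (auto simp: rep_sum_def rep_twist_def split: prod.split intro!: ext)

lemma rep_iso_twist_twist:
  assumes R: "is_rep G R" and \<chi>: "is_char G \<chi>" and sq: "\<And>g. g \<in> carrier G \<Longrightarrow> \<chi> g * \<chi> g = 1"
  shows "rep_iso G (R \<boxtimes> \<chi> \<boxtimes> \<chi>) R"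
proof -
  note vR = vector_space_simps[OF is_repD(1)[OF R]]
  have "linear_between (R \<boxtimes> \<chi> \<boxtimes> \<chi>) R id" by (simp add: linear_between_def)
  then show ?thesis
    using is_rep_twist[OF is_rep_twist[OF R \<chi>] \<chi>] R sq
    unfolding rep_iso_def by (auto intro!: exI[of _ id] simp: vR)
qed

lemma is_rep_char: "is_char G \<chi> \<Longrightarrow> is_rep G (char_rep \<chi>)"
  by (rule is_repI)
    (auto simp: char_rep_def is_char_def linear_between_def algebra_simps subspace_iff
      vector_space_def)

lemma is_rep_subrep:
  assumes R: "is_rep G R" and "U \<subseteq> rspace R" "Modules.module.subspace (rscale R) U"
    and "\<And>g u. g \<in> carrier G \<Longrightarrow> u \<in> U \<Longrightarrow> ract R g u \<in> U"
  shows "is_rep G (R\<lparr>rspace := U\<rparr>)"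
proof (rule is_repI)
  fix g assume g: "g \<in> carrier G"
  show "linear_between (R\<lparr>rspace := U\<rparr>) (R\<lparr>rspace := U\<rparr>) (ract (R\<lparr>rspace := U\<rparr>) g)"
    using g assms(2,4) linear_betweenD[OF is_repD(3)[OF R g]]
    by (intro linear_betweenI) (auto simp: subset_iff)
qed (use is_repD[OF R] assms in \<open>auto simp: subset_iff\<close>)

section \<open>Permutation representations\<close>

lemma perm_rep_sel [simp]:
  "rspace (perm_rep X act) = {f. Poly_Mapping.keys f \<subseteq> X}" "rscale (perm_rep X act) = pscale"
  by (simp_all add: perm_rep_def)

lemma perm_rep_act:
  assumes "finite K" "Poly_Mapping.keys f \<subseteq> K"
  shows "ract (perm_rep X act) g f =
    (\<Sum>x\<in>K. Poly_Mapping.single (act g x) (Poly_Mapping.lookup f x))"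
  unfolding perm_rep_def
  by simp (rule sum.mono_neutral_left, use assms in \<open>auto simp: in_keys_iff\<close>)

lemma pscale_single: "pscale c (Poly_Mapping.single x d) = Poly_Mapping.single x (c * d)"
  by (rule poly_mapping_eqI) (auto simp: lookup_single when_def)

lemma pscale_sum: "pscale c (\<Sum>x\<in>A. f x) = (\<Sum>x\<in>A. pscale c (f x))"
  by (rule poly_mapping_eqI) (auto simp: lookup_sum sum_distrib_left)

lemma keys_pscale_subset: "Poly_Mapping.keys (pscale c f) \<subseteq> Poly_Mapping.keys f"
  by (auto simp: in_keys_iff)

lemma perm_rep_act_add:
  "ract (perm_rep X act) g (u + v) = ract (perm_rep X act) g u + ract (perm_rep X act) g v"
  using Poly_Mapping.keys_add[of u v]
  by (simp add: perm_rep_act[of "Poly_Mapping.keys u \<union> Poly_Mapping.keys v"] lookup_add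
      single_add sum.distrib)

lemma perm_rep_act_sum:
  "ract (perm_rep X act) g (\<Sum>x\<in>A. f x) = (\<Sum>x\<in>A. ract (perm_rep X act) g (f x))"
proof (induction A rule: infinite_finite_induct)
  case empty show ?case by (simp add: perm_rep_act[of "{}"])
qed (simp_all add: perm_rep_act_add perm_rep_act[of "{}" 0])

lemma perm_rep_act_single:
  "ract (perm_rep X act) g (Poly_Mapping.single x c) = Poly_Mapping.single (act g x) c"
  by (subst perm_rep_act[of "{x}"]) auto

lemma is_rep_perm:
  assumes X: "is_gset G X act" shows "is_rep G (perm_rep X act)"
proof (rule is_repI)
  show "vector_space (rscale (perm_rep X act))"
    by (simp add: vector_space_pscale)
  show "Modules.module.subspace (rscale (perm_rep X act)) (rspace (perm_rep X act))"
    using Poly_Mapping.keys_add keys_pscale_subset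
    by (fastforce simp: subspace_iff[OF vector_space_pscale])
  fix g assume g: "g \<in> carrier G"
  show "linear_between (perm_rep X act) (perm_rep X act) (ract (perm_rep X act) g)"
  proof (rule linear_betweenI)
    fix f assume f: "f \<in> rspace (perm_rep X act)"
    have "Poly_Mapping.keys (\<Sum>x\<in>Poly_Mapping.keys f. Poly_Mapping.single (act g x) (Poly_Mapping.lookup f x))
      \<subseteq> (\<Union>x\<in>Poly_Mapping.keys f. Poly_Mapping.keys (Poly_Mapping.single (act g x) (Poly_Mapping.lookup f x)))"
      by (rule keys_sum)
    also have "\<dots> \<subseteq> X" using f g X by (auto simp: is_gset_def split: if_splits)
    finally show "ract (perm_rep X act) g f \<in> rspace (perm_rep X act)"
      by (simp add: perm_rep_act[of "Poly_Mapping.keys f"])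
    fix c show "ract (perm_rep X act) g (rscale (perm_rep X act) c f)
        = rscale (perm_rep X act) c (ract (perm_rep X act) g f)"
      using keys_pscale_subset[of c f]
      by (simp add: perm_rep_act[of "Poly_Mapping.keys f"] pscale_sum pscale_single)
  qed (simp add: perm_rep_act_add)
next
  fix v assume v: "v \<in> rspace (perm_rep X act)"
  have "ract (perm_rep X act) \<one>\<^bsub>G\<^esub> v
      = (\<Sum>x\<in>Poly_Mapping.keys v. Poly_Mapping.single x (Poly_Mapping.lookup v x))"
    unfolding perm_rep_act[OF finite_keys order_refl]
    using v X by (intro sum.cong) (auto simp: is_gset_def subset_iff)
  then show "ract (perm_rep X act) \<one>\<^bsub>G\<^esub> v = v" by (simp flip: sum_single_lookup)
  fix g h assume gh: "g \<in> carrier G" "h \<in> carrier G"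
  show "ract (perm_rep X act) (g \<otimes>\<^bsub>G\<^esub> h) v = ract (perm_rep X act) g (ract (perm_rep X act) h v)"
    unfolding perm_rep_act[OF finite_keys[of v] order_refl] perm_rep_act_sum perm_rep_act_single
    using v X gh by (intro sum.cong) (auto simp: is_gset_def subset_iff)
qed

lemma linear_between_sum:
  assumes R: "vector_space (rscale R)" "Modules.module.subspace (rscale R) (rspace R)"
    and S: "vector_space (rscale S)"
    and lin: "linear_between R S f" and "\<And>x. x \<in> A \<Longrightarrow> \<phi> x \<in> rspace R"
  shows "f (\<Sum>x\<in>A. rscale R (a x) (\<phi> x)) = (\<Sum>x\<in>A. rscale S (a x) (f (\<phi> x)))
    \<and> (\<Sum>x\<in>A. rscale R (a x) (\<phi> x)) \<in> rspace R"
  using assms(5)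
proof (induction A rule: infinite_finite_induct)
  case (insert x A)
  then show ?case
    using linear_betweenD[OF lin] R by (simp add: subspace_iff)
qed (use linear_between_0[OF R(1) S lin] R in \<open>auto simp: subspace_iff\<close>)

text \<open>The equivariant family \<open>\<phi>\<close> is a basis of \<open>rspace S\<close>, by
  \<open>space\<close> and \<open>indep\<close>, and the group permutes it. Coefficient families are
  total functions of which only the values on \<open>X\<close> matter, so the span is a plain range.
  That \<open>S\<close> is a representation is part of the conclusion.\<close>

lemma perm_rep_iso:
  fixes S :: "('g, 'w::ab_group_add) rep"
  assumes G: "group G" and X: "is_gset G X act" and fin: "finite X" and S: "vector_space (rscale S)"
    and space: "rspace S = range (\<lambda>a. \<Sum>x\<in>X. rscale S (a x) (\<phi> x))"
    and indep: "\<And>a. (\<Sum>x\<in>X. rscale S (a x) (\<phi> x)) = 0 \<Longrightarrow> (\<forall>x\<in>X. a x = 0)"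
    and lin: "\<And>g. g \<in> carrier G \<Longrightarrow> linear_between S S (ract S g)"
    and eq: "\<And>g x. g \<in> carrier G \<Longrightarrow> x \<in> X \<Longrightarrow> \<phi> (act g x) = ract S g (\<phi> x)"
  shows "rep_iso G (perm_rep X act) S"
proof (rule rep_iso_transport[OF G is_rep_perm[OF X] S])
  interpret vector_space "rscale S" by fact
  define f where "f p = (\<Sum>x\<in>X. rscale S (Poly_Mapping.lookup p x) (\<phi> x))" for p
  have f_add: "f (p + q) = f p + f q" for p q
    by (simp add: f_def lookup_add scale_left_distrib sum.distrib)
  have f_scale: "f (pscale c p) = rscale S c (f p)" for c p
    by (simp add: f_def scale_sum_right)
  have f_diff: "f (p - q) = f p - f q" for p q
    by (simp add: f_def lookup_minus scale_left_diff_distrib sum_subtractf)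
  have f_sum: "f (\<Sum>x\<in>A. h x) = (\<Sum>x\<in>A. f (h x))" for A :: "'b set" and h
    by (induction A rule: infinite_finite_induct) (auto simp: f_add, auto simp: f_def)
  have f_single: "f (Poly_Mapping.single x c) = rscale S c (\<phi> x)" if "x \<in> X" for x c
    using that fin by (simp add: f_def lookup_single when_def if_distrib[of "\<lambda>c. rscale S c _"] cong: if_cong)
  have f_mem: "f p \<in> rspace S" for p
    unfolding space f_def by blast
  have \<phi>_mem: "\<phi> x \<in> rspace S" if "x \<in> X" for x
    using f_mem[of "Poly_Mapping.single x 1"] that by (simp add: f_single)
  have sub: "Modules.module.subspace (rscale S) (rspace S)"
    unfolding subspace_iff[OF S]
  proof (intro conjI ballI allI)
    show "0 \<in> rspace S" using f_mem[of 0] by (simp add: f_def)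
    fix u assume "u \<in> rspace S"
    then obtain a where a: "u = (\<Sum>x\<in>X. rscale S (a x) (\<phi> x))" unfolding space by blast
    show "rscale S c u \<in> rspace S" for c
      unfolding a space by (auto simp: scale_sum_right intro!: exI[of _ "\<lambda>x. c * a x"])
    fix v assume "v \<in> rspace S"
    then obtain b where b: "v = (\<Sum>x\<in>X. rscale S (b x) (\<phi> x))" unfolding space by blast
    show "u + v \<in> rspace S"
      unfolding a b space
      by (rule range_eqI[of _ _ "\<lambda>x. a x + b x"]) (simp add: scale_left_distrib sum.distrib)
  qed
  show "linear_between (perm_rep X act) S f"
    by (rule linear_betweenI) (simp_all add: f_mem f_add f_scale)
  show "bij_betw f (rspace (perm_rep X act)) (rspace S)"
    unfolding bij_betw_def
  proof
    show "inj_on f (rspace (perm_rep X act))"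
    proof (rule inj_onI)
      fix p q assume p: "p \<in> rspace (perm_rep X act)" and q: "q \<in> rspace (perm_rep X act)"
        and "f p = f q"
      then have "f (p - q) = 0" by (simp add: f_diff)
      then have "\<forall>x\<in>X. Poly_Mapping.lookup p x = Poly_Mapping.lookup q x"
        using indep[of "Poly_Mapping.lookup (p - q)"] by (simp add: f_def lookup_minus)
      moreover have "Poly_Mapping.lookup p x = 0" "Poly_Mapping.lookup q x = 0" if "x \<notin> X" for x
        using p q that by (auto simp: in_keys_iff subset_iff)
      ultimately show "p = q" by (intro poly_mapping_eqI) metis
    qed
    show "f ` rspace (perm_rep X act) = rspace S"
    proof
      show "rspace S \<subseteq> f ` rspace (perm_rep X act)"
      proof
        fix v assume "v \<in> rspace S"
        then obtain a where a: "v = (\<Sum>x\<in>X. rscale S (a x) (\<phi> x))" unfolding space by blast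
        let ?p = "\<Sum>x\<in>X. Poly_Mapping.single x (a x)"
        have "Poly_Mapping.keys ?p \<subseteq> (\<Union>x\<in>X. Poly_Mapping.keys (Poly_Mapping.single x (a x)))"
          by (rule keys_sum)
        also have "\<dots> \<subseteq> X" by (auto split: if_splits)
        finally have "?p \<in> rspace (perm_rep X act)" by simp
        moreover have "f ?p = v" by (simp add: f_sum f_single a)
        ultimately show "v \<in> f ` rspace (perm_rep X act)" by blast
      qed
    qed (use f_mem in auto)
  qed
  fix g p assume g: "g \<in> carrier G" and p: "p \<in> rspace (perm_rep X act)"
  have gX: "act g x \<in> X" if "x \<in> X" for x using X g that by (auto simp: is_gset_def)
  have "f (ract (perm_rep X act) g p) = (\<Sum>x\<in>X. rscale S (Poly_Mapping.lookup p x) (\<phi> (act g x)))"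
    using p fin gX by (simp add: perm_rep_act[of X] f_sum f_single)
  also have "\<dots> = (\<Sum>x\<in>X. rscale S (Poly_Mapping.lookup p x) (ract S g (\<phi> x)))"
    by (simp add: eq[OF g])
  also have "\<dots> = ract S g (f p)"
    unfolding f_def using linear_between_sum[OF S sub S lin[OF g], of X \<phi>] \<phi>_mem by simp
  finally show "f (ract (perm_rep X act) g p) = ract S g (f p)" .
qed

section \<open>The anticanonical space and its coordinates\<close>

text \<open>The indices of the forms are literals; keeping 1 from becoming \<open>Suc 0\<close> lets
  the value tables for \<open>s_form 1 2\<close> and the like match as rewrite rules.\<close>

declare One_nat_def [simp del] One_nat_def [symmetric, simp]

lemma idx_eq: "idx = {(1, 2), (1, 3), (2, 1), (2, 3), (3, 1), (3, 2)}"
  by (auto simp: idx_def)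

lemma idx_cases:
  assumes "(i, j) \<in> idx"
  obtains "i = 1" "j = 2" | "i = 1" "j = 3" | "i = 2" "j = 1" | "i = 2" "j = 3" | "i = 3" "j = 1"
    | "i = 3" "j = 2"
  using assms by (auto simp: idx_eq)

lemma sum_idx: "(\<Sum>x\<in>idx. f x) = f (1, 2) + f (1, 3) + f (2, 1) + f (2, 3) + f (3, 1) + f (3, 2)"
  for f :: "_ \<Rightarrow> 'b::comm_monoid_add"
  by (simp add: idx_eq add.assoc)

definition perm3 :: "nat \<Rightarrow> nat \<Rightarrow> nat \<Rightarrow> nat" where
  "perm3 i j = id(1 := i, 2 := j, 3 := third i j)"

lemma perm3_eq:
  "perm3 1 2 = id" "perm3 1 3 = transpose 2 3" "perm3 2 1 = transpose 1 2"
  "perm3 2 3 = transpose 1 2 \<circ> transpose 2 3" "perm3 3 1 = transpose 2 3 \<circ> transpose 1 2"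
  "perm3 3 2 = transpose 1 3"
  by (auto simp: perm3_def fun_eq_iff transpose_def)

lemma perm3_permutes:
  assumes "(i, j) \<in> idx" shows "perm3 i j permutes {1, 2, 3}"
  using assms by (cases rule: idx_cases)
    (simp_all add: perm3_eq permutes_id permutes_swap_id permutes_compose)

lemma eta_perm3: "eta i j = sgn_char (perm3 i j)"
  by (simp add: eta_def sgn_char_def perm3_def)

lemma sgn_char_transpose: "a \<noteq> b \<Longrightarrow> sgn_char (transpose a b) = - 1"
  by (simp add: sgn_char_def sign_swap_id)

lemma sgn_char_comp:
  "permutation f \<Longrightarrow> permutation g \<Longrightarrow> sgn_char (f \<circ> g) = sgn_char f * sgn_char g"
  by (simp add: sgn_char_def sign_compose)

lemma eta_values:
  "eta 1 2 = 1" "eta 1 3 = - 1" "eta 2 1 = - 1" "eta 2 3 = 1" "eta 3 1 = 1" "eta 3 2 = - 1"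
  by (simp_all add: eta_perm3 perm3_eq sgn_char_transpose sgn_char_comp permutation_swap_id)
    (simp add: sgn_char_def)

lemma pscale_1 [simp]: "pscale 1 p = p" and pscale_m1 [simp]: "pscale (- 1) p = - p"
  and pscale_0 [simp]: "pscale 0 p = 0" and pscale_0' [simp]: "pscale c 0 = 0"
  by (simp_all add: vector_space_simps[OF vector_space_pscale])

lemma pscale_add: "pscale c (p + q) = pscale c p + pscale c q"
  and pscale_add_left: "pscale (c + d) p = pscale c p + pscale d p"
  and pscale_pscale [simp]: "pscale c (pscale d p) = pscale (c * d) p"
  by (simp_all add: vector_space_simps[OF vector_space_pscale])

lemma pscale_uminus: "pscale c (- p) = - pscale c p"
  and pscale_diff: "pscale c (p - q) = pscale c p - pscale c q"
  by (rule poly_mapping_eqI; simp add: lookup_minus algebra_simps)+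

lemma sigma_values:
  "sigma_form 1 2 = s_form 1 3 - s_form 3 1 - s_form 2 3"
  "sigma_form 1 3 = - (s_form 1 2 - s_form 2 1 - s_form 3 2)"
  "sigma_form 2 1 = - (s_form 2 3 - s_form 3 2 - s_form 1 3)"
  "sigma_form 2 3 = s_form 2 1 - s_form 1 2 - s_form 3 1"
  "sigma_form 3 1 = s_form 3 2 - s_form 2 3 - s_form 1 2"
  "sigma_form 3 2 = - (s_form 3 1 - s_form 1 3 - s_form 2 1)"
  by (simp_all add: sigma_form_def eta_values)

lemma peval_id_pscale:
  "peval id x (pscale c p) = c * peval id x p"
  by (simp add: pscale_eq_mult peval_id_simps)

lemmas ev_simps = peval_id_simps peval_id_pscale

lemma pconst_diff: "pconst (a - b) = pconst a - pconst b"
  by (simp add: pconst_def single_diff)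

text \<open>The dual basis of the \<open>s_form i j\<close>, realised by evaluation. At a point with
  \<open>x_i = 1\<close>, \<open>x_j = y\<close> and third coordinate 0 all basis forms vanish
  except \<open>s_form i j\<close>, with value \<open>y^2\<close>, and \<open>s_form j i\<close>,
  with value \<open>y\<close>. The mean over \<open>y = 1\<close> and \<open>y = -1\<close> keeps
  the first coefficient and cancels the second.\<close>

definition s_coeff :: "nat mpoly \<Rightarrow> nat \<times> nat \<Rightarrow> complex" where
  "s_coeff P = (\<lambda>(i, j). (peval id ((\<lambda>_. 0)(i := 1, j := 1)) P + peval id ((\<lambda>_. 0)(i := 1, j := - 1)) P) / 2)"

lemma s_coeff_add: "s_coeff (P + Q) x = s_coeff P x + s_coeff Q x"
  and s_coeff_diff: "s_coeff (P - Q) x = s_coeff P x - s_coeff Q x"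
  and s_coeff_uminus: "s_coeff (- P) x = - s_coeff P x"
  and s_coeff_pscale: "s_coeff (pscale c P) x = c * s_coeff P x"
  and s_coeff_0: "s_coeff 0 x = 0"
  by (auto simp: s_coeff_def ev_simps field_simps split: prod.split)

lemma s_coeff_sum: "s_coeff (\<Sum>y\<in>A. f y) x = (\<Sum>y\<in>A. s_coeff (f y) x)"
  by (induction A rule: infinite_finite_induct) (auto simp: s_coeff_add s_coeff_0)

lemma s_coeff_s_form:
  assumes "(i, j) \<in> idx" "x \<in> idx"
  shows "s_coeff (s_form i j) x = (if x = (i, j) then 1 else 0)"
  using assms by (elim idx_cases) (auto simp: idx_eq s_coeff_def s_form_def ev_simps)

lemma s_form_in_V:
  assumes "(i, j) \<in> idx" shows "s_form i j \<in> V_space"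
proof -
  have "s_form i j \<in> forms (1 + 1 + 1) {1, 2, 3}"
    unfolding s_form_def using assms
    by (intro forms_mult forms_diff forms_pvar) (auto simp: idx_eq)
  moreover have "peval id (base_point k) (s_form i j) = 0" if "k \<in> {1..4}" for k
  proof -
    have "k \<in> {1, 2, 3, 4}" using that by auto
    then show ?thesis
      using assms by (auto simp: idx_eq s_form_def ev_simps base_point_def)
  qed
  ultimately show ?thesis by (simp add: V_space_def)
qed

lemma V_space_add: "P \<in> V_space \<Longrightarrow> Q \<in> V_space \<Longrightarrow> P + Q \<in> V_space"
  and V_space_pscale: "P \<in> V_space \<Longrightarrow> pscale c P \<in> V_space"
  and V_space_0: "0 \<in> V_space"
  by (auto simp: V_space_def forms_add forms_pscale ev_simps)

lemma V_space_uminus: "P \<in> V_space \<Longrightarrow> - P \<in> V_space"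
  using V_space_pscale[of P "- 1"] by simp

lemma V_space_diff: "P \<in> V_space \<Longrightarrow> Q \<in> V_space \<Longrightarrow> P - Q \<in> V_space"
  using V_space_add[of P "- Q"] V_space_uminus[of Q] by simp

lemma V_space_sum: "(\<And>x. x \<in> A \<Longrightarrow> f x \<in> V_space) \<Longrightarrow> (\<Sum>x\<in>A. f x) \<in> V_space"
  by (induction A rule: infinite_finite_induct) (auto simp: V_space_add V_space_0)

lemmas V_space_closed = V_space_add V_space_diff V_space_pscale V_space_uminus V_space_0

lemma sigma_form_in_V:
  assumes "(i, j) \<in> idx" shows "sigma_form i j \<in> V_space"
  using assms by (elim idx_cases)
    (auto simp: sigma_values idx_eq intro!: V_space_closed s_form_in_V)

section \<open>Coordinate expansions of forms and the basis of the anticanonical space\<close>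

lemma forms_Suc_family:
  assumes "finite X" "\<forall>i\<in>I. q i \<in> forms (Suc d) X"
  obtains r where "\<forall>i\<in>I. \<forall>j\<in>X. r i j \<in> forms d X"
    "\<forall>i\<in>I. q i = (\<Sum>j\<in>X. pvar j * r i j)"
proof -
  have "\<forall>i\<in>I. \<exists>r. (\<forall>j\<in>X. r j \<in> forms d X) \<and> q i = (\<Sum>j\<in>X. pvar j * r j)"
    using assms by (blast intro: forms_Suc)
  from bchoice[OF this] that show ?thesis by blast
qed

lemma forms_1_family:
  assumes "finite X" "\<forall>i\<in>I. q i \<in> forms 1 X"
  obtains c where "\<forall>i\<in>I. q i = (\<Sum>j\<in>X. pvar j * pconst (c i j))"
proof -
  have "\<forall>i\<in>I. q i \<in> forms (Suc 0) X" using assms(2) by simp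
  then obtain r where r: "\<forall>i\<in>I. \<forall>j\<in>X. r i j \<in> forms 0 X"
    "\<forall>i\<in>I. q i = (\<Sum>j\<in>X. pvar j * r i j)"
    by (rule forms_Suc_family[OF assms(1)])
  define c where "c i j = (SOME c. r i j = pconst c)" for i j
  have "r i j = pconst (c i j)" if "i \<in> I" "j \<in> X" for i j
    unfolding c_def by (rule someI_ex) (use r(1) that in \<open>blast intro: forms_0_pconst\<close>)
  then have "\<forall>i\<in>I. q i = (\<Sum>j\<in>X. pvar j * pconst (c i j))"
    using r(2) by simp
  then show ?thesis by (rule that)
qed

lemma forms_2_expand:
  assumes "finite X" "P \<in> forms 2 X"
  obtains c where "P = (\<Sum>i\<in>X. pvar i * (\<Sum>j\<in>X. pvar j * pconst (c i j)))"
proof -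
  have "P \<in> forms (Suc 1) X" using assms(2) by (simp only: Suc_1)
  then obtain q where q: "\<forall>i\<in>X. q i \<in> forms 1 X" "P = (\<Sum>i\<in>X. pvar i * q i)"
    using forms_Suc[OF assms(1)] by blast
  obtain c where "\<forall>i\<in>X. q i = (\<Sum>j\<in>X. pvar j * pconst (c i j))"
    by (rule forms_1_family[OF assms(1) q(1)])
  then show ?thesis using q(2) that[of c] by simp
qed

lemma forms_3_expand:
  assumes "finite X" "P \<in> forms 3 X"
  obtains c where "P = (\<Sum>i\<in>X. pvar i * (\<Sum>j\<in>X. pvar j * (\<Sum>k\<in>X. pvar k * pconst (c i j k))))"
proof -
  have "P \<in> forms (Suc 2) X" using assms(2) by (simp only: eval_nat_numeral)
  then obtain q where q: "\<forall>i\<in>X. q i \<in> forms 2 X" "P = (\<Sum>i\<in>X. pvar i * q i)"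
    using forms_Suc[OF assms(1)] by blast
  have "\<exists>c. q i = (\<Sum>j\<in>X. pvar j * (\<Sum>k\<in>X. pvar k * pconst (c j k)))" if "i \<in> X" for i
  proof -
    have "q i \<in> forms 2 X" using q(1) that by blast
    from forms_2_expand[OF assms(1) this] show ?thesis by blast
  qed
  then have "\<forall>i\<in>X. \<exists>c. q i = (\<Sum>j\<in>X. pvar j * (\<Sum>k\<in>X. pvar k * pconst (c j k)))" by blast
  from bchoice[OF this] obtain c
    where "\<forall>i\<in>X. q i = (\<Sum>j\<in>X. pvar j * (\<Sum>k\<in>X. pvar k * pconst (c i j k)))" by blast
  then show ?thesis using q(2) that[of c] by simp
qed

text \<open>Of the ten cubic monomials, the cubes are excluded by vanishing at the first three base
  points, and the coefficient of \<open>x_1 x_2 x_3\<close> is determined by vanishing at the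
  fourth, where all monomials take the value 1. Each of the six others, \<open>x_i x_j^2\<close>,
  occurs in exactly one basis form, \<open>s_form i j\<close>, which is
  \<open>x_i x_j^2 - x_1 x_2 x_3\<close>.\<close>

lemma V_space_span:
  assumes "P \<in> V_space"
  shows "\<exists>a. P = (\<Sum>(i, j)\<in>idx. pscale (a (i, j)) (s_form i j))"
proof -
  obtain c where P: "P = (\<Sum>i\<in>{1, 2, 3}. pvar i *
      (\<Sum>j\<in>{1, 2, 3}. pvar j * (\<Sum>k\<in>{1, 2, 3}. pvar k * pconst (c i j k))))"
    using assms forms_3_expand[of "{1, 2, 3}" P] unfolding V_space_def by blast
  have ev: "peval id (base_point k) P = 0" if "k \<in> {1, 2, 3, 4}" for k
    using assms that unfolding V_space_def by auto
  have c0: "c 1 1 1 = 0" "c 2 2 2 = 0" "c 3 3 3 = 0"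
    using ev[of 1] ev[of 2] ev[of 3] unfolding P by (simp_all add: ev_simps base_point_def)
  \<comment> \<open>The coefficient of \<open>x_i x_j^2\<close>, collected from its three positions
    in the nested expansion.\<close>
  define a where "a = (\<lambda>(i, j). c i j j + c j i j + c j j i)"
  have "c 1 2 3 + (c 1 3 2 + c 2 1 3 + c 2 3 1 + c 3 1 2 + c 3 2 1 +
      (a (1, 2) + a (1, 3) + a (2, 1) + a (2, 3) + a (3, 1) + a (3, 2))) = peval id (base_point 4) P"
    unfolding P by (simp add: ev_simps base_point_def a_def c0)
  then have c123: "c 1 2 3 = - (c 1 3 2 + c 2 1 3 + c 2 3 1 + c 3 1 2 + c 3 2 1 +
      (a (1, 2) + a (1, 3) + a (2, 1) + a (2, 3) + a (3, 1) + a (3, 2)))"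
    unfolding eq_neg_iff_add_eq_0 using ev[of 4] by simp
  have "P = (\<Sum>(i, j)\<in>idx. pscale (a (i, j)) (s_form i j))"
    unfolding P
    by (simp add: sum_idx c0 c123 s_form_def pscale_eq_mult pconst_add pconst_uminus pconst_diff a_def algebra_simps)
  then show ?thesis by blast
qed

lemma V_space_expand:
  assumes "P \<in> V_space"
  shows "P = (\<Sum>(i, j)\<in>idx. pscale (s_coeff P (i, j)) (s_form i j))"
proof -
  obtain a where a: "P = (\<Sum>(i, j)\<in>idx. pscale (a (i, j)) (s_form i j))"
    using V_space_span[OF assms] by blast
  have "s_coeff P x = a x" if "x \<in> idx" for x
    using that unfolding a by (auto simp: s_coeff_sum sum_idx s_coeff_add s_coeff_pscale s_coeff_s_form idx_eq)
  then show ?thesis using a by (simp add: sum_idx idx_eq)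
qed

lemma V_space_eqI:
  assumes "P \<in> V_space" "Q \<in> V_space" "\<And>x. x \<in> idx \<Longrightarrow> s_coeff P x = s_coeff Q x"
  shows "P = Q"
  using V_space_expand[OF assms(1)] V_space_expand[OF assms(2)] assms(3) by (simp add: sum_idx idx_eq)

lemma s_coeff_lincomb:
  "x \<in> idx \<Longrightarrow> s_coeff (\<Sum>(i, j)\<in>idx. pscale (a (i, j)) (s_form i j)) x = a x"
  by (auto simp: s_coeff_sum sum_idx s_coeff_add s_coeff_pscale s_coeff_s_form idx_eq)

definition s_coeffs :: "nat mpoly \<Rightarrow> complex list" where
  "s_coeffs P = map (s_coeff P) [(1, 2), (1, 3), (2, 1), (2, 3), (3, 1), (3, 2)]"

text \<open>The orbit of \<open>\<plusminus>s\<^sub>i\<^sub>j\<close> under the cyclic group of order 4 generated by passing to the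
  neighbouring pentagon.\<close>

definition quad :: "nat \<Rightarrow> nat \<Rightarrow> nat \<Rightarrow> nat mpoly" where
  "quad i j k = (if k = 0 then pscale (eta i j) (s_form i j) else if k = 1 then sigma_form i j
     else if k = 2 then - pscale (eta i j) (s_form i j) else - sigma_form i j)"

text \<open>The coordinates of all 24 elements, one line per index pair. They are kept as lists so
  that \<open>quad_inj\<close> reduces to the distinctness of explicit lists of numbers.\<close>

lemma s_coeffs_quad:
  "map (\<lambda>((i, j), k). s_coeffs (quad i j k)) (List.product [(1, 2), (1, 3), (2, 1), (2, 3), (3, 1), (3, 2)] [0, 1, 2, 3]) =
  [[1,0,0,0,0,0], [0,1,0,-1,-1,0], [-1,0,0,0,0,0], [0,-1,0,1,1,0],
   [0,-1,0,0,0,0], [-1,0,1,0,0,1], [0,1,0,0,0,0], [1,0,-1,0,0,-1],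
   [0,0,-1,0,0,0], [0,1,0,-1,0,1], [0,0,1,0,0,0], [0,-1,0,1,0,-1],
   [0,0,0,1,0,0], [-1,0,1,0,-1,0], [0,0,0,-1,0,0], [1,0,-1,0,1,0],
   [0,0,0,0,1,0], [-1,0,0,-1,0,1], [0,0,0,0,-1,0], [1,0,0,1,0,-1],
   [0,0,0,0,0,-1], [0,1,1,0,-1,0], [0,0,0,0,0,1], [0,-1,-1,0,1,0]]"
  by (simp add: s_coeffs_def quad_def eta_values sigma_values s_coeff_add s_coeff_diff s_coeff_uminus s_coeff_pscale s_coeff_s_form idx_eq)

lemma quad_inj: "inj_on (\<lambda>((i, j), k). quad i j k) (idx \<times> {..<4})"
proof -
  define l :: "((nat \<times> nat) \<times> nat) list"
    where "l = List.product [(1, 2), (1, 3), (2, 1), (2, 3), (3, 1), (3, 2)] [0, 1, 2, 3]"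
  have "distinct (map (\<lambda>((i, j), k). s_coeffs (quad i j k)) l)"
    unfolding l_def s_coeffs_quad by simp
  also have "(\<lambda>((i, j), k). s_coeffs (quad i j k)) = s_coeffs \<circ> (\<lambda>((i, j), k). quad i j k)"
    by (simp add: fun_eq_iff split: prod.split)
  finally have "inj_on (\<lambda>((i, j), k). quad i j k) (set l)"
    by (intro inj_on_imageI2[of s_coeffs]) (simp only: distinct_map)
  moreover have "{..<4} = {0, 1, 2, 3 :: nat}" by auto
  then have "set l = idx \<times> {..<4}" by (simp only: idx_eq l_def set_product list.set)
  ultimately show ?thesis by (simp only:)
qed

section \<open>The action on the sections\<close>

lemma S5_carrier: "g \<in> carrier S5 \<longleftrightarrow> g permutes {1..5}"
  and S5_mult: "g \<otimes>\<^bsub>S5\<^esub> h = g \<circ> h" and S5_one: "\<one>\<^bsub>S5\<^esub> = id"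
  by (simp_all add: sym_group_def)

lemma S5_comp: "g \<in> carrier S5 \<Longrightarrow> h \<in> carrier S5 \<Longrightarrow> g \<circ> h \<in> carrier S5"
  by (simp add: S5_carrier permutes_compose)

lemma S5_id: "id \<in> carrier S5"
  by (simp add: S5_carrier permutes_id)

lemma S5_power: "g \<in> carrier S5 \<Longrightarrow> g ^^ n \<in> carrier S5"
  by (induction n) (auto simp: S5_comp S5_id)

lemma S5_transpose: "a \<in> {1..5} \<Longrightarrow> b \<in> {1..5} \<Longrightarrow> transpose a b \<in> carrier S5"
  unfolding S5_carrier by (rule permutes_swap_id)

lemma S5_perm3: "(i, j) \<in> idx \<Longrightarrow> perm3 i j \<in> carrier S5"
  unfolding S5_carrier by (rule permutes_subset[OF perm3_permutes]) auto

lemma S5_group: "group S5"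
  by (rule sym_group_is_group)

lemma S5_permutation: "g \<in> carrier S5 \<Longrightarrow> permutation g"
  by (rule sym_group_carrier')

lemma sgn_S5_comp: "g \<in> carrier S5 \<Longrightarrow> h \<in> carrier S5 \<Longrightarrow> sgn_char (g \<circ> h) = sgn_char g * sgn_char h"
  by (simp add: sgn_char_comp S5_permutation)

lemma sgn_char_sq: "sgn_char g * sgn_char g = 1"
  by (simp add: sgn_char_def flip: of_int_mult)

lemma is_char_sgn: "is_char S5 sgn_char"
  by (simp add: is_char_def S5_mult S5_one sgn_S5_comp) (simp add: sgn_char_def)

text \<open>\<open>quart\<close> and \<open>quint\<close> generate a copy of \<open>Aff(1, \<int>/5)\<close>; \<open>quint\<close> generates the stabiliser of
  \<open>s\<^sub>1\<^sub>2\<close> in \<open>S\<^sub>5\<close>, and \<open>quart\<close> passes from a pentagon to a neighbouring one.\<close>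

definition quart :: "nat \<Rightarrow> nat" where
  "quart = transpose 1 2 \<circ> transpose 2 3 \<circ> transpose 3 4"

definition quint :: "nat \<Rightarrow> nat" where
  "quint = transpose 2 3 \<circ> transpose 3 4 \<circ> transpose 4 5 \<circ> transpose 1 2"

lemma quart_S5: "quart \<in> carrier S5" and quint_S5: "quint \<in> carrier S5"
  by (simp_all add: quart_def quint_def S5_comp S5_transpose)

lemma sgn_quart: "sgn_char quart = - 1" and sgn_quint: "sgn_char quint = 1"
  by (simp_all add: quart_def quint_def sgn_S5_comp S5_comp S5_transpose sgn_char_transpose)

lemma quart_values: "quart 1 = 2" "quart 2 = 3" "quart 3 = 4" "quart 4 = 1" "quart 5 = 5"
  and quint_values: "quint 1 = 3" "quint 3 = 4" "quint 4 = 5" "quint 5 = 2" "quint 2 = 1"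
  by (simp_all add: quart_def quint_def transpose_def)

lemma funpow_numerals:
  "f ^^ 1 = f" "f ^^ 2 = f \<circ> f" "f ^^ 3 = f \<circ> f \<circ> f" "f ^^ 4 = f \<circ> f \<circ> f \<circ> f"
  "f ^^ 5 = f \<circ> f \<circ> f \<circ> f \<circ> f"
  by (simp_all only: eval_nat_numeral BitM.simps One_nat_def funpow.simps comp_id comp_assoc)

lemma quint_pow5: "quint ^^ 5 = id"
proof
  fix x show "(quint ^^ 5) x = id x"
  proof (cases "x \<in> {1..5}")
    case True
    then have "x \<in> {1, 2, 3, 4, 5}" by auto
    then show ?thesis by (auto simp: funpow_numerals quint_values)
  next
    case False
    then have "quint x = x" using quint_S5 unfolding S5_carrier by (rule permutes_not_in[rotated])
    then show ?thesis by (simp add: funpow_numerals)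
  qed
qed

lemma less_4_cases: "k < 4 \<Longrightarrow> k = 0 \<or> k = 1 \<or> k = 2 \<or> k = (3::nat)"
  and less_5_cases: "a < 5 \<Longrightarrow> a = 0 \<or> a = 1 \<or> a = 2 \<or> a = 3 \<or> a = (4::nat)"
  by auto

lemma quint_pow_inj: "a < 5 \<Longrightarrow> b < 5 \<Longrightarrow> quint ^^ a = quint ^^ b \<Longrightarrow> a = b"
proof -
  have *: "(quint ^^ 0) 1 = 1" "(quint ^^ 1) 1 = 3" "(quint ^^ 2) 1 = 4" "(quint ^^ 3) 1 = 5" "(quint ^^ 4) 1 = 2"
    by (simp_all add: funpow_numerals quint_values)
  assume "a < 5" "b < 5" and eq: "quint ^^ a = quint ^^ b"
  then show "a = b" using fun_cong[OF eq, of 1] * less_5_cases[of a] less_5_cases[of b] by auto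
qed

locale del_pezzo =
  fixes \<rho> :: "(nat \<Rightarrow> nat) \<Rightarrow> nat mpoly \<Rightarrow> nat mpoly"
  assumes action: "del_pezzo_action \<rho>"
begin

section \<open>The action on sections and its values on generators\<close>

lemma is_rep_V: "is_rep S5 (V_rep \<rho>)"
  using action unfolding del_pezzo_action_def by blast

lemma V_rep_sel [simp]: "rspace (V_rep \<rho>) = V_space" "rscale (V_rep \<rho>) = pscale" "ract (V_rep \<rho>) = \<rho>"
  by (simp_all add: V_rep_def)

lemma rho_mem: "g \<in> carrier S5 \<Longrightarrow> v \<in> V_space \<Longrightarrow> \<rho> g v \<in> V_space"
  using rep_space_closed(4)[OF is_rep_V] by simp

lemma rho_add: "g \<in> carrier S5 \<Longrightarrow> u \<in> V_space \<Longrightarrow> v \<in> V_space \<Longrightarrow> \<rho> g (u + v) = \<rho> g u + \<rho> g v"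
  using linear_betweenD(2)[OF is_repD(3)[OF is_rep_V]] by simp

lemma rho_pscale: "g \<in> carrier S5 \<Longrightarrow> v \<in> V_space \<Longrightarrow> \<rho> g (pscale c v) = pscale c (\<rho> g v)"
  using linear_betweenD(3)[OF is_repD(3)[OF is_rep_V]] by simp

lemma rho_uminus: "g \<in> carrier S5 \<Longrightarrow> v \<in> V_space \<Longrightarrow> \<rho> g (- v) = - \<rho> g v"
  using rho_pscale[of g v "- 1"] by simp

lemma rho_diff: "g \<in> carrier S5 \<Longrightarrow> u \<in> V_space \<Longrightarrow> v \<in> V_space \<Longrightarrow> \<rho> g (u - v) = \<rho> g u - \<rho> g v"
  using rho_add[of g u "- v"] by (simp add: rho_uminus V_space_uminus)

lemma rho_comp: "g \<in> carrier S5 \<Longrightarrow> h \<in> carrier S5 \<Longrightarrow> v \<in> V_space \<Longrightarrow> \<rho> (g \<circ> h) v = \<rho> g (\<rho> h v)"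
  using is_repD(5)[OF is_rep_V] by (simp add: S5_mult)

lemma rho_id: "v \<in> V_space \<Longrightarrow> \<rho> id v = v"
  using is_repD(4)[OF is_rep_V] by (simp add: S5_one)

lemma rho_S3:
  "\<tau> permutes {1, 2, 3} \<Longrightarrow> (i, j) \<in> idx \<Longrightarrow>
    \<rho> \<tau> (s_form i j) = pscale (sgn_char \<tau>) (s_form (\<tau> i) (\<tau> j))"
  using action unfolding del_pezzo_action_def by fast

lemma rho_12:
  "\<rho> (transpose 1 2) (s_form 1 2) = - s_form 2 1" "\<rho> (transpose 1 2) (s_form 2 1) = - s_form 1 2"
  "\<rho> (transpose 1 2) (s_form 1 3) = - s_form 2 3" "\<rho> (transpose 1 2) (s_form 2 3) = - s_form 1 3"
  "\<rho> (transpose 1 2) (s_form 3 1) = - s_form 3 2" "\<rho> (transpose 1 2) (s_form 3 2) = - s_form 3 1"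
  by (subst rho_S3; simp add: permutes_swap_id idx_eq sgn_char_transpose transpose_def)+

lemma rho_23:
  "\<rho> (transpose 2 3) (s_form 1 2) = - s_form 1 3" "\<rho> (transpose 2 3) (s_form 2 1) = - s_form 3 1"
  "\<rho> (transpose 2 3) (s_form 1 3) = - s_form 1 2" "\<rho> (transpose 2 3) (s_form 2 3) = - s_form 3 2"
  "\<rho> (transpose 2 3) (s_form 3 1) = - s_form 2 1" "\<rho> (transpose 2 3) (s_form 3 2) = - s_form 2 3"
  by (subst rho_S3; simp add: permutes_swap_id idx_eq sgn_char_transpose transpose_def)+

lemma rho_34:
  "\<rho> (transpose 3 4) (s_form 1 2) = sigma_form 3 1" "\<rho> (transpose 3 4) (s_form 1 3) = s_form 2 3"
  "\<rho> (transpose 3 4) (s_form 2 1) = - sigma_form 3 2" "\<rho> (transpose 3 4) (s_form 2 3) = s_form 1 3"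
  "\<rho> (transpose 3 4) (s_form 3 1) = - sigma_form 1 2" "\<rho> (transpose 3 4) (s_form 3 2) = sigma_form 2 1"
  using action unfolding del_pezzo_action_def by blast+

lemma rho_45:
  "\<rho> (transpose 4 5) (s_form 1 2) = s_form 1 3" "\<rho> (transpose 4 5) (s_form 1 3) = s_form 1 2"
  "\<rho> (transpose 4 5) (s_form 2 1) = s_form 2 3" "\<rho> (transpose 4 5) (s_form 2 3) = s_form 2 1"
  "\<rho> (transpose 4 5) (s_form 3 1) = s_form 3 2" "\<rho> (transpose 4 5) (s_form 3 2) = s_form 3 1"
proof -
  have *: "\<forall>(i, j)\<in>idx. \<rho> (transpose 4 5) (s_form i j) = s_form i (third i j)"
    using action unfolding del_pezzo_action_def by blast
  show "\<rho> (transpose 4 5) (s_form 1 2) = s_form 1 3" "\<rho> (transpose 4 5) (s_form 1 3) = s_form 1 2"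
    "\<rho> (transpose 4 5) (s_form 2 1) = s_form 2 3" "\<rho> (transpose 4 5) (s_form 2 3) = s_form 2 1"
    "\<rho> (transpose 4 5) (s_form 3 1) = s_form 3 2" "\<rho> (transpose 4 5) (s_form 3 2) = s_form 3 1"
    using * by (simp_all add: idx_eq)
qed

lemmas rho_gens = rho_12 rho_23 rho_34 rho_45
lemmas rho_linear = rho_add rho_diff rho_uminus rho_pscale

lemma s_in_V [simp]:
  "s_form 1 2 \<in> V_space" "s_form 1 3 \<in> V_space" "s_form 2 1 \<in> V_space" "s_form 2 3 \<in> V_space"
  "s_form 3 1 \<in> V_space" "s_form 3 2 \<in> V_space"
  by (simp_all add: s_form_in_V idx_eq)

lemma sigma_in_V [simp]:
  "sigma_form 1 2 \<in> V_space" "sigma_form 1 3 \<in> V_space" "sigma_form 2 1 \<in> V_space" "sigma_form 2 3 \<in> V_space"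
  "sigma_form 3 1 \<in> V_space" "sigma_form 3 2 \<in> V_space"
  by (simp_all add: sigma_form_in_V idx_eq)

text \<open>\<open>quart\<close> and \<open>quint\<close> are defined as words in adjacent
  transpositions so that these identities follow from the tables \<open>rho_gens\<close>, after
  expanding each \<open>sigma_form\<close> linearly in the basis.\<close>

lemma rho_quart:
  "\<rho> quart (s_form 1 2) = sigma_form 1 2" "\<rho> quart (sigma_form 1 2) = - s_form 1 2"
  by (simp_all add: quart_def rho_comp S5_comp S5_transpose rho_gens rho_linear sigma_values V_space_closed)

lemma rho_quint:
  "\<rho> quint (s_form 1 2) = s_form 1 2" "\<rho> quint (sigma_form 1 2) = sigma_form 1 2"
  by (simp_all add: quint_def rho_comp S5_comp S5_transpose rho_gens rho_linear sigma_values V_space_closed)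

lemma rho_quint_pow:
  "\<rho> (quint ^^ a) (s_form 1 2) = s_form 1 2" "\<rho> (quint ^^ a) (sigma_form 1 2) = sigma_form 1 2"
  by (induction a) (simp_all add: rho_id rho_comp S5_power quint_S5 rho_quint)

lemma rho_quart_pow: "k < 4 \<Longrightarrow> \<rho> (quart ^^ k) (s_form 1 2) = quad 1 2 k"
proof -
  assume "k < 4"
  then show ?thesis
    using less_4_cases[of k]
    by (auto simp: funpow_numerals rho_id rho_comp S5_comp quart_S5 rho_quart rho_uminus quad_def eta_values)
qed

lemma rho_perm3:
  assumes "(i, j) \<in> idx"
  shows "\<rho> (perm3 i j) (s_form 1 2) = pscale (eta i j) (s_form i j)"
    "\<rho> (perm3 i j) (sigma_form 1 2) = sigma_form i j"
proof -
  have p: "perm3 i j 1 = i" "perm3 i j 2 = j" "perm3 i j 3 = third i j"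
    by (simp_all add: perm3_def)
  note S3 = rho_S3[OF perm3_permutes[OF assms]]
  have S: "perm3 i j \<in> carrier S5" by (rule S5_perm3[OF assms])
  show "\<rho> (perm3 i j) (s_form 1 2) = pscale (eta i j) (s_form i j)"
    by (subst S3) (simp_all add: idx_eq p eta_perm3)
  show "\<rho> (perm3 i j) (sigma_form 1 2) = sigma_form i j"
    by (simp add: sigma_values(1) rho_linear[OF S] V_space_closed S3 idx_eq p)
      (simp add: sigma_form_def eta_perm3 pscale_diff)
qed

text \<open>\<open>quint\<close> fixes \<open>s_form 1 2\<close>, \<open>quart\<close> moves it
  along the four-cycle \<open>quad 1 2\<close>, and \<open>perm3 i j\<close> carries that cycle to
  \<open>quad i j\<close>; the sign occurring in \<open>rho_perm3\<close> is the \<open>eta\<close>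
  built into \<open>quad\<close>.\<close>

lemma rho_rep:
  assumes "(i, j) \<in> idx" "k < 4"
  shows "\<rho> (perm3 i j \<circ> quart ^^ k \<circ> quint ^^ a) (s_form 1 2) = quad i j k"
proof -
  have "\<rho> (perm3 i j \<circ> quart ^^ k \<circ> quint ^^ a) (s_form 1 2) = \<rho> (perm3 i j) (quad 1 2 k)"
    using assms
    by (simp add: rho_comp S5_comp S5_perm3 S5_power quart_S5 quint_S5 rho_quint_pow rho_quart_pow)
  also have "\<dots> = quad i j k"
    using rho_perm3[OF assms(1)] S5_perm3[OF assms(1)]
    by (simp add: quad_def eta_values rho_uminus)
  finally show ?thesis .
qed

text \<open>The image of \<open>s_form 1 2\<close> recovers \<open>(i, j)\<close> and
  \<open>k\<close> by \<open>quad_inj\<close>; cancelling the common left factor then leaves powers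
  of \<open>quint\<close>, whose exponents below 5 are distinguished by the image of 1.\<close>

lemma rep_inj:
  "inj_on (\<lambda>((i, j), k, a). perm3 i j \<circ> quart ^^ k \<circ> quint ^^ a) (idx \<times> {..<4 :: nat} \<times> {..<5 :: nat})"
proof (rule inj_onI)
  fix x y :: "(nat \<times> nat) \<times> nat \<times> nat"
  obtain i j k a i' j' k' a' where xy: "x = ((i, j), k, a)" "y = ((i', j'), k', a')"
    by (metis prod.exhaust)
  assume "x \<in> idx \<times> {..<4} \<times> {..<5}" "y \<in> idx \<times> {..<4} \<times> {..<5}"
    and "(\<lambda>((i, j), k, a). perm3 i j \<circ> quart ^^ k \<circ> quint ^^ a) x
      = (\<lambda>((i, j), k, a). perm3 i j \<circ> quart ^^ k \<circ> quint ^^ a) y"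
  then have ij: "(i, j) \<in> idx" "(i', j') \<in> idx" and k: "k < 4" "k' < 4" and a: "a < 5" "a' < 5"
    and eq: "perm3 i j \<circ> quart ^^ k \<circ> quint ^^ a = perm3 i' j' \<circ> quart ^^ k' \<circ> quint ^^ a'"
    unfolding xy by simp_all
  have "quad i j k = quad i' j' k'"
    using rho_rep[OF ij(1) k(1), of a] rho_rep[OF ij(2) k(2), of a'] eq by simp
  then have *: "((i, j), k) = ((i', j'), k')"
    using inj_onD[OF quad_inj, of "((i, j), k)" "((i', j'), k')"] ij k by simp
  have "perm3 i j \<circ> quart ^^ k permutes {1..5}"
    using S5_comp[OF S5_perm3[OF ij(1)] S5_power[OF quart_S5]] unfolding S5_carrier .
  then have "inj (perm3 i j \<circ> quart ^^ k)" by (rule permutes_inj)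
  then have "quint ^^ a = quint ^^ a'"
    using eq * by (auto dest: injD[OF fun.inj_map])
  then show "x = y"
    unfolding xy using * quint_pow_inj[OF a] by simp
qed

text \<open>Since 6 * 4 * 5 = 5!, the injective parametrisation is onto. This normal form is the way
  in which later statements about an arbitrary permutation are reduced to \<open>perm3\<close>,
  \<open>quart\<close> and \<open>quint\<close>.\<close>

lemma S5_cases:
  assumes "g \<in> carrier S5"
  obtains i j k a where "(i, j) \<in> idx" "k < 4" "a < 5" "g = perm3 i j \<circ> quart ^^ k \<circ> quint ^^ a"
proof -
  let ?f = "\<lambda>((i, j), k, a). perm3 i j \<circ> quart ^^ k \<circ> quint ^^ a"
  let ?A = "idx \<times> {..<4::nat} \<times> {..<5::nat}"
  have fin: "finite (carrier S5)"
    by (simp add: sym_group_def finite_permutations)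
  have "card (?f ` ?A) = card ?A" by (rule card_image[OF rep_inj])
  also have "\<dots> = fact 5" by (simp add: idx_eq card_cartesian_product fact_numeral)
  also have "\<dots> = card (carrier S5)"
    by (simp add: sym_group_def card_permutations)
  finally have "card (?f ` ?A) = card (carrier S5)" .
  moreover have "?f ` ?A \<subseteq> carrier S5"
    by (auto simp: S5_comp S5_perm3 S5_power quart_S5 quint_S5)
  ultimately have "?f ` ?A = carrier S5" by (metis card_subset_eq[OF fin])
  then have "g \<in> ?f ` ?A" using assms by simp
  then show ?thesis using that by (elim imageE) (auto split: prod.splits)
qed

text \<open>Equal images force equal \<open>(i, j)\<close> and \<open>k\<close> in the normal forms,
  so that only the power of \<open>quint\<close> can differ: the stabiliser of
  \<open>s_form 1 2\<close> is no larger than the group generated by \<open>quint\<close>.\<close>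

lemma rho_orbit_eq:
  assumes "g \<in> carrier S5" "g' \<in> carrier S5" "\<rho> g (s_form 1 2) = \<rho> g' (s_form 1 2)"
  obtains b where "g' = g \<circ> quint ^^ b"
proof -
  obtain i j k a where g: "(i, j) \<in> idx" "k < 4" "a < 5" "g = perm3 i j \<circ> quart ^^ k \<circ> quint ^^ a"
    using S5_cases[OF assms(1)] by blast
  obtain i' j' k' a' where g': "(i', j') \<in> idx" "k' < 4" "a' < 5" "g' = perm3 i' j' \<circ> quart ^^ k' \<circ> quint ^^ a'"
    using S5_cases[OF assms(2)] by blast
  have "quad i j k = quad i' j' k'"
    using assms(3) rho_rep[OF g(1,2), of a] rho_rep[OF g'(1,2), of a'] g g' by simp
  then have *: "i' = i" "j' = j" "k' = k"
    using inj_onD[OF quad_inj, of "((i, j), k)" "((i', j'), k')"] g g' by auto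
  \<comment> \<open>The detour over 5 replaces the possibly negative exponent
    \<open>a' - a\<close>.\<close>
  have "quint ^^ a \<circ> quint ^^ (5 - a + a') = quint ^^ 5 \<circ> quint ^^ a'"
    using g(3) by (simp flip: funpow_add)
  then have "g' = g \<circ> quint ^^ (5 - a + a')"
    using g'(4) unfolding * g(4) comp_assoc by (simp add: quint_pow5)
  then show ?thesis by (rule that)
qed

lemma M_set_eq_quad: "M_set = (\<Union>(i, j)\<in>idx. quad i j ` {..<4})"
proof -
  have "{..<4} = {0, 1, 2, 3 :: nat}" by auto
  moreover have "{s_form i j, - s_form i j, sigma_form i j, - sigma_form i j} = quad i j ` {0, 1, 2, 3}"
    if "(i, j) \<in> idx" for i j
    using that by (cases rule: idx_cases) (simp_all add: quad_def eta_values insert_commute)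
  then have "M_set = (\<Union>(i, j)\<in>idx. quad i j ` {0, 1, 2, 3})"
    unfolding M_set_def by (intro SUP_cong refl) (auto simp only: split: prod.split)
  ultimately show ?thesis by simp
qed

lemma M_set_orbit: "M_set = (\<lambda>g. \<rho> g (s_form 1 2)) ` carrier S5"
proof
  show "M_set \<subseteq> (\<lambda>g. \<rho> g (s_form 1 2)) ` carrier S5"
  proof
    fix m assume "m \<in> M_set"
    then obtain i j k where "(i, j) \<in> idx" "k < 4" "m = quad i j k"
      unfolding M_set_eq_quad by auto
    then have "m = \<rho> (perm3 i j \<circ> quart ^^ k \<circ> quint ^^ 0) (s_form 1 2)"
      "perm3 i j \<circ> quart ^^ k \<circ> quint ^^ 0 \<in> carrier S5"
      by (simp_all only: rho_rep S5_comp S5_perm3 S5_power quart_S5 quint_S5)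
    then show "m \<in> (\<lambda>g. \<rho> g (s_form 1 2)) ` carrier S5" by blast
  qed
  show "(\<lambda>g. \<rho> g (s_form 1 2)) ` carrier S5 \<subseteq> M_set"
  proof clarify
    fix g assume "g \<in> carrier S5"
    then obtain i j k a where g: "(i, j) \<in> idx" "k < 4" "a < 5" "g = perm3 i j \<circ> quart ^^ k \<circ> quint ^^ a"
      using S5_cases by blast
    then show "\<rho> g (s_form 1 2) \<in> M_set"
      using rho_rep[OF g(1,2)] unfolding M_set_eq_quad by auto
  qed
qed

end

section \<open>Combinatorial pentagons\<close>

lemma UNIV_5: "(UNIV :: 5 set) = {0, 1, 2, 3, 4}"
  by (rule card_subset_eq[symmetric]) simp_all

lemma cases_5: "(i :: 5) = 0 \<or> i = 1 \<or> i = 2 \<or> i = 3 \<or> i = 4"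
  using UNIV_5 by auto

lemma of_nat_5: "\<exists>n. (a :: 5) = of_nat n"
  using cases_5[of a] of_nat_0 of_nat_1 of_nat_numeral by metis

text \<open>The labelling is chosen so that \<open>i \<mapsto> i + 1\<close> acts on the labels as
  \<open>quint\<close> and \<open>i \<mapsto> 3 * i\<close> as \<open>quart\<close>; 3 generates the
  units modulo 5. Affine reparametrisations of this pentagon thereby become words in the two
  permutations.\<close>

definition base_pentagon :: "5 \<Rightarrow> nat" where
  "base_pentagon i = (if i = 0 then 5 else if i = 1 then 2 else if i = 2 then 1 else if i = 3 then 3 else 4)"

lemma base_pentagon_bij: "bij_betw base_pentagon UNIV {1..5}"
proof -
  have "{1..5} = {5, 2, 1, 3, 4 :: nat}" by auto
  then show ?thesis
    unfolding bij_betw_def UNIV_5 inj_on_def by (auto simp: base_pentagon_def)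
qed

lemma base_pentagon_add: "base_pentagon (i + of_nat n) = (quint ^^ n) (base_pentagon i)"
proof (induction n)
  case (Suc n)
  have step: "base_pentagon (j + 1) = quint (base_pentagon j)" for j
    using cases_5[of j] by (elim disjE) (simp_all add: base_pentagon_def quint_values)
  have "base_pentagon (i + of_nat (Suc n)) = base_pentagon ((i + of_nat n) + 1)"
    by (simp add: algebra_simps)
  then show ?case using Suc step by simp
qed simp

lemma base_pentagon_mult: "base_pentagon (3 ^ k * i) = (quart ^^ k) (base_pentagon i)"
proof (induction k)
  case (Suc k)
  have step: "base_pentagon (3 * j) = quart (base_pentagon j)" for j
    using cases_5[of j] by (elim disjE) (simp_all add: base_pentagon_def quart_values)
  show ?case using Suc step[of "3 ^ k * i"] by (simp add: mult.assoc)
qed simp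

lemma base_pentagon_affine:
  "\<exists>n. \<forall>i. base_pentagon (3 ^ k * i + a) = (quint ^^ n) ((quart ^^ k) (base_pentagon i))"
  using of_nat_5[of a] by (metis base_pentagon_add base_pentagon_mult)

lemma pentagon_eq_iff:
  assumes "g \<in> carrier S5" "h \<in> carrier S5"
  shows "g \<circ> base_pentagon = h \<circ> base_pentagon \<longleftrightarrow> g = h"
proof
  assume eq: "g \<circ> base_pentagon = h \<circ> base_pentagon"
  show "g = h"
  proof
    fix x show "g x = h x"
    proof (cases "x \<in> {1..5}")
      case True
      then obtain i where "x = base_pentagon i" using base_pentagon_bij unfolding bij_betw_def by blast
      then show ?thesis using fun_cong[OF eq, of i] by simp
    next
      case False
      then show ?thesis using assms unfolding S5_carrier by (metis permutes_not_in)
    qed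
  qed
qed simp

text \<open>Together with \<open>pentagon_eq_iff\<close> this makes the ordered pentagons a free
  transitive orbit, so that oriented and double pentagons can be treated as cosets.\<close>

lemma pentagons_eq: "pentagons = (\<lambda>g. g \<circ> base_pentagon) ` carrier S5"
proof
  show "(\<lambda>g. g \<circ> base_pentagon) ` carrier S5 \<subseteq> pentagons"
    unfolding pentagons_def S5_carrier[abs_def]
    using bij_betw_trans[OF base_pentagon_bij permutes_imp_bij] S5_carrier by auto
  show "pentagons \<subseteq> (\<lambda>g. g \<circ> base_pentagon) ` carrier S5"
  proof
    fix p assume "p \<in> pentagons"
    then have p: "bij_betw p UNIV {1..5}" by (simp add: pentagons_def)
    define b where "b = inv_into UNIV base_pentagon"
    define g where "g x = (if x \<in> {1..5} then p (b x) else x)" for x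
    have "bij_betw (p \<circ> b) {1..5} {1..5}"
      unfolding b_def by (rule bij_betw_trans[OF bij_betw_inv_into[OF base_pentagon_bij] p])
    then have "bij_betw g {1..5} {1..5}"
      by (rule bij_betw_cong[THEN iffD1, rotated]) (simp add: g_def)
    then have "g permutes {1..5}"
      by (rule bij_imp_permutes) (auto simp: g_def)
    moreover have "g \<circ> base_pentagon = p"
    proof
      fix i have "base_pentagon i \<in> {1..5}" using base_pentagon_bij bij_betwE by blast
      then show "(g \<circ> base_pentagon) i = p i"
        using base_pentagon_bij by (simp add: g_def b_def bij_betw_def)
    qed
    ultimately show "p \<in> (\<lambda>g. g \<circ> base_pentagon) ` carrier S5"
      unfolding S5_carrier[symmetric] by blast
  qed
qed

section \<open>Oriented, unoriented and double classes\<close>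

lemma oriented_shift: "oriented (\<lambda>i. p (i + b)) = oriented p"
proof -
  have "(\<lambda>i. p (i + a)) \<in> oriented (\<lambda>i. p (i + b))" for a
    unfolding oriented_def by (auto intro!: exI[of _ "a - b"] simp: algebra_simps)
  moreover have "(\<lambda>i. p (i + a + b)) \<in> oriented p" for a
    unfolding oriented_def by (auto intro!: exI[of _ "a + b"] simp: algebra_simps)
  ultimately show ?thesis by (auto simp: oriented_def)
qed

lemma unoriented_eq_oriented: "unoriented p = oriented p \<union> oriented (\<lambda>i. p (- i))"
proof -
  have "(\<lambda>i. p (- i + a)) = (\<lambda>i. p (- (i + - a)))" "(\<lambda>i. p (- (i + a))) = (\<lambda>i. p (- i + - a))" for a
    by (simp_all add: algebra_simps)
  then have "{(\<lambda>i. p (- i + a)) | a. True} = {(\<lambda>i. p (- (i + a))) | a. True}" by blast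
  then show ?thesis by (simp add: unoriented_def oriented_def)
qed

lemma unoriented_shift: "unoriented (\<lambda>i. p (i + b)) = unoriented p"
  using oriented_shift[of p b] oriented_shift[of "\<lambda>i. p (- i)" "- b"]
  by (simp add: unoriented_eq_oriented algebra_simps)

lemma unoriented_uminus: "unoriented (\<lambda>i. p (- i)) = unoriented p"
  by (auto simp: unoriented_eq_oriented)

definition double_class :: "(5 \<Rightarrow> nat) \<Rightarrow> (5 \<Rightarrow> nat) set set" where
  "double_class p = {unoriented p, unoriented (\<lambda>i. p (2 * i))}"

lemma double_class_shift: "double_class (\<lambda>i. p (i + b)) = double_class p"
proof -
  \<comment> \<open>As 3 is the inverse of 2 modulo 5, a shift after doubling is a shift before
    doubling.\<close>
  have "2 * i + b = 2 * (i + 3 * b)" for i :: 5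
    using cases_5[of i] cases_5[of b] by (elim disjE) simp_all
  then have "unoriented (\<lambda>i. p (2 * i + b)) = unoriented (\<lambda>i. p (2 * i))"
    using unoriented_shift[of "\<lambda>i. p (2 * i)" "3 * b"] by (simp only:)
  then show ?thesis
    by (simp only: double_class_def unoriented_shift)
qed

text \<open>Dilation by 3 exchanges the two members of the pair: 3 = -2 modulo 5 gives the neighbour
  up to reflection, and 3 * 2 = 1 leads from the neighbour back.\<close>

lemma double_class_mult: "double_class (\<lambda>i. p (3 * i)) = double_class p"
proof -
  have "3 * i = 2 * (- i)" for i :: 5
    using cases_5[of i] by (elim disjE) simp_all
  then have "unoriented (\<lambda>i. p (3 * i)) = unoriented (\<lambda>i. p (2 * i))"
    using unoriented_uminus[of "\<lambda>i. p (2 * i)"] by (simp only:)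
  moreover have "3 * (2 * i) = i" for i :: 5
    using cases_5[of i] by (elim disjE) simp_all
  ultimately show ?thesis
    by (simp only: double_class_def insert_commute)
qed

lemma double_class_affine: "double_class (g \<circ> quint ^^ n \<circ> quart ^^ k \<circ> base_pentagon) = double_class (g \<circ> base_pentagon)"
proof -
  have "double_class (\<lambda>i. p (3 ^ k * i)) = double_class p" for p
  proof (induction k)
    case (Suc k)
    then show ?case using double_class_mult[of "\<lambda>i. p (3 ^ k * i)"] by (simp add: algebra_simps)
  qed simp
  from this[of "\<lambda>i. g (base_pentagon (i + of_nat n))"]
  show ?thesis
    using double_class_shift[of "\<lambda>i. g (base_pentagon i)" "of_nat n"]
    by (simp add: comp_def base_pentagon_add base_pentagon_mult)
qed

text \<open>The two unoriented classes contain the dilations by 1, -1, 2 and -2 with all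
  translations; modulo 5 these four factors are the powers of 3 with exponents 0, 2, 3 and
  1.\<close>

lemma in_double_class:
  assumes "q \<in> \<Union> (double_class p)"
  shows "\<exists>k a. k < 4 \<and> q = (\<lambda>i. p (3 ^ k * i + a))"
proof -
  have aff: "(- i :: 5) = 3 ^ 2 * i" "2 * i = (3 ^ 3 * i :: 5)" "2 * - i = (3 ^ 1 * i :: 5)" for i
    using cases_5[of i] by (elim disjE; simp)+
  consider a where "q = (\<lambda>i. p (i + a))" | a where "q = (\<lambda>i. p (- i + a))"
    | a where "q = (\<lambda>i. p (2 * (i + a)))" | a where "q = (\<lambda>i. p (2 * (- i + a)))"
    using assms by (auto simp: double_class_def unoriented_def)
  then show ?thesis
  proof cases
    case (1 a) then show ?thesis by (intro exI[of _ 0] exI[of _ a]) simp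
  next
    case (2 a) then show ?thesis unfolding aff(1) by (intro exI[of _ 2] exI[of _ a]) simp
  next
    case (3 a) then show ?thesis unfolding ring_distribs aff(2) by (intro exI[of _ 3] exI) simp
  next
    case (4 a) then show ?thesis unfolding ring_distribs aff(3) by (intro exI[of _ 1] exI) simp
  qed
qed

lemma oriented_eqD:
  assumes "g \<in> carrier S5" "h \<in> carrier S5" "oriented (g \<circ> base_pentagon) = oriented (h \<circ> base_pentagon)"
  shows "\<exists>n. h = g \<circ> quint ^^ n"
proof -
  have "h \<circ> base_pentagon \<in> oriented (h \<circ> base_pentagon)"
    unfolding oriented_def by (auto intro!: exI[of _ 0])
  then obtain a where "h \<circ> base_pentagon = (\<lambda>i. (g \<circ> base_pentagon) (i + a))"
    using assms(3) unfolding oriented_def by auto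
  moreover obtain n where "a = of_nat n" using of_nat_5 by blast
  ultimately have "h \<circ> base_pentagon = (g \<circ> quint ^^ n) \<circ> base_pentagon"
    by (simp add: comp_def base_pentagon_add)
  then show ?thesis
    using pentagon_eq_iff assms(1,2) S5_comp S5_power quint_S5 by metis
qed

lemma oriented_quint: "oriented (g \<circ> quint ^^ n \<circ> base_pentagon) = oriented (g \<circ> base_pentagon)"
  using oriented_shift[of "g \<circ> base_pentagon" "of_nat n"] by (simp add: comp_def base_pentagon_add)

text \<open>Converse to \<open>double_class_affine\<close>: two permutations give the same double
  pentagon only if they differ on the right by an element of the affine group. The bound on
  \<open>k\<close> is what the use of \<open>quad\<close> requires.\<close>

lemma double_class_eqD:
  assumes "g \<in> carrier S5" "h \<in> carrier S5" "double_class (g \<circ> base_pentagon) = double_class (h \<circ> base_pentagon)"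
  shows "\<exists>n k. k < 4 \<and> h = g \<circ> quint ^^ n \<circ> quart ^^ k"
proof -
  have "h \<circ> base_pentagon \<in> \<Union> (double_class (h \<circ> base_pentagon))"
    unfolding double_class_def unoriented_def by (auto intro!: exI[of _ 0])
  then obtain k a where k: "k < 4" "h \<circ> base_pentagon = (\<lambda>i. (g \<circ> base_pentagon) (3 ^ k * i + a))"
    using assms(3) in_double_class by metis
  moreover obtain n where "\<forall>i. base_pentagon (3 ^ k * i + a) = (quint ^^ n) ((quart ^^ k) (base_pentagon i))"
    using base_pentagon_affine by blast
  ultimately have "h \<circ> base_pentagon = (g \<circ> quint ^^ n \<circ> quart ^^ k) \<circ> base_pentagon"
    by (simp add: comp_def)
  then have "h = g \<circ> quint ^^ n \<circ> quart ^^ k"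
    using pentagon_eq_iff assms(1,2) S5_comp S5_power quint_S5 quart_S5 by metis
  then show ?thesis using k(1) by blast
qed

lemma oriented_act_class: "oriented_act g (oriented p) = oriented (g \<circ> p)"
  by (auto simp: oriented_act_def oriented_def comp_def)

lemma double_act_class: "double_act g (double_class p) = double_class (g \<circ> p)"
proof -
  have "(\<lambda>p. g \<circ> p) ` unoriented q = unoriented (g \<circ> q)" for q
    by (auto simp: unoriented_def comp_def image_Un image_def)
  from this[of p] this[of "\<lambda>i. p (2 * i)"] show ?thesis
    by (simp add: double_act_def double_class_def comp_def)
qed

lemma double_pentagons_eq: "double_pentagons = (\<lambda>g. double_class (g \<circ> base_pentagon)) ` carrier S5"
  by (auto simp: double_pentagons_def pentagons_eq double_class_def)

lemma oriented_pentagons_eq: "oriented_pentagons = (\<lambda>g. oriented (g \<circ> base_pentagon)) ` carrier S5"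
  by (auto simp: oriented_pentagons_def pentagons_eq)

lemma is_gset_oriented: "is_gset S5 oriented_pentagons oriented_act"
  unfolding is_gset_def oriented_pentagons_eq S5_mult S5_one
  by (auto simp: oriented_act_class S5_comp comp_assoc[symmetric])

lemma is_gset_double: "is_gset S5 double_pentagons double_act"
  unfolding is_gset_def double_pentagons_eq S5_mult S5_one
  by (auto simp: double_act_class S5_comp comp_assoc[symmetric])

context del_pezzo
begin

section \<open>M as oriented pentagons, and the labelling of double pentagons by index pairs\<close>

lemma is_gset_M: "is_gset S5 M_set \<rho>"
  unfolding is_gset_def M_set_orbit S5_mult S5_one
  by (auto simp: rho_comp[symmetric] S5_comp rho_mem rho_id S5_id comp_assoc)

lemma rho_quint_right: "g \<in> carrier S5 \<Longrightarrow> \<rho> (g \<circ> quint ^^ n) (s_form 1 2) = \<rho> g (s_form 1 2)"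
  by (simp add: rho_comp S5_power quint_S5 rho_quint_pow)

lemma M_gset_iso: "gset_iso S5 M_set \<rho> oriented_pentagons oriented_act"
proof -
  \<comment> \<open>The choice of \<open>g\<close> is immaterial: by \<open>rho_orbit_eq\<close> two
    choices differ by a power of \<open>quint\<close> on the right, which rotates the
    pentagon.\<close>
  define f where "f m = oriented ((SOME g. g \<in> carrier S5 \<and> \<rho> g (s_form 1 2) = m) \<circ> base_pentagon)" for m
  have f: "f (\<rho> g (s_form 1 2)) = oriented (g \<circ> base_pentagon)" if g: "g \<in> carrier S5" for g
  proof -
    let ?h = "SOME h. h \<in> carrier S5 \<and> \<rho> h (s_form 1 2) = \<rho> g (s_form 1 2)"
    have h: "?h \<in> carrier S5 \<and> \<rho> ?h (s_form 1 2) = \<rho> g (s_form 1 2)"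
      by (rule someI[of "\<lambda>h. h \<in> carrier S5 \<and> \<rho> h (s_form 1 2) = \<rho> g (s_form 1 2)" g]) (use g in simp)
    then obtain b where "?h = g \<circ> quint ^^ b" using rho_orbit_eq[OF g, of ?h] by auto
    then show ?thesis unfolding f_def by (simp only: oriented_quint)
  qed
  have "bij_betw f M_set oriented_pentagons"
    unfolding bij_betw_def
  proof
    show "inj_on f M_set"
    proof (rule inj_onI)
      fix m m' assume "m \<in> M_set" "m' \<in> M_set" and eq: "f m = f m'"
      then obtain g g' where g: "g \<in> carrier S5" "g' \<in> carrier S5" "m = \<rho> g (s_form 1 2)" "m' = \<rho> g' (s_form 1 2)"
        unfolding M_set_orbit by blast
      then have "oriented (g \<circ> base_pentagon) = oriented (g' \<circ> base_pentagon)" using eq f by simp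
      then obtain n where "g' = g \<circ> quint ^^ n" using oriented_eqD g by blast
      then show "m = m'" using g rho_quint_right by simp
    qed
    show "f ` M_set = oriented_pentagons"
      unfolding M_set_orbit oriented_pentagons_eq image_image by (simp add: f cong: image_cong)
  qed
  moreover have "f (\<rho> g m) = oriented_act g (f m)" if g: "g \<in> carrier S5" and m: "m \<in> M_set" for g m
  proof -
    obtain h where h: "h \<in> carrier S5" "m = \<rho> h (s_form 1 2)" using m unfolding M_set_orbit by blast
    then have "\<rho> g m = \<rho> (g \<circ> h) (s_form 1 2)" using g by (simp add: rho_comp)
    then show ?thesis using f[OF S5_comp[OF g h(1)]] f[OF h(1)] h(2) by (simp add: oriented_act_class comp_assoc)
  qed
  ultimately show ?thesis
    unfolding gset_iso_def using is_gset_M is_gset_oriented by blast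
qed

text \<open>The factors stand in the order produced by \<open>double_class_eqD\<close>, opposite to
  that of the normal form. It makes no difference here, since \<open>quint\<close> also fixes
  \<open>sigma_form 1 2\<close> and hence all of \<open>quad 1 2\<close>.\<close>

lemma rho_affine_right:
  assumes "k < 4"
  shows "\<rho> (quint ^^ n \<circ> quart ^^ k) (s_form 1 2) = quad 1 2 k"
proof -
  have "\<rho> (quint ^^ n) (quad 1 2 k) = quad 1 2 k"
    by (simp add: quad_def eta_values rho_quint_pow rho_uminus S5_power quint_S5)
  then show ?thesis
    using assms by (simp add: rho_comp S5_power quart_S5 quint_S5 rho_quart_pow)
qed

definition dpent :: "nat \<times> nat \<Rightarrow> (5 \<Rightarrow> nat) set set" where
  "dpent = (\<lambda>(i, j). double_class (perm3 i j \<circ> base_pentagon))"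

lemma dpent_class:
  assumes "(i, j) \<in> idx" "k < 4"
  shows "double_class (perm3 i j \<circ> quart ^^ k \<circ> quint ^^ a \<circ> base_pentagon) = dpent (i, j)"
  using double_class_affine[of "perm3 i j" 0 k] double_class_affine[of "perm3 i j \<circ> quart ^^ k" a 0]
  by (simp add: dpent_def)

text \<open>If two labels give the same double pentagon, their representatives differ by an affine
  permutation; applied to \<open>s_form 1 2\<close> this equates an element of
  \<open>quad i' j'\<close> with one of \<open>quad i j\<close>, which \<open>quad_inj\<close>
  allows only for equal labels. Surjectivity is the normal form with its affine factor
  absorbed.\<close>

lemma dpent_bij: "bij_betw dpent idx double_pentagons"
  unfolding bij_betw_def
proof
  show "inj_on dpent idx"
  proof (rule inj_onI, clarify)
    fix i j i' j' assume ij: "(i, j) \<in> idx" "(i', j') \<in> idx" and "dpent (i, j) = dpent (i', j')"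
    then have eq: "double_class (perm3 i j \<circ> base_pentagon) = double_class (perm3 i' j' \<circ> base_pentagon)"
      by (simp add: dpent_def)
    note S = S5_perm3[OF ij(1)] S5_perm3[OF ij(2)]
    obtain n k where k: "k < 4" "perm3 i' j' = perm3 i j \<circ> quint ^^ n \<circ> quart ^^ k"
      using double_class_eqD[OF S eq] by blast
    have "quad i' j' 0 = \<rho> (perm3 i' j') (s_form 1 2)"
      using rho_perm3[OF ij(2)] by (simp add: quad_def)
    also have "\<dots> = \<rho> (perm3 i j) (quad 1 2 k)"
      unfolding k(2) comp_assoc
      using rho_affine_right[OF k(1), of n] S
      by (simp add: rho_comp S5_comp S5_power quart_S5 quint_S5 rho_mem)
    also have "\<dots> = quad i j k"
      using rho_perm3[OF ij(1)] S by (simp add: quad_def eta_values rho_uminus)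
    finally show "i = i' \<and> j = j'"
      using inj_onD[OF quad_inj, of "((i, j), k)" "((i', j'), 0)"] ij k(1) by auto
  qed
  show "dpent ` idx = double_pentagons"
  proof
    show "dpent ` idx \<subseteq> double_pentagons"
      unfolding double_pentagons_eq dpent_def using S5_perm3 by auto
    show "double_pentagons \<subseteq> dpent ` idx"
    proof
      fix d assume "d \<in> double_pentagons"
      then obtain g where g: "g \<in> carrier S5" "d = double_class (g \<circ> base_pentagon)"
        unfolding double_pentagons_eq by blast
      obtain i j k a where "(i, j) \<in> idx" "k < 4" "a < 5" "g = perm3 i j \<circ> quart ^^ k \<circ> quint ^^ a"
        using S5_cases[OF g(1)] by blast
      then have "d = dpent (i, j)" "(i, j) \<in> idx" using dpent_class g(2) by auto
      then show "d \<in> dpent ` idx" by blast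
    qed
  qed
qed

end

section \<open>The symmetric square\<close>

lemma peval_pconst_pscale: "peval pconst a (pscale c p) = pscale c (peval pconst a p)"
  by (simp add: pscale_eq_mult peval_pconst_simps)

lemma sym_mult_add: "sym_mult (p + q) = sym_mult p + sym_mult q"
  and sym_mult_diff: "sym_mult (p - q) = sym_mult p - sym_mult q"
  and sym_mult_mult: "sym_mult (p * q) = sym_mult p * sym_mult q"
  and sym_mult_pscale: "sym_mult (pscale c p) = pscale c (sym_mult p)"
  and sym_mult_sum: "sym_mult (\<Sum>x\<in>A. f x) = (\<Sum>x\<in>A. sym_mult (f x))"
  and sym_mult_pvar: "sym_mult (pvar (i, j)) = s_form i j"
  and sym_mult_0: "sym_mult 0 = 0"
  unfolding sym_mult_def by (simp_all add: peval_pconst_simps peval_pconst_pscale)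

lemma forms_1_expand:
  assumes "finite X" "p \<in> forms 1 X"
  obtains c where "p = (\<Sum>x\<in>X. pscale (c x) (pvar x))"
proof -
  obtain c where "\<forall>i\<in>{()}. p = (\<Sum>j\<in>X. pvar j * pconst (c i j))"
    using forms_1_family[of X "{()}" "\<lambda>_. p"] assms by auto
  then show ?thesis using that[of "c ()"] by (simp add: pscale_eq_mult mult.commute)
qed

lemma finite_idx: "finite idx"
  by (simp add: idx_eq)

text \<open>Uniqueness for the description in \<open>sym_lin\<close> holds because
  \<open>sym_mult\<close> sends a linear form to the combination of basis sections with the same
  coefficients, and \<open>s_coeff\<close> reads these off again.\<close>

lemma sym_lin_eq:
  assumes "v \<in> V_space"
  shows "sym_lin v = (\<Sum>x\<in>idx. pscale (s_coeff v x) (pvar x))"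
  unfolding sym_lin_def
proof (rule the_equality)
  show "(\<Sum>x\<in>idx. pscale (s_coeff v x) (pvar x)) \<in> forms 1 idx \<and>
      sym_mult (\<Sum>x\<in>idx. pscale (s_coeff v x) (pvar x)) = v"
  proof
    show "(\<Sum>x\<in>idx. pscale (s_coeff v x) (pvar x)) \<in> forms 1 idx"
      by (intro forms_sum forms_pscale forms_pvar)
    have "sym_mult (\<Sum>x\<in>idx. pscale (s_coeff v x) (pvar x)) = (\<Sum>(i, j)\<in>idx. pscale (s_coeff v (i, j)) (s_form i j))"
      by (auto simp: sym_mult_sum sym_mult_pscale sym_mult_pvar intro!: sum.cong)
    then show "sym_mult (\<Sum>x\<in>idx. pscale (s_coeff v x) (pvar x)) = v"
      using V_space_expand[OF assms] by simp
  qed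
next
  fix l assume l: "l \<in> forms 1 idx \<and> sym_mult l = v"
  obtain c where c: "l = (\<Sum>x\<in>idx. pscale (c x) (pvar x))"
    by (rule forms_1_expand[OF finite_idx]) (use l in auto)
  have "v = (\<Sum>(i, j)\<in>idx. pscale (c (i, j)) (s_form i j))"
    using l unfolding c by (auto simp: sym_mult_sum sym_mult_pscale sym_mult_pvar intro!: sum.cong)
  then have "s_coeff v x = c x" if "x \<in> idx" for x using s_coeff_lincomb[OF that] by simp
  then show "l = (\<Sum>x\<in>idx. pscale (s_coeff v x) (pvar x))" using c by simp
qed

lemma sym_lin_add: "u \<in> V_space \<Longrightarrow> v \<in> V_space \<Longrightarrow> sym_lin (u + v) = sym_lin u + sym_lin v"
  by (simp add: sym_lin_eq V_space_add s_coeff_add pscale_add_left sum.distrib)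

lemma sym_lin_pscale: "v \<in> V_space \<Longrightarrow> sym_lin (pscale c v) = pscale c (sym_lin v)"
  by (simp add: sym_lin_eq V_space_pscale s_coeff_pscale pscale_sum)

lemma sym_lin_uminus: "v \<in> V_space \<Longrightarrow> sym_lin (- v) = - sym_lin v"
  using sym_lin_pscale[of v "- 1"] by simp

lemma sym_lin_diff: "u \<in> V_space \<Longrightarrow> v \<in> V_space \<Longrightarrow> sym_lin (u - v) = sym_lin u - sym_lin v"
  using sym_lin_add[of u "- v"] by (simp add: V_space_uminus sym_lin_uminus)

lemma sym_lin_0: "sym_lin 0 = 0"
  using sym_lin_pscale[of 0 0] by (simp add: V_space_0)

lemma sym_lin_sum: "(\<And>x. x \<in> A \<Longrightarrow> f x \<in> V_space) \<Longrightarrow> sym_lin (\<Sum>x\<in>A. f x) = (\<Sum>x\<in>A. sym_lin (f x))"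
  by (induction A rule: infinite_finite_induct) (auto simp: sym_lin_0 sym_lin_add V_space_sum)

lemma sym_lin_s_form:
  assumes "(i, j) \<in> idx" shows "sym_lin (s_form i j) = pvar (i, j)"
  using assms
  by (simp add: sym_lin_eq s_form_in_V s_coeff_s_form if_distrib[of "\<lambda>c. pscale c _"] finite_idx sum.delta cong: if_cong)

section \<open>The quadrics Q and the kernel of multiplication\<close>

lemma Q_values:
  "Q_elt 1 2 = pvar (1, 2) * (pvar (1, 3) - pvar (3, 1) - pvar (2, 3))"
  "Q_elt 1 3 = - (pvar (1, 3) * (pvar (1, 2) - pvar (2, 1) - pvar (3, 2)))"
  "Q_elt 2 1 = - (pvar (2, 1) * (pvar (2, 3) - pvar (3, 2) - pvar (1, 3)))"
  "Q_elt 2 3 = pvar (2, 3) * (pvar (2, 1) - pvar (1, 2) - pvar (3, 1))"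
  "Q_elt 3 1 = pvar (3, 1) * (pvar (3, 2) - pvar (2, 3) - pvar (1, 2))"
  "Q_elt 3 2 = - (pvar (3, 2) * (pvar (3, 1) - pvar (1, 3) - pvar (2, 1)))"
  by (simp_all add: Q_elt_def sigma_values sym_lin_add sym_lin_diff sym_lin_uminus V_space_closed s_form_in_V
      sym_lin_s_form idx_eq algebra_simps)

lemma Q_elt_Sym2: "(i, j) \<in> idx \<Longrightarrow> Q_elt i j \<in> Sym2_space"
proof -
  assume "(i, j) \<in> idx"
  then have "Q_elt i j \<in> forms (1 + 1) idx"
    unfolding Q_elt_def by (intro forms_mult)
      (auto simp: sym_lin_eq s_form_in_V sigma_form_in_V intro!: forms_sum forms_pscale forms_pvar)
  then show ?thesis by (simp add: Sym2_space_def)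
qed

text \<open>Factored, this is \<open>x_1 x_2 x_3 (x_1 - x_2) (x_2 - x_3) (x_3 - x_1)\<close>, the
  six lines joining pairs of base points. It vanishes to order three at each base point, so as a
  section of -2K its divisor also contains the four exceptional curves.\<close>

definition lines_form :: "nat mpoly" where
  "lines_form = s_form 1 2 * sigma_form 1 2"

lemma sym_mult_uminus: "sym_mult (- p) = - sym_mult p"
  using sym_mult_pscale[of "- 1" p] by simp

lemma sym_mult_Q:
  assumes "(i, j) \<in> idx" shows "sym_mult (Q_elt i j) = lines_form"
  using assms
  by (cases rule: idx_cases)
    (simp_all add: Q_values lines_form_def sigma_values sym_mult_mult sym_mult_add sym_mult_diff sym_mult_uminus
      sym_mult_pvar s_form_def algebra_simps)

lemma lines_form_nonzero: "pscale c lines_form = 0 \<Longrightarrow> c = 0"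
proof -
  assume "pscale c lines_form = 0"
  \<comment> \<open>The point (1 : 2 : 3) lies on none of the six lines.\<close>
  then have "peval id (\<lambda>i. of_nat i) (pscale c lines_form) = 0" by simp
  then show "c = 0" by (simp add: lines_form_def sigma_values s_form_def ev_simps)
qed

text \<open>No \<open>Q_elt\<close> contains a square, so evaluation at the indicator of two index
  pairs isolates the coefficient of one mixed monomial. For two pairs of the same sign this is, up
  to sign, the sum of the two corresponding coefficients, and three numbers whose pairwise sums
  vanish are zero.\<close>

lemma Q_indep:
  assumes "(\<Sum>x\<in>idx. pscale (a x) (case x of (i, j) \<Rightarrow> Q_elt i j)) = 0"
  shows "\<forall>x\<in>idx. a x = 0"
proof -
  have ev: "peval id y (\<Sum>x\<in>idx. pscale (a x) (case x of (i, j) \<Rightarrow> Q_elt i j)) = 0" for y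
    unfolding assms by simp
  have "a (1, 2) + a (3, 1) = 0"
    using ev[of "\<lambda>x. if x \<in> {(1, 2), (3, 1)} then 1 else 0"] by (simp add: sum_idx Q_values ev_simps neg_eq_iff_add_eq_0)
  moreover have "a (1, 2) + a (2, 3) = 0"
    using ev[of "\<lambda>x. if x \<in> {(1, 2), (2, 3)} then 1 else 0"] by (simp add: sum_idx Q_values ev_simps neg_eq_iff_add_eq_0)
  moreover have "a (2, 3) + a (3, 1) = 0"
    using ev[of "\<lambda>x. if x \<in> {(2, 3), (3, 1)} then 1 else 0"] by (simp add: sum_idx Q_values ev_simps neg_eq_iff_add_eq_0)
  moreover have "a (1, 3) + a (2, 1) = 0"
    using ev[of "\<lambda>x. if x \<in> {(1, 3), (2, 1)} then 1 else 0"] by (simp add: sum_idx Q_values ev_simps)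
  moreover have "a (1, 3) + a (3, 2) = 0"
    using ev[of "\<lambda>x. if x \<in> {(1, 3), (3, 2)} then 1 else 0"] by (simp add: sum_idx Q_values ev_simps)
  moreover have "a (2, 1) + a (3, 2) = 0"
    using ev[of "\<lambda>x. if x \<in> {(2, 1), (3, 2)} then 1 else 0"] by (simp add: sum_idx Q_values ev_simps)
  ultimately have "a (1, 2) = 0 \<and> a (2, 3) = 0 \<and> a (3, 1) = 0 \<and> a (1, 3) = 0 \<and> a (2, 1) = 0 \<and> a (3, 2) = 0"
    by algebra
  then show ?thesis by (simp add: idx_eq)
qed

lemma W'_space_eq: "W'_space = range (\<lambda>a. \<Sum>x\<in>idx. pscale (a x) (case x of (i, j) \<Rightarrow> Q_elt i j))"
    (is "_ = range ?f")
proof -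
  interpret vector_space "pscale :: complex \<Rightarrow> (nat \<times> nat) mpoly \<Rightarrow> _"
    by (rule vector_space_pscale)
  have "subspace (range ?f)"
    unfolding subspace_iff[OF vector_space_pscale]
  proof (intro conjI ballI allI)
    show "0 \<in> range ?f" by (rule range_eqI[of _ _ "\<lambda>_. 0"]) simp
    fix p assume "p \<in> range ?f"
    then obtain a where a: "p = ?f a" by blast
    show "pscale c p \<in> range ?f" for c
      unfolding a by (rule range_eqI[of _ _ "\<lambda>x. c * a x"]) (simp add: pscale_sum)
    fix q assume "q \<in> range ?f"
    then obtain b where b: "q = ?f b" by blast
    show "p + q \<in> range ?f"
      unfolding a b by (rule range_eqI[of _ _ "\<lambda>x. a x + b x"]) (simp add: pscale_add_left sum.distrib)
  qed
  moreover have "{Q_elt i j | i j. (i, j) \<in> idx} \<subseteq> range ?f"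
  proof clarify
    fix i j assume ij: "(i, j) \<in> idx"
    show "Q_elt i j \<in> range ?f"
      by (rule range_eqI[of _ _ "\<lambda>x. if x = (i, j) then 1 else 0"])
        (simp add: if_distrib[of "\<lambda>c. pscale c _"] finite_idx ij sum.delta cong: if_cong)
  qed
  ultimately have "W'_space \<subseteq> range ?f"
    unfolding W'_space_def by (rule span_minimal[rotated])
  moreover have "?f a \<in> W'_space" for a
    unfolding W'_space_def
    by (intro span_sum span_scale span_base) auto
  ultimately show ?thesis by blast
qed

text \<open>Evaluation at points of the lines \<open>x\<^sub>i = 0\<close> and \<open>x\<^sub>i = x\<^sub>j\<close> gives enough equations to determine
  the kernel of \<open>sym_mult\<close>.\<close>

lemma sextic_relations:
  fixes d11 d12 d13 d14 d15 d16 d22 d23 d24 d25 d26 d33 d34 d35 d36 d44 d45 d46 d55 d56 d66 :: complex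
  assumes H: "\<And>x y z. d11 * (x * y * (y - z)) * (x * y * (y - z)) +
      d12 * (x * y * (y - z)) * (x * z * (z - y)) + d13 * (x * y * (y - z)) * (y * x * (x - z)) +
      d14 * (x * y * (y - z)) * (y * z * (z - x)) + d15 * (x * y * (y - z)) * (z * x * (x - y)) +
      d16 * (x * y * (y - z)) * (z * y * (y - x)) + d22 * (x * z * (z - y)) * (x * z * (z - y)) +
      d23 * (x * z * (z - y)) * (y * x * (x - z)) + d24 * (x * z * (z - y)) * (y * z * (z - x)) +
      d25 * (x * z * (z - y)) * (z * x * (x - y)) + d26 * (x * z * (z - y)) * (z * y * (y - x)) +
      d33 * (y * x * (x - z)) * (y * x * (x - z)) + d34 * (y * x * (x - z)) * (y * z * (z - x)) +
      d35 * (y * x * (x - z)) * (z * x * (x - y)) + d36 * (y * x * (x - z)) * (z * y * (y - x)) +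
      d44 * (y * z * (z - x)) * (y * z * (z - x)) + d45 * (y * z * (z - x)) * (z * x * (x - y)) +
      d46 * (y * z * (z - x)) * (z * y * (y - x)) + d55 * (z * x * (x - y)) * (z * x * (x - y)) + d56 * (z * x * (x - y)) * (z * y * (y - x)) + d66 * (z * y * (y - x)) * (z * y * (y - x)) = 0"
  shows "d11 = 0 \<and> d22 = 0 \<and> d33 = 0 \<and> d44 = 0 \<and> d55 = 0 \<and> d66 = 0 \<and>
     d13 = 0 \<and> d25 = 0 \<and> d46 = 0 \<and>
     d16 = 0 \<and> d24 = 0 \<and> d35 = 0 \<and>
     (\<exists>a12 a13 a21 a23 a31 a32. d12 = a12 - a13 \<and> d34 = a23 - a21 \<and> d56 = a31 - a32 \<and>
       d15 = - a12 - a31 \<and> d14 = - a12 - a23 \<and> d45 = - a23 - a31 \<and>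
       d23 = a13 + a21 \<and> d26 = a13 + a32 \<and> d36 = a21 + a32)"
proof -
  \<comment> \<open>The numbers 1 to 6 stand for the index pairs 12, 13, 21, 23, 31, 32. On
    \<open>x = 0\<close> only forms 4 and 6 survive, with values \<open>y * z^2\<close> and
    \<open>y^2 * z\<close>, so three points determine the three coefficients involving them.\<close>
  have e0: "1 * d44 + 1 * d46 + 1 * d66 = 0"
    using H[of "0" "1" "1"] by simp
  have e1: "1 * d44 + (-1) * d46 + 1 * d66 = 0"
    using H[of "0" "1" "-1"] by simp
  have e2: "16 * d44 + 8 * d46 + 4 * d66 = 0"
    using H[of "0" "1" "2"] by simp
  have z0: "d44 = 0 \<and> d46 = 0 \<and> d66 = 0"
    using e0 e1 e2 by (simp, algebra)
  have e3: "1 * d22 + 1 * d25 + 1 * d55 = 0"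
    using H[of "1" "0" "1"] by simp
  have e4: "1 * d22 + (-1) * d25 + 1 * d55 = 0"
    using H[of "1" "0" "-1"] by simp
  have e5: "16 * d22 + 8 * d25 + 4 * d55 = 0"
    using H[of "1" "0" "2"] by simp
  have z1: "d22 = 0 \<and> d25 = 0 \<and> d55 = 0"
    using e3 e4 e5 by (simp, algebra)
  have e6: "1 * d11 + 1 * d13 + 1 * d33 = 0"
    using H[of "1" "1" "0"] by simp
  have e7: "1 * d11 + (-1) * d13 + 1 * d33 = 0"
    using H[of "1" "-1" "0"] by simp
  have e8: "16 * d11 + 8 * d13 + 4 * d33 = 0"
    using H[of "1" "2" "0"] by simp
  have z2: "d11 = 0 \<and> d13 = 0 \<and> d33 = 0"
    using e6 e7 e8 by (simp, algebra)
  \<comment> \<open>On \<open>y = z\<close> the forms 1 and 2 vanish. With \<open>y = z = 1\<close>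
    what remains is \<open>(x - 1)^2 * (x^2 * d35 - x * (d34 + d36 + d45 + d56))\<close>, and the
    two values of \<open>x\<close> separate \<open>d35\<close> from the bracketed sum. The other two
    lines are treated alike.\<close>
  have g0: "(-2) * d34 + 4 * d35 + (-2) * d36 + (-2) * d45 + (-2) * d56 = 0"
    using H[of "2" "1" "1"] by (simp add: z0 z1 z2 algebra_simps)
  have g1: "(-12) * d34 + 36 * d35 + (-12) * d36 + (-12) * d45 + (-12) * d56 = 0"
    using H[of "3" "1" "1"] by (simp add: z0 z1 z2 algebra_simps)
  have g2: "(-2) * d12 + (-2) * d15 + 4 * d16 + (-2) * d26 + (-2) * d56 = 0"
    using H[of "1" "2" "1"] by (simp add: z0 z1 z2 algebra_simps)
  have g3: "(-12) * d12 + (-12) * d15 + 36 * d16 + (-12) * d26 + (-12) * d56 = 0"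
    using H[of "1" "3" "1"] by (simp add: z0 z1 z2 algebra_simps)
  have g4: "(-2) * d12 + (-2) * d14 + (-2) * d23 + 4 * d24 + (-2) * d34 = 0"
    using H[of "1" "1" "2"] by (simp add: z0 z1 z2 algebra_simps)
  have g5: "(-12) * d12 + (-12) * d14 + (-12) * d23 + 36 * d24 + (-12) * d34 = 0"
    using H[of "1" "1" "3"] by (simp add: z0 z1 z2 algebra_simps)
  have zero: "d35 = 0" "d16 = 0" "d24 = 0"
    using g0 g1 g2 g3 g4 g5 by algebra+
  have R: "d34 + d36 + d45 + d56 = 0" "d12 + d15 + d26 + d56 = 0" "d12 + d14 + d23 + d34 = 0"
    using g0 g2 g4 unfolding zero by algebra+
  show ?thesis
  proof (intro conjI exI)
    \<comment> \<open>The witnesses are fixed by unification here. The last six equations prescribe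
      the pairwise sums of \<open>a12\<close>, \<open>a23\<close>, \<open>a31\<close> and of
      \<open>a13\<close>, \<open>a21\<close>, \<open>a32\<close>; half sums solve each triple. The
      three equations displayed are then consequences of \<open>R\<close>.\<close>
    show "d12 = - (d15 + d14 - d45) / 2 - (d23 + d26 - d36) / 2"
      "d34 = - (d14 + d45 - d15) / 2 - (d23 + d36 - d26) / 2"
      "d56 = - (d15 + d45 - d14) / 2 - (d26 + d36 - d23) / 2"
      using R by algebra+
  qed (simp_all add: z0 z1 z2 zero field_simps)
qed

text \<open>The nested expansion counts each mixed monomial twice. Collecting the 21 monomials
  brings the form into the shape assumed in \<open>sextic_relations\<close>, where only the sums of
  \<open>C x y\<close> and \<open>C y x\<close> appear.\<close>

lemma quadratic_form_idx:
  fixes v :: "nat \<times> nat \<Rightarrow> complex"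
  shows "(\<Sum>x\<in>idx. v x * (\<Sum>y\<in>idx. v y * C x y)) =
      C (1, 2) (1, 2) * (v (1, 2)) * (v (1, 2)) +
      (C (1, 2) (1, 3) + C (1, 3) (1, 2)) * (v (1, 2)) * (v (1, 3)) +
      (C (1, 2) (2, 1) + C (2, 1) (1, 2)) * (v (1, 2)) * (v (2, 1)) +
      (C (1, 2) (2, 3) + C (2, 3) (1, 2)) * (v (1, 2)) * (v (2, 3)) +
      (C (1, 2) (3, 1) + C (3, 1) (1, 2)) * (v (1, 2)) * (v (3, 1)) +
      (C (1, 2) (3, 2) + C (3, 2) (1, 2)) * (v (1, 2)) * (v (3, 2)) +
      C (1, 3) (1, 3) * (v (1, 3)) * (v (1, 3)) +
      (C (1, 3) (2, 1) + C (2, 1) (1, 3)) * (v (1, 3)) * (v (2, 1)) +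
      (C (1, 3) (2, 3) + C (2, 3) (1, 3)) * (v (1, 3)) * (v (2, 3)) +
      (C (1, 3) (3, 1) + C (3, 1) (1, 3)) * (v (1, 3)) * (v (3, 1)) +
      (C (1, 3) (3, 2) + C (3, 2) (1, 3)) * (v (1, 3)) * (v (3, 2)) +
      C (2, 1) (2, 1) * (v (2, 1)) * (v (2, 1)) +
      (C (2, 1) (2, 3) + C (2, 3) (2, 1)) * (v (2, 1)) * (v (2, 3)) +
      (C (2, 1) (3, 1) + C (3, 1) (2, 1)) * (v (2, 1)) * (v (3, 1)) +
      (C (2, 1) (3, 2) + C (3, 2) (2, 1)) * (v (2, 1)) * (v (3, 2)) +
      C (2, 3) (2, 3) * (v (2, 3)) * (v (2, 3)) +
      (C (2, 3) (3, 1) + C (3, 1) (2, 3)) * (v (2, 3)) * (v (3, 1)) +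
      (C (2, 3) (3, 2) + C (3, 2) (2, 3)) * (v (2, 3)) * (v (3, 2)) +
      C (3, 1) (3, 1) * (v (3, 1)) * (v (3, 1)) +
      (C (3, 1) (3, 2) + C (3, 2) (3, 1)) * (v (3, 1)) * (v (3, 2)) +
      C (3, 2) (3, 2) * (v (3, 2)) * (v (3, 2))"
  by (simp add: sum_idx algebra_simps)

text \<open>An element of the kernel is a quadratic form vanishing at the vector of basis sections
  of every point of the plane; finitely many such points already force it to be a combination of the
  \<open>Q_elt i j\<close>.\<close>

lemma W_subset_W': "W_space \<subseteq> W'_space"
proof
  fix q assume q: "q \<in> W_space"
  then obtain C where C: "q = (\<Sum>x\<in>idx. pvar x * (\<Sum>y\<in>idx. pvar y * pconst (C x y)))"
    using forms_2_expand[OF finite_idx, of q] unfolding W_space_def Sym2_space_def by blast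
  have ev: "(\<Sum>x\<in>idx. v x * (\<Sum>y\<in>idx. v y * C x y)) = 0"
    if v: "v = (\<lambda>(i, j). peval id p (s_form i j))" for v p
  proof -
    have "0 = peval id p (sym_mult q)" using q by (simp add: W_space_def)
    also have "\<dots> = peval id v q"
      unfolding sym_mult_def peval_peval[OF ring_hom_fun_id] v by (simp add: case_prod_unfold)
    also have "\<dots> = (\<Sum>x\<in>idx. v x * (\<Sum>y\<in>idx. v y * C x y))"
      unfolding C by (simp add: ev_simps)
    finally show ?thesis by simp
  qed
  have "C (1, 2) (1, 2) * (x * y * (y - z)) * (x * y * (y - z)) + (C (1, 2) (1, 3) +
      C (1, 3) (1, 2)) * (x * y * (y - z)) * (x * z * (z - y)) + (C (1, 2) (2, 1) +
      C (2, 1) (1, 2)) * (x * y * (y - z)) * (y * x * (x - z)) + (C (1, 2) (2, 3) +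
      C (2, 3) (1, 2)) * (x * y * (y - z)) * (y * z * (z - x)) + (C (1, 2) (3, 1) +
      C (3, 1) (1, 2)) * (x * y * (y - z)) * (z * x * (x - y)) + (C (1, 2) (3, 2) +
      C (3, 2) (1, 2)) * (x * y * (y - z)) * (z * y * (y - x)) +
      C (1, 3) (1, 3) * (x * z * (z - y)) * (x * z * (z - y)) + (C (1, 3) (2, 1) +
      C (2, 1) (1, 3)) * (x * z * (z - y)) * (y * x * (x - z)) + (C (1, 3) (2, 3) +
      C (2, 3) (1, 3)) * (x * z * (z - y)) * (y * z * (z - x)) + (C (1, 3) (3, 1) +
      C (3, 1) (1, 3)) * (x * z * (z - y)) * (z * x * (x - y)) + (C (1, 3) (3, 2) +
      C (3, 2) (1, 3)) * (x * z * (z - y)) * (z * y * (y - x)) +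
      C (2, 1) (2, 1) * (y * x * (x - z)) * (y * x * (x - z)) + (C (2, 1) (2, 3) +
      C (2, 3) (2, 1)) * (y * x * (x - z)) * (y * z * (z - x)) + (C (2, 1) (3, 1) +
      C (3, 1) (2, 1)) * (y * x * (x - z)) * (z * x * (x - y)) + (C (2, 1) (3, 2) +
      C (3, 2) (2, 1)) * (y * x * (x - z)) * (z * y * (y - x)) +
      C (2, 3) (2, 3) * (y * z * (z - x)) * (y * z * (z - x)) + (C (2, 3) (3, 1) +
      C (3, 1) (2, 3)) * (y * z * (z - x)) * (z * x * (x - y)) + (C (2, 3) (3, 2) +
      C (3, 2) (2, 3)) * (y * z * (z - x)) * (z * y * (y - x)) +
      C (3, 1) (3, 1) * (z * x * (x - y)) * (z * x * (x - y)) + (C (3, 1) (3, 2) +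
      C (3, 2) (3, 1)) * (z * x * (x - y)) * (z * y * (y - x)) + C (3, 2) (3, 2) * (z * y * (y - x)) * (z * y * (y - x)) = 0" for x y z
    using ev[OF refl, of "(\<lambda>_. z)(1 := x, 2 := y)"] unfolding quadratic_form_idx
    by (simp add: s_form_def ev_simps)
  from sextic_relations[OF this] obtain a12 a13 a21 a23 a31 a32 where
    rel: "C (1, 2) (1, 2) = 0"
      "C (1, 3) (1, 3) = 0"
      "C (2, 1) (2, 1) = 0"
      "C (2, 3) (2, 3) = 0"
      "C (3, 1) (3, 1) = 0"
      "C (3, 2) (3, 2) = 0"
      "(C (1, 2) (2, 1) + C (2, 1) (1, 2)) = 0"
      "(C (1, 3) (3, 1) + C (3, 1) (1, 3)) = 0"
      "(C (2, 3) (3, 2) + C (3, 2) (2, 3)) = 0"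
      "(C (1, 2) (3, 2) + C (3, 2) (1, 2)) = 0"
      "(C (1, 3) (2, 3) + C (2, 3) (1, 3)) = 0"
      "(C (2, 1) (3, 1) + C (3, 1) (2, 1)) = 0"
      "(C (1, 2) (1, 3) + C (1, 3) (1, 2)) = a12 - a13"
      "(C (2, 1) (2, 3) + C (2, 3) (2, 1)) = a23 - a21"
      "(C (3, 1) (3, 2) + C (3, 2) (3, 1)) = a31 - a32"
      "(C (1, 2) (3, 1) + C (3, 1) (1, 2)) = - a12 - a31"
      "(C (1, 2) (2, 3) + C (2, 3) (1, 2)) = - a12 - a23"
      "(C (2, 3) (3, 1) + C (3, 1) (2, 3)) = - a23 - a31"
      "(C (1, 3) (2, 1) + C (2, 1) (1, 3)) = a13 + a21"
      "(C (1, 3) (3, 2) + C (3, 2) (1, 3)) = a13 + a32"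
      "(C (2, 1) (3, 2) + C (3, 2) (2, 1)) = a21 + a32"
    by (elim conjE exE) blast
  \<comment> \<open>The matrix \<open>C\<close> need not be symmetric, so each relation is solved
    for one of two mirror entries, the other then cancelling in \<open>q\<close>. The form
    \<open>0 - ...\<close> lets the single rule \<open>eq_diff_eq\<close> treat all cases.\<close>
  have swap: "C (2, 1) (1, 2) = 0 - C (1, 2) (2, 1)"
    "C (3, 1) (1, 3) = 0 - C (1, 3) (3, 1)"
    "C (3, 2) (2, 3) = 0 - C (2, 3) (3, 2)"
    "C (3, 2) (1, 2) = 0 - C (1, 2) (3, 2)"
    "C (2, 3) (1, 3) = 0 - C (1, 3) (2, 3)"
    "C (3, 1) (2, 1) = 0 - C (2, 1) (3, 1)"
    "C (1, 3) (1, 2) = a12 - a13 - C (1, 2) (1, 3)"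
    "C (2, 3) (2, 1) = a23 - a21 - C (2, 1) (2, 3)"
    "C (3, 2) (3, 1) = a31 - a32 - C (3, 1) (3, 2)"
    "C (3, 1) (1, 2) = - a12 - a31 - C (1, 2) (3, 1)"
    "C (2, 3) (1, 2) = - a12 - a23 - C (1, 2) (2, 3)"
    "C (3, 1) (2, 3) = - a23 - a31 - C (2, 3) (3, 1)"
    "C (2, 1) (1, 3) = a13 + a21 - C (1, 3) (2, 1)"
    "C (3, 2) (1, 3) = a13 + a32 - C (1, 3) (3, 2)"
    "C (3, 2) (2, 1) = a21 + a32 - C (2, 1) (3, 2)"
    using rel by (simp_all only: eq_diff_eq add.commute)
  define a where "a x = (if x = (1, 2) then a12 else if x = (1, 3) then a13 else if x = (2, 1) then a21
    else if x = (2, 3) then a23 else if x = (3, 1) then a31 else a32)" for x :: "nat \<times> nat"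
  have "q = (\<Sum>x\<in>idx. pscale (a x) (case x of (i, j) \<Rightarrow> Q_elt i j))"
    unfolding C
    by (simp add: sum_idx a_def rel(1-6) swap Q_values pscale_eq_mult pconst_add pconst_diff
        pconst_uminus algebra_simps)
  then show "q \<in> W'_space" unfolding W'_space_eq by blast
qed

lemma W'_subset_Sym2: "W'_space \<subseteq> Sym2_space"
proof -
  have "(\<Sum>x\<in>idx. pscale (a x) (case x of (i, j) \<Rightarrow> Q_elt i j)) \<in> forms 2 idx" for a
    by (intro forms_sum) (auto intro!: forms_pscale Q_elt_Sym2[unfolded Sym2_space_def])
  then show ?thesis unfolding W'_space_eq Sym2_space_def by blast
qed

lemma W_space_eq: "W_space = {q \<in> W'_space. sym_mult q = 0}"
  using W_subset_W' W'_subset_Sym2 by (auto simp: W_space_def)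

lemma W'_space_add: "p \<in> W'_space \<Longrightarrow> q \<in> W'_space \<Longrightarrow> p + q \<in> W'_space"
  and W'_space_pscale: "p \<in> W'_space \<Longrightarrow> pscale c p \<in> W'_space"
  and W'_space_Q: "(i, j) \<in> idx \<Longrightarrow> Q_elt i j \<in> W'_space"
  and W'_space_0: "0 \<in> W'_space"
proof -
  interpret vector_space "pscale :: complex \<Rightarrow> (nat \<times> nat) mpoly \<Rightarrow> _"
    by (rule vector_space_pscale)
  show "p \<in> W'_space \<Longrightarrow> q \<in> W'_space \<Longrightarrow> p + q \<in> W'_space"
    "p \<in> W'_space \<Longrightarrow> pscale c p \<in> W'_space" "0 \<in> W'_space"
    unfolding W'_space_def by (rule span_add span_scale span_zero; assumption?)+
  show "(i, j) \<in> idx \<Longrightarrow> Q_elt i j \<in> W'_space"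
    unfolding W'_space_def by (rule span_base) blast
qed

lemma sgn_char_cases: "sgn_char g = 1 \<or> sgn_char g = - 1"
  by (simp add: sgn_char_def sign_def)

lemma gset_bij:
  assumes "group G" "is_gset G X act" "g \<in> carrier G"
  shows "bij_betw (act g) X X"
proof -
  interpret group G by fact
  have mem: "act h x \<in> X" if "h \<in> carrier G" "x \<in> X" for h x
    using assms(2) that unfolding is_gset_def by blast
  have "act h (act k x) = x" if "h \<in> carrier G" "k \<in> carrier G" "h \<otimes>\<^bsub>G\<^esub> k = \<one>\<^bsub>G\<^esub>" "x \<in> X" for h k x
    using assms(2) that unfolding is_gset_def by metis
  then show ?thesis
    using assms(3) mem
    by (intro bij_betw_byWitness[where f' = "act (inv\<^bsub>G\<^esub> g)"]) auto
qed

context del_pezzo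
begin

section \<open>The action on the symmetric square and the twisted quadrics\<close>

lemma sym_act_add: "sym_act \<rho> g (p + q) = sym_act \<rho> g p + sym_act \<rho> g q"
  and sym_act_mult: "sym_act \<rho> g (p * q) = sym_act \<rho> g p * sym_act \<rho> g q"
  and sym_act_pscale: "sym_act \<rho> g (pscale c p) = pscale c (sym_act \<rho> g p)"
  and sym_act_sum: "sym_act \<rho> g (\<Sum>x\<in>A. f x) = (\<Sum>x\<in>A. sym_act \<rho> g (f x))"
  and sym_act_pvar: "sym_act \<rho> g (pvar (i, j)) = sym_lin (\<rho> g (s_form i j))"
  unfolding sym_act_def by (simp_all add: peval_pconst_simps peval_pconst_pscale)

lemma rho_sum:
  assumes "g \<in> carrier S5" "\<And>x. x \<in> A \<Longrightarrow> f x \<in> V_space"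
  shows "\<rho> g (\<Sum>x\<in>A. f x) = (\<Sum>x\<in>A. \<rho> g (f x))"
  using assms(2)
  by (induction A rule: infinite_finite_induct)
    (use rho_pscale[OF assms(1) V_space_0, of 0] in \<open>auto simp: rho_add assms(1) V_space_sum\<close>)

lemma sym_act_lin:
  assumes g: "g \<in> carrier S5" and v: "v \<in> V_space"
  shows "sym_act \<rho> g (sym_lin v) = sym_lin (\<rho> g v)"
proof -
  have "sym_act \<rho> g (sym_lin v) = (\<Sum>(i, j)\<in>idx. sym_lin (\<rho> g (pscale (s_coeff v (i, j)) (s_form i j))))"
    using g by (auto simp: sym_lin_eq[OF v] sym_act_sum sym_act_pscale sym_act_pvar rho_pscale
        s_form_in_V sym_lin_pscale rho_mem intro!: sum.cong)
  also have "\<dots> = sym_lin (\<Sum>(i, j)\<in>idx. \<rho> g (pscale (s_coeff v (i, j)) (s_form i j)))"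
    by (subst sym_lin_sum) (auto simp: g rho_mem V_space_pscale s_form_in_V intro!: sum.cong)
  also have "(\<Sum>(i, j)\<in>idx. \<rho> g (pscale (s_coeff v (i, j)) (s_form i j))) = \<rho> g v"
    by (subst (2) V_space_expand[OF v], subst rho_sum[OF g])
      (auto simp: V_space_pscale s_form_in_V intro!: sum.cong)
  finally show ?thesis .
qed

text \<open>The twist by the sign makes \<open>Qtw g\<close> depend only on the double pentagon of \<open>g\<close>: passing from
  \<open>(s, \<sigma>)\<close> to \<open>(\<sigma>, - s)\<close> changes both the sign of the product and that of \<open>g\<close>.\<close>

definition Qtw :: "(nat \<Rightarrow> nat) \<Rightarrow> (nat \<times> nat) mpoly" where
  "Qtw g = pscale (sgn_char g) (sym_lin (\<rho> g (s_form 1 2)) * sym_lin (\<rho> g (sigma_form 1 2)))"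

lemma sym_act_Qtw:
  assumes "g \<in> carrier S5" "h \<in> carrier S5"
  shows "sym_act \<rho> g (Qtw h) = pscale (sgn_char g) (Qtw (g \<circ> h))"
  using assms
  by (simp add: Qtw_def sym_act_pscale sym_act_mult sym_act_lin rho_mem rho_comp sgn_S5_comp
      sgn_char_sq flip: mult.assoc)

lemma Qtw_quint: "g \<in> carrier S5 \<Longrightarrow> Qtw (g \<circ> quint ^^ a) = Qtw g"
proof -
  have "sgn_char (quint ^^ a) = 1"
  proof (induction a)
    case 0 show ?case by (simp add: sgn_char_def)
  next
    case (Suc a)
    then show ?case
      using sgn_S5_comp[OF quint_S5 S5_power[OF quint_S5, of a]] by (simp only: funpow.simps sgn_quint mult_1)
  qed
  then show "g \<in> carrier S5 \<Longrightarrow> Qtw (g \<circ> quint ^^ a) = Qtw g"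
    by (simp add: Qtw_def rho_comp S5_power quint_S5 rho_quint_pow sgn_S5_comp)
qed

lemma pscale_mult_left: "pscale c p * q = pscale c (p * q)"
  for p q :: "(nat \<times> nat) mpoly"
  by (simp add: pscale_eq_mult algebra_simps)

lemma Qtw_quart: "g \<in> carrier S5 \<Longrightarrow> Qtw (g \<circ> quart) = Qtw g"
  by (simp add: Qtw_def rho_comp quart_S5 rho_quart sgn_S5_comp sgn_quart rho_uminus rho_mem
      sym_lin_uminus pscale_uminus mult.commute)
    (metis pscale_m1 pscale_pscale mult_minus1 minus_minus)

lemma Qtw_quart_pow: "g \<in> carrier S5 \<Longrightarrow> Qtw (g \<circ> quart ^^ k) = Qtw g"
proof (induction k arbitrary: g)
  case (Suc k)
  have "g \<circ> quart ^^ Suc k = (g \<circ> quart) \<circ> quart ^^ k" by (simp only: funpow.simps comp_assoc)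
  then show ?case
    using Suc.IH[OF S5_comp[OF Suc.prems quart_S5]] Qtw_quart[OF Suc.prems] by (simp only:)
qed simp

lemma Qtw_perm3: "(i, j) \<in> idx \<Longrightarrow> Qtw (perm3 i j) = Q_elt i j"
  by (simp add: Qtw_def rho_perm3 sym_lin_pscale s_form_in_V pscale_mult_left Q_elt_def eta_perm3 sgn_char_sq)

lemma Qtw_rep: "(i, j) \<in> idx \<Longrightarrow> Qtw (perm3 i j \<circ> quart ^^ k \<circ> quint ^^ a) = Q_elt i j"
  by (simp add: Qtw_quint Qtw_quart_pow Qtw_perm3 S5_comp S5_perm3 S5_power quart_S5)

lemma Qtw_in_W': "g \<in> carrier S5 \<Longrightarrow> Qtw g \<in> W'_space \<and> sym_mult (Qtw g) = lines_form"
  using S5_cases[of g] Qtw_rep W'_space_Q sym_mult_Q by metis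

text \<open>Defined through the labels in \<open>idx\<close>; \<open>Qdp_class\<close> gives the
  description free of labels, through any permutation representing the double pentagon, from which
  equivariance follows.\<close>

definition Qdp :: "(5 \<Rightarrow> nat) set set \<Rightarrow> (nat \<times> nat) mpoly" where
  "Qdp d = (case inv_into idx dpent d of (i, j) \<Rightarrow> Q_elt i j)"

lemma Qdp_dpent: "(i, j) \<in> idx \<Longrightarrow> Qdp (dpent (i, j)) = Q_elt i j"
  using dpent_bij by (simp add: Qdp_def bij_betw_def)

lemma Qdp_class: "g \<in> carrier S5 \<Longrightarrow> Qdp (double_class (g \<circ> base_pentagon)) = Qtw g"
  using S5_cases[of g] Qtw_rep dpent_class Qdp_dpent by metis

lemma sum_double_pentagons: "(\<Sum>d\<in>double_pentagons. f d) = (\<Sum>x\<in>idx. f (dpent x))"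
  by (rule sum.reindex_bij_betw[OF dpent_bij, symmetric])

lemma Qdp_act:
  assumes "g \<in> carrier S5" "d \<in> double_pentagons"
  shows "sym_act \<rho> g (Qdp d) = pscale (sgn_char g) (Qdp (double_act g d))"
  using assms sym_act_Qtw Qdp_class S5_comp
  unfolding double_pentagons_eq by (auto simp: double_act_class simp flip: comp_assoc)

lemma W'_space_Qdp: "W'_space = range (\<lambda>a. \<Sum>d\<in>double_pentagons. pscale (a d) (Qdp d))"
proof -
  have "(\<Sum>d\<in>double_pentagons. pscale (a d) (Qdp d)) =
      (\<Sum>x\<in>idx. pscale (a (dpent x)) (case x of (i, j) \<Rightarrow> Q_elt i j))" for a
    unfolding sum_double_pentagons by (auto simp: Qdp_dpent intro!: sum.cong)
  then have "range (\<lambda>a. \<Sum>d\<in>double_pentagons. pscale (a d) (Qdp d)) =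
      (\<lambda>b. \<Sum>x\<in>idx. pscale (b x) (case x of (i, j) \<Rightarrow> Q_elt i j)) ` range (\<lambda>a x. a (dpent x))"
    by (simp add: image_image)
  also have "\<dots> = W'_space"
    unfolding W'_space_eq
  proof (intro subset_antisym image_subsetI)
    fix b :: "nat \<times> nat \<Rightarrow> complex"
    have "(\<Sum>x\<in>idx. pscale (b x) (case x of (i, j) \<Rightarrow> Q_elt i j)) =
      (\<Sum>x\<in>idx. pscale (b (inv_into idx dpent (dpent x))) (case x of (i, j) \<Rightarrow> Q_elt i j))"
      using dpent_bij by (auto simp: bij_betw_def intro!: sum.cong)
    then show "(\<Sum>x\<in>idx. pscale (b x) (case x of (i, j) \<Rightarrow> Q_elt i j)) \<in>
      (\<lambda>b. \<Sum>x\<in>idx. pscale (b x) (case x of (i, j) \<Rightarrow> Q_elt i j)) ` range (\<lambda>a x. a (dpent x))"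
      by (intro image_eqI[OF _ rangeI[of _ "\<lambda>d. b (inv_into idx dpent d)"]])
  qed (intro rangeI)
  finally show ?thesis by simp
qed

text \<open>The second claim stands in for the equivariance of multiplication, no action on sextic
  forms being given. Each \<open>Q_elt\<close> goes to the sign times some \<open>Qtw\<close>, and
  all \<open>Qtw\<close> have the same product \<open>lines_form\<close>; so \<open>sym_mult\<close>
  changes by the sign only, and its kernel on \<open>W'_space\<close> is stable.\<close>

lemma sym_act_W':
  assumes g: "g \<in> carrier S5" and q: "q \<in> W'_space"
  shows "sym_act \<rho> g q \<in> W'_space" "sym_mult (sym_act \<rho> g q) = pscale (sgn_char g) (sym_mult q)"
proof -
  obtain a where a: "q = (\<Sum>x\<in>idx. pscale (a x) (case x of (i, j) \<Rightarrow> Q_elt i j))"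
    using q unfolding W'_space_eq by blast
  define u where "u x = sym_act \<rho> g (case x of (i, j) \<Rightarrow> Q_elt i j)" for x
  have u: "u x \<in> W'_space \<and> sym_mult (u x) = pscale (sgn_char g) lines_form" if x: "x \<in> idx" for x
  proof -
    obtain i j where ij: "x = (i, j)" by (cases x)
    then have "u x = pscale (sgn_char g) (Qtw (g \<circ> perm3 i j))"
      using sym_act_Qtw[OF g S5_perm3] Qtw_perm3 x by (simp add: u_def)
    then show ?thesis
      using Qtw_in_W'[OF S5_comp[OF g S5_perm3]] x ij by (simp add: W'_space_pscale sym_mult_pscale)
  qed
  have act: "sym_act \<rho> g q = (\<Sum>x\<in>idx. pscale (a x) (u x))"
    by (simp add: a u_def sym_act_sum sym_act_pscale)
  have "(\<Sum>x\<in>A. pscale (a x) (u x)) \<in> W'_space" if "A \<subseteq> idx" for A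
    using that by (induction A rule: infinite_finite_induct)
      (auto simp: W'_space_0 W'_space_add W'_space_pscale u)
  then show "sym_act \<rho> g q \<in> W'_space" using act by simp
  have "sym_mult (sym_act \<rho> g q) = (\<Sum>x\<in>idx. pscale (a x) (pscale (sgn_char g) lines_form))"
    unfolding act by (simp add: sym_mult_sum sym_mult_pscale u)
  also have "\<dots> = pscale (sgn_char g) (\<Sum>x\<in>idx. pscale (a x) lines_form)"
    by (simp add: pscale_sum mult.commute)
  also have "(\<Sum>x\<in>idx. pscale (a x) lines_form) = sym_mult q"
    unfolding a by (auto simp: sym_mult_sum sym_mult_pscale sym_mult_Q intro!: sum.cong)
  finally show "sym_mult (sym_act \<rho> g q) = pscale (sgn_char g) (sym_mult q)" .
qed

section \<open>Comparison of W', W and D\<close>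

lemma W'_rep_sel [simp]: "rspace (W'_rep \<rho>) = W'_space" "rscale (W'_rep \<rho>) = pscale" "ract (W'_rep \<rho>) = sym_act \<rho>"
  and W_rep_sel [simp]: "rspace (W_rep \<rho>) = W_space" "rscale (W_rep \<rho>) = pscale" "ract (W_rep \<rho>) = sym_act \<rho>"
  by (simp_all add: W'_rep_def W_rep_def)

lemma D_iso_W'_twist: "D_rep \<simeq> W'_rep \<rho> \<boxtimes> sgn_char"
  unfolding D_rep_def
proof (rule perm_rep_iso[OF S5_group is_gset_double])
  show "finite double_pentagons"
    using bij_betw_finite[OF dpent_bij] finite_idx by simp
  show "rspace (W'_rep \<rho> \<boxtimes> sgn_char) =
      range (\<lambda>a. \<Sum>d\<in>double_pentagons. rscale (W'_rep \<rho> \<boxtimes> sgn_char) (a d) (Qdp d))"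
    using W'_space_Qdp by simp
  show "\<forall>d\<in>double_pentagons. a d = 0"
    if "(\<Sum>d\<in>double_pentagons. rscale (W'_rep \<rho> \<boxtimes> sgn_char) (a d) (Qdp d)) = 0" for a
  proof -
    have "(\<Sum>x\<in>idx. pscale (a (dpent x)) (case x of (i, j) \<Rightarrow> Q_elt i j))
        = (\<Sum>x\<in>idx. pscale (a (dpent x)) (Qdp (dpent x)))"
      by (auto simp: Qdp_dpent intro!: sum.cong)
    also have "\<dots> = 0" using that by (simp add: sum_double_pentagons)
    finally have "\<forall>x\<in>idx. a (dpent x) = 0" by (rule Q_indep)
    moreover have "double_pentagons = dpent ` idx" using dpent_bij by (simp add: bij_betw_def)
    ultimately show ?thesis by (metis imageE)
  qed
  fix g assume g: "g \<in> carrier S5"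
  show "linear_between (W'_rep \<rho> \<boxtimes> sgn_char) (W'_rep \<rho> \<boxtimes> sgn_char) (ract (W'_rep \<rho> \<boxtimes> sgn_char) g)"
    by (rule linear_betweenI)
      (simp_all add: g sym_act_W' W'_space_pscale sym_act_add sym_act_pscale pscale_add mult.commute)
  fix d assume "d \<in> double_pentagons"
  then show "Qdp (double_act g d) = ract (W'_rep \<rho> \<boxtimes> sgn_char) g (Qdp d)"
    using g by (simp add: Qdp_act sgn_char_sq)
qed (simp add: vector_space_pscale)

lemma D_twist_iso_W': "D_rep \<boxtimes> sgn_char \<simeq> W'_rep \<rho>"
proof -
  have 1: "D_rep \<boxtimes> sgn_char \<simeq> W'_rep \<rho> \<boxtimes> sgn_char \<boxtimes> sgn_char"
    by (rule rep_iso_twist[OF D_iso_W'_twist is_char_sgn])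
  \<comment> \<open>At this point \<open>W'_rep\<close> is not yet known to be a representation, so
    the double twist is removed by transport along the identity instead of
    \<open>rep_iso_twist_twist\<close>.\<close>
  have "W'_rep \<rho> \<boxtimes> sgn_char \<boxtimes> sgn_char \<simeq> W'_rep \<rho>"
    by (rule rep_iso_transport[OF S5_group rep_iso_is_rep(2)[OF 1], where f = id])
      (auto simp: vector_space_pscale linear_between_def sgn_char_sq)
  with 1 show ?thesis by (rule rep_iso_trans)
qed

lemma is_rep_W': "is_rep S5 (W'_rep \<rho>)"
  by (rule rep_iso_is_rep(2)[OF D_twist_iso_W'])

lemma is_rep_W: "is_rep S5 (W_rep \<rho>)"
proof -
  have "is_rep S5 (W'_rep \<rho>\<lparr>rspace := W_space\<rparr>)"
  proof (rule is_rep_subrep[OF is_rep_W'])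
    show "Modules.module.subspace (rscale (W'_rep \<rho>)) W_space"
      by (auto simp: subspace_iff[OF vector_space_pscale] W_space_eq W'_space_0 W'_space_add
          W'_space_pscale sym_mult_add sym_mult_pscale sym_mult_0)
  qed (auto simp: W_space_eq sym_act_W')
  then show ?thesis by (simp add: W'_rep_def W_rep_def)
qed

lemma W_eps_iso_W': "W_rep \<rho> \<boxplus> eps_rep \<simeq> W'_rep \<rho>"
proof -
  define q where "q = (\<Sum>d\<in>double_pentagons. Qdp d)"
  have char_sel: "rspace eps_rep = UNIV" "rscale eps_rep c z = c * z" "ract eps_rep g z = sgn_char g * z" for c z g
    by (simp_all add: char_rep_def)
  have q_sum: "q = (\<Sum>d\<in>double_pentagons. pscale 1 (Qdp d))" by (simp add: q_def)
  have q_mem: "q \<in> W'_space"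
    unfolding W'_space_Qdp q_sum by (rule range_eqI[of _ _ "\<lambda>_. 1"]) simp
  have q_act: "sym_act \<rho> g q = pscale (sgn_char g) q" if g: "g \<in> carrier S5" for g
  proof -
    have "sym_act \<rho> g q = (\<Sum>d\<in>double_pentagons. pscale (sgn_char g) (Qdp (double_act g d)))"
      using g by (simp add: q_def sym_act_sum Qdp_act)
    also have "\<dots> = pscale (sgn_char g) (\<Sum>d\<in>double_pentagons. Qdp (double_act g d))"
      by (simp add: pscale_sum)
    also have "(\<Sum>d\<in>double_pentagons. Qdp (double_act g d)) = q"
      unfolding q_def by (rule sum.reindex_bij_betw[OF gset_bij[OF S5_group is_gset_double g]])
    finally show ?thesis .
  qed
  \<comment> \<open>All six summands contribute \<open>lines_form\<close> with the same sign, so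
    \<open>q\<close> does not lie in the kernel and spans a complement of it.\<close>
  have "sym_mult q = (\<Sum>x\<in>idx. lines_form)"
    unfolding q_def sum_double_pentagons sym_mult_sum
    by (rule sum.cong[OF refl]) (auto simp: Qdp_dpent sym_mult_Q)
  also have "\<dots> = pscale 6 lines_form"
    by (simp add: idx_eq pscale_eq_mult pconst_numeral)
  finally have q_mult: "sym_mult q = pscale 6 lines_form" .
  have mult_W': "\<exists>c. sym_mult v = pscale c lines_form" if v: "v \<in> W'_space" for v
  proof -
    obtain a where "v = (\<Sum>x\<in>idx. pscale (a x) (case x of (i, j) \<Rightarrow> Q_elt i j))"
      using v unfolding W'_space_eq by blast
    then have "sym_mult v = (\<Sum>x\<in>idx. pscale (a x) lines_form)"
      by (auto simp: sym_mult_sum sym_mult_pscale sym_mult_Q intro!: sum.cong)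
    also have "\<dots> = pscale (\<Sum>x\<in>idx. a x) lines_form"
      by (simp add: sum_idx pscale_add_left)
    finally show ?thesis by blast
  qed
  define f where "f = (\<lambda>(w, z). w + pscale z q)"
  show ?thesis
  proof (rule rep_iso_transport[OF S5_group, where f = f])
    show "is_rep S5 (W_rep \<rho> \<boxplus> eps_rep)"
      by (intro is_rep_sum is_rep_W is_rep_char is_char_sgn)
    show "vector_space (rscale (W'_rep \<rho>))" by (simp add: vector_space_pscale)
    show "linear_between (W_rep \<rho> \<boxplus> eps_rep) (W'_rep \<rho>) f"
      by (rule linear_betweenI)
        (auto simp: f_def W_space_eq char_sel W'_space_add W'_space_pscale q_mem pscale_add
          pscale_add_left)
    show "bij_betw f (rspace (W_rep \<rho> \<boxplus> eps_rep)) (rspace (W'_rep \<rho>))"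
      unfolding bij_betw_def
    proof
      show "inj_on f (rspace (W_rep \<rho> \<boxplus> eps_rep))"
      proof (rule inj_onI)
        fix x y assume "x \<in> rspace (W_rep \<rho> \<boxplus> eps_rep)" "y \<in> rspace (W_rep \<rho> \<boxplus> eps_rep)"
          and eq: "f x = f y"
        moreover obtain w z w' z' where xy: "x = (w, z)" "y = (w', z')" by (cases x, cases y) auto
        ultimately have w: "sym_mult w = 0" "sym_mult w' = 0"
          by (auto simp: W_space_def)
        have "sym_mult (f x) = sym_mult (f y)" using eq by simp
        then have "pscale (z * 6) lines_form = pscale (z' * 6) lines_form"
          by (simp add: xy f_def sym_mult_add sym_mult_pscale w q_mult)
        then have "pscale (z * 6 - z' * 6) lines_form = 0"
          using pscale_add_left[of "z * 6 - z' * 6" "z' * 6" lines_form] by simp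
        then have "z = z'" using lines_form_nonzero by fastforce
        then show "x = y" using eq by (simp add: xy f_def)
      qed
      show "f ` rspace (W_rep \<rho> \<boxplus> eps_rep) = rspace (W'_rep \<rho>)"
      proof
        show "f ` rspace (W_rep \<rho> \<boxplus> eps_rep) \<subseteq> rspace (W'_rep \<rho>)"
          by (auto simp: f_def W_space_eq W'_space_add W'_space_pscale q_mem)
        show "rspace (W'_rep \<rho>) \<subseteq> f ` rspace (W_rep \<rho> \<boxplus> eps_rep)"
        proof
          fix v assume "v \<in> rspace (W'_rep \<rho>)"
          then have v: "v \<in> W'_space" by simp
          obtain c where c: "sym_mult v = pscale c lines_form" using mult_W'[OF v] by blast
          \<comment> \<open>The projection to \<open>W_space\<close>: the divisor 6 is the multiple
            of \<open>lines_form\<close> to which \<open>q\<close> is sent.\<close>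
          have "v + pscale (- (c / 6)) q \<in> W_space"
            using v q_mem pscale_add_left[of c "- c" lines_form]
            by (simp add: W_space_eq W'_space_add W'_space_pscale sym_mult_add sym_mult_pscale q_mult c)
          moreover have "v = f (v + pscale (- (c / 6)) q, c / 6)"
            using pscale_add_left[of "- (c / 6)" "c / 6" q] by (simp add: f_def add.assoc)
          ultimately show "v \<in> f ` rspace (W_rep \<rho> \<boxplus> eps_rep)" by (auto simp: char_sel)
        qed
      qed
    qed
    fix g x assume "g \<in> carrier S5" "x \<in> rspace (W_rep \<rho> \<boxplus> eps_rep)"
    then show "f (ract (W_rep \<rho> \<boxplus> eps_rep) g x) = ract (W'_rep \<rho>) g (f x)"
      by (auto simp: f_def char_sel sym_act_add sym_act_pscale q_act mult.commute split: prod.split)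
  qed
qed

end

section \<open>The permutation representation\<close>

lemma sum_Pair: "(\<Sum>x\<in>A. (f x, g x)) = (\<Sum>x\<in>A. f x, \<Sum>x\<in>A. g x)"
  by (rule prod_eqI) (simp_all add: fst_sum snd_sum)

context del_pezzo
begin

text \<open>As \<open>sigma_form 1 2\<close> is \<open>quad 1 2 1\<close>, its image lies one place
  after that of \<open>s_form 1 2\<close> in the four-cycle, with 4 wrapping round to 0.\<close>

lemma rho_rep_sigma:
  assumes "(i, j) \<in> idx" "k < 4"
  shows "\<rho> (perm3 i j \<circ> quart ^^ k \<circ> quint ^^ a) (sigma_form 1 2) = quad i j (if k = 3 then 0 else k + 1)"
proof -
  have "\<rho> (quart ^^ k) (sigma_form 1 2) = quad 1 2 (if k = 3 then 0 else k + 1)"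
    using less_4_cases[OF assms(2)]
    by (auto simp: funpow_numerals rho_id rho_comp S5_comp quart_S5 rho_quart rho_uminus quad_def eta_values)
  then have "\<rho> (perm3 i j \<circ> quart ^^ k \<circ> quint ^^ a) (sigma_form 1 2) =
      \<rho> (perm3 i j) (quad 1 2 (if k = 3 then 0 else k + 1))"
    using assms by (simp add: rho_comp S5_comp S5_perm3 S5_power quart_S5 quint_S5 rho_quint_pow)
  also have "\<dots> = quad i j (if k = 3 then 0 else k + 1)"
    using rho_perm3[OF assms(1)] S5_perm3[OF assms(1)]
    by (simp add: quad_def eta_values rho_uminus)
  finally show ?thesis .
qed

lemma sgn_rep:
  assumes "(i, j) \<in> idx" "k < 4"
  shows "sgn_char (perm3 i j \<circ> quart ^^ k \<circ> quint ^^ a) = eta i j * (- 1) ^ k"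
proof -
  have "sgn_char (g ^^ n) = sgn_char g ^ n" if g: "g \<in> carrier S5" for g n
  proof (induction n)
    case 0 show ?case by (simp add: sgn_char_def)
  next
    case (Suc n)
    then show ?case
      using sgn_S5_comp[OF g S5_power[OF g, of n]] by (simp only: funpow.simps power_Suc)
  qed
  then show ?thesis
    using assms
    by (simp add: sgn_S5_comp S5_comp S5_perm3 S5_power quart_S5 quint_S5 sgn_quart sgn_quint eta_perm3)
qed

lemma pscale_uminus_left: "pscale (- c) p = - pscale c p"
  by (rule poly_mapping_eqI) simp

lemma eta_sq: "eta i j * eta i j = 1"
  by (simp add: eta_perm3 sgn_char_sq)

text \<open>An intertwiner \<open>V \<rightarrow> V \<otimes> \<epsilon>\<close> sends \<open>s\<close> to a combination of \<open>s\<close> and \<open>\<sigma>\<close>, the vectors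
  fixed by the stabiliser of \<open>s\<close>; compatibility with the linear relations between the \<open>\<sigma>\<^sub>i\<^sub>j\<close> and
  the \<open>s\<^sub>i\<^sub>j\<close> forces the ratio 1 : 2. Its square is 5.\<close>

definition twist_map :: "nat mpoly \<Rightarrow> nat mpoly" where
  "twist_map v = (\<Sum>(i, j)\<in>idx. pscale (s_coeff v (i, j))
     (pscale (eta i j) (s_form i j) + pscale 2 (sigma_form i j)))"

lemma twist_map_add: "twist_map (u + v) = twist_map u + twist_map v"
  and twist_map_pscale: "twist_map (pscale c v) = pscale c (twist_map v)"
  by (simp_all add: twist_map_def sum_idx s_coeff_add s_coeff_pscale pscale_add_left pscale_add algebra_simps)

lemma twist_map_uminus: "twist_map (- v) = - twist_map v"
  using twist_map_pscale[of "- 1" v] by simp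

lemma twist_map_diff: "twist_map (u - v) = twist_map u - twist_map v"
  using twist_map_add[of u "- v"] by (simp add: twist_map_uminus)

lemma twist_map_sum: "twist_map (\<Sum>x\<in>A. f x) = (\<Sum>x\<in>A. twist_map (f x))"
proof -
  have "twist_map 0 = 0" using twist_map_pscale[of 0 0] by simp
  then show ?thesis
    by (induction A rule: infinite_finite_induct) (simp_all add: twist_map_add)
qed

lemma twist_map_in_V: "twist_map v \<in> V_space"
  unfolding twist_map_def
  by (intro V_space_sum) (auto intro!: V_space_closed s_form_in_V sigma_form_in_V)

lemma twist_map_s:
  assumes "(i, j) \<in> idx"
  shows "twist_map (s_form i j) = pscale (eta i j) (s_form i j) + pscale 2 (sigma_form i j)"
  using assms by (elim idx_cases) (auto simp: twist_map_def sum_idx s_coeff_s_form idx_eq)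

lemma twist_map_sigma:
  assumes "(i, j) \<in> idx"
  shows "twist_map (sigma_form i j) = pscale 2 (s_form i j) - pscale (eta i j) (sigma_form i j)"
  using assms
  by (elim idx_cases)
    (auto simp: sigma_values twist_map_add twist_map_diff twist_map_uminus twist_map_s idx_eq eta_values
      pscale_eq_mult pconst_numeral pconst_uminus algebra_simps)

text \<open>Applied to \<open>\<eta> s + 2 \<sigma>\<close>, the two contributions in
  \<open>\<sigma>\<close> cancel and those in \<open>s\<close> add up to
  \<open>\<eta>\<^sup>2 + 4 = 5\<close>.\<close>

lemma twist_map_twist_map:
  assumes "v \<in> V_space" shows "twist_map (twist_map v) = pscale 5 v"
proof -
  have "twist_map (twist_map (s_form i j)) = pscale 5 (s_form i j)" if "(i, j) \<in> idx" for i j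
    using that eta_sq[of i j] pscale_add_left[of 1 4 "s_form i j"]
    by (simp add: twist_map_s twist_map_sigma twist_map_add twist_map_pscale pscale_add pscale_diff
        mult.commute)
  then have "twist_map (twist_map (\<Sum>(i, j)\<in>idx. pscale (s_coeff v (i, j)) (s_form i j))) =
      pscale 5 (\<Sum>(i, j)\<in>idx. pscale (s_coeff v (i, j)) (s_form i j))"
    by (auto simp: twist_map_sum twist_map_pscale pscale_sum mult.commute intro!: sum.cong)
  then show ?thesis by (simp flip: V_space_expand[OF assms])
qed

text \<open>The formulas for \<open>s_form i j\<close> and \<open>sigma_form i j\<close> combine
  into one that holds on all of \<open>M_set\<close>, the signs \<open>eta\<close> and the
  alternation along \<open>quad\<close> being absorbed by the sign of \<open>g\<close>. In this form
  twisted equivariance on the orbit is immediate.\<close>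

lemma twist_map_orbit:
  assumes "g \<in> carrier S5"
  shows "twist_map (\<rho> g (s_form 1 2)) =
    pscale (sgn_char g) (\<rho> g (s_form 1 2) + pscale 2 (\<rho> g (sigma_form 1 2)))"
proof -
  obtain i j k a where g: "(i, j) \<in> idx" "k < 4" "g = perm3 i j \<circ> quart ^^ k \<circ> quint ^^ a"
    using S5_cases[OF assms] by metis
  show ?thesis
    unfolding g(3) rho_rep[OF g(1,2)] rho_rep_sigma[OF g(1,2)] sgn_rep[OF g(1,2)]
    using less_4_cases[OF g(2)] sgn_char_cases[of "perm3 i j"] unfolding eta_perm3[symmetric]
    by (elim disjE) (simp_all add: quad_def twist_map_pscale twist_map_uminus twist_map_s[OF g(1)]
        twist_map_sigma[OF g(1)] pscale_add pscale_diff pscale_uminus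
        pscale_uminus_left algebra_simps)
qed

text \<open>Comparing \<open>twist_map_orbit\<close> at \<open>g \<circ> perm3 i j\<close> and at
  \<open>perm3 i j\<close> gives the claim for the multiple \<open>eta i j\<close> of
  \<open>s_form i j\<close>; the basis expansion extends it to all of
  \<open>V_space\<close>.\<close>

lemma twist_map_rho:
  assumes g: "g \<in> carrier S5" and v: "v \<in> V_space"
  shows "twist_map (\<rho> g v) = pscale (sgn_char g) (\<rho> g (twist_map v))"
proof -
  have *: "twist_map (\<rho> g (s_form i j)) = pscale (sgn_char g) (\<rho> g (twist_map (s_form i j)))"
    if ij: "(i, j) \<in> idx" for i j
  proof -
    let ?h = "perm3 i j" and ?s = "s_form 1 2" and ?t = "sigma_form 1 2"
    note h = S5_perm3[OF ij]
    have "twist_map (\<rho> g (\<rho> ?h ?s)) = pscale (sgn_char g) (\<rho> g (twist_map (\<rho> ?h ?s)))"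
      using twist_map_orbit[OF S5_comp[OF g h]] g h
      by (simp add: twist_map_orbit rho_comp sgn_S5_comp rho_linear rho_mem V_space_closed)
    then have "pscale (eta i j) (twist_map (\<rho> g (s_form i j))) =
        pscale (eta i j) (pscale (sgn_char g) (\<rho> g (twist_map (s_form i j))))"
      using g ij by (simp add: rho_perm3 rho_pscale s_form_in_V twist_map_pscale twist_map_in_V mult.commute)
    \<comment> \<open>The factor \<open>eta i j\<close> is removed by multiplying with it once more,
      its square being 1.\<close>
    then have "pscale (eta i j) (pscale (eta i j) (twist_map (\<rho> g (s_form i j)))) =
        pscale (eta i j) (pscale (eta i j) (pscale (sgn_char g) (\<rho> g (twist_map (s_form i j)))))"
      by simp
    then show ?thesis by (simp add: eta_sq flip: mult.assoc)
  qed
  have "twist_map (\<rho> g v) = (\<Sum>(i, j)\<in>idx. pscale (s_coeff v (i, j)) (twist_map (\<rho> g (s_form i j))))"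
    by (subst V_space_expand[OF v], subst rho_sum[OF g])
      (auto simp: V_space_pscale s_form_in_V rho_pscale g twist_map_sum twist_map_pscale intro!: sum.cong)
  also have "\<dots> = pscale (sgn_char g) (\<Sum>(i, j)\<in>idx. \<rho> g (pscale (s_coeff v (i, j)) (twist_map (s_form i j))))"
    by (auto simp: * pscale_sum rho_pscale g twist_map_in_V mult.commute intro!: sum.cong)
  also have "(\<Sum>(i, j)\<in>idx. \<rho> g (pscale (s_coeff v (i, j)) (twist_map (s_form i j)))) =
      \<rho> g (\<Sum>(i, j)\<in>idx. pscale (s_coeff v (i, j)) (twist_map (s_form i j)))"
    by (subst rho_sum[OF g]) (auto simp: V_space_pscale twist_map_in_V intro!: sum.cong)
  also have "(\<Sum>(i, j)\<in>idx. pscale (s_coeff v (i, j)) (twist_map (s_form i j))) = twist_map v"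
  proof -
    have "(\<Sum>(i, j)\<in>idx. pscale (s_coeff v (i, j)) (twist_map (s_form i j))) =
        twist_map (\<Sum>(i, j)\<in>idx. pscale (s_coeff v (i, j)) (s_form i j))"
      by (auto simp: twist_map_sum twist_map_pscale intro!: sum.cong)
    then show ?thesis by (simp flip: V_space_expand[OF v])
  qed
  finally show ?thesis .
qed

lemma V_iso_twist: "V_rep \<rho> \<simeq> V_rep \<rho> \<boxtimes> sgn_char"
proof (rule rep_iso_transport[OF S5_group is_rep_V, where f = twist_map])
  show "linear_between (V_rep \<rho>) (V_rep \<rho> \<boxtimes> sgn_char) twist_map"
    by (rule linear_betweenI) (simp_all add: twist_map_in_V twist_map_add twist_map_pscale)
  show "bij_betw twist_map (rspace (V_rep \<rho>)) (rspace (V_rep \<rho> \<boxtimes> sgn_char))"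
    by (rule bij_betw_byWitness[where f' = "\<lambda>v. pscale (1 / 5) (twist_map v)"])
      (auto simp: twist_map_pscale twist_map_twist_map twist_map_in_V V_space_pscale)
qed (simp_all add: vector_space_pscale twist_map_rho)

text \<open>For \<open>s = s\<^sub>i\<^sub>j\<close> and \<open>\<sigma> = \<sigma>\<^sub>i\<^sub>j\<close>, the pair of components of an element of \<open>M\<close> in \<open>V\<close> and
  \<open>V \<otimes> \<epsilon>\<close>, in terms of the differences \<open>u\<close> and \<open>w\<close> of its coefficients at \<open>\<plusminus>\<eta>s\<close> and \<open>\<plusminus>\<sigma>\<close>.\<close>

definition VV_sum :: "(nat \<times> nat \<Rightarrow> complex) \<Rightarrow> (nat \<times> nat \<Rightarrow> complex) \<Rightarrow> nat mpoly \<times> nat mpoly" where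
  "VV_sum u w =
    (\<Sum>(i, j)\<in>idx. pscale (eta i j * u (i, j)) (s_form i j) + pscale (w (i, j)) (sigma_form i j),
     \<Sum>(i, j)\<in>idx. pscale (u (i, j)) (s_form i j) - pscale (eta i j * w (i, j)) (sigma_form i j))"

lemma VV_sum_in_V: "fst (VV_sum u w) \<in> V_space" "snd (VV_sum u w) \<in> V_space"
  unfolding VV_sum_def fst_conv snd_conv
  by (intro V_space_sum; auto intro!: V_space_closed s_form_in_V sigma_form_in_V)+

lemma s_coeff_VV_sum:
  "map (s_coeff (fst (VV_sum u w))) [(1, 2), (1, 3), (2, 1), (2, 3), (3, 1), (3, 2)] =
   [u (1, 2) - w (1, 3) - w (2, 3) - w (3, 1), - u (1, 3) + w (1, 2) + w (2, 1) + w (3, 2),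
    - u (2, 1) + w (1, 3) + w (2, 3) + w (3, 2), u (2, 3) - w (1, 2) - w (2, 1) - w (3, 1),
    u (3, 1) - w (1, 2) - w (2, 3) - w (3, 2), - u (3, 2) + w (1, 3) + w (2, 1) + w (3, 1)]"
  "map (s_coeff (snd (VV_sum u w))) [(1, 2), (1, 3), (2, 1), (2, 3), (3, 1), (3, 2)] =
   [u (1, 2) - w (1, 3) + w (2, 3) + w (3, 1), u (1, 3) - w (1, 2) + w (2, 1) + w (3, 2),
    u (2, 1) + w (1, 3) - w (2, 3) + w (3, 2), u (2, 3) + w (1, 2) - w (2, 1) + w (3, 1),
    u (3, 1) + w (1, 2) + w (2, 3) - w (3, 2), u (3, 2) + w (1, 3) + w (2, 1) - w (3, 1)]"
  by (simp_all add: VV_sum_def sum_idx s_coeff_add s_coeff_diff s_coeff_uminus s_coeff_pscale sigma_values eta_values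
      s_coeff_s_form idx_eq)

text \<open>At the index pairs 12, 23, 31 the difference of the two components contains only
  pairwise sums of \<open>w\<close> over these pairs; at 13, 21, 32 the same holds for the sum of
  the components. Hence \<open>w\<close> vanishes on both triples, and then \<open>u\<close> can be
  read off.\<close>

lemma VV_sum_inj:
  assumes "VV_sum u w = 0"
  shows "\<forall>x\<in>idx. u x = 0 \<and> w x = 0"
proof -
  have "s_coeff (fst (VV_sum u w)) x = 0" "s_coeff (snd (VV_sum u w)) x = 0" for x
    using assms by (simp_all add: s_coeff_0)
  note eqs = s_coeff_VV_sum[of u w, unfolded list.map this list.inject]
  have 1: "w (1, 3) = 0 \<and> w (2, 1) = 0 \<and> w (3, 2) = 0" using eqs by (elim conjE) algebra
  have 2: "w (1, 2) = 0 \<and> w (2, 3) = 0 \<and> w (3, 1) = 0" using eqs by (elim conjE) algebra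
  show ?thesis using eqs by (simp add: 1 2 idx_eq)
qed

lemma VV_sum_surj:
  assumes "v1 \<in> V_space" "v2 \<in> V_space"
  shows "\<exists>u w. VV_sum u w = (v1, v2)"
proof -
  \<comment> \<open>Half sums and half differences decouple the system. On each triple of index
    pairs \<open>w\<close> is recovered from its pairwise sums, given by \<open>p\<close> on 13, 21,
    32 and by \<open>- m\<close> on 12, 23, 31; the remaining equations yield
    \<open>u\<close>.\<close>
  define p where "p x = (s_coeff v1 x + s_coeff v2 x) / 2" for x
  define m where "m x = (s_coeff v1 x - s_coeff v2 x) / 2" for x
  define w where "w x = (if x = (1, 3) then (p (2, 1) + p (3, 2) - p (1, 3)) / 2
    else if x = (2, 1) then (p (1, 3) + p (3, 2) - p (2, 1)) / 2
    else if x = (3, 2) then (p (1, 3) + p (2, 1) - p (3, 2)) / 2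
    else if x = (1, 2) then (m (1, 2) - m (3, 1) - m (2, 3)) / 2
    else if x = (2, 3) then (m (2, 3) - m (1, 2) - m (3, 1)) / 2
    else (m (3, 1) - m (1, 2) - m (2, 3)) / 2)" for x :: "nat \<times> nat"
  define u where "u x = (if x = (1, 2) then p (1, 2) + w (1, 3) else if x = (2, 3) then p (2, 3) + w (2, 1)
    else if x = (3, 1) then p (3, 1) + w (3, 2) else if x = (1, 3) then w (1, 2) - m (1, 3)
    else if x = (2, 1) then w (2, 3) - m (2, 1) else w (3, 1) - m (3, 2))" for x :: "nat \<times> nat"
  note cs = s_coeff_VV_sum[of u w, unfolded list.map list.inject]
  have "fst (VV_sum u w) = v1"
    by (rule V_space_eqI[OF VV_sum_in_V(1) assms(1)])
      (use cs(1) in \<open>auto simp: idx_eq u_def w_def p_def m_def field_simps\<close>)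
  moreover have "snd (VV_sum u w) = v2"
    by (rule V_space_eqI[OF VV_sum_in_V(2) assms(2)])
      (use cs(2) in \<open>auto simp: idx_eq u_def w_def p_def m_def field_simps\<close>)
  ultimately show ?thesis by (metis prod.collapse)
qed

section \<open>The isomorphism from M to the sum of four representations\<close>

lemma sum_M_set:
  "(\<Sum>m\<in>M_set. f m) = (\<Sum>(i, j)\<in>idx. f (quad i j 0) + f (quad i j 1) + f (quad i j 2) + f (quad i j 3))"
  for f :: "_ \<Rightarrow> 'b::comm_monoid_add"
proof -
  have "M_set = (\<lambda>((i, j), k). quad i j k) ` (idx \<times> {..<4})"
    unfolding M_set_eq_quad by (force simp: image_iff)
  then have "(\<Sum>m\<in>M_set. f m) = (\<Sum>((i, j), k)\<in>idx \<times> {..<4}. f (quad i j k))"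
    using sum.reindex[OF quad_inj, of f] by (simp add: comp_def case_prod_unfold)
  also have "\<dots> = (\<Sum>(i, j)\<in>idx. \<Sum>k<4. f (quad i j k))"
    by (simp add: sum.cartesian_product case_prod_unfold)
  also have "{..<4} = {0, 1, 2, 3 :: nat}" by auto
  finally show ?thesis by (simp add: add.assoc)
qed

lemma finite_M_set: "finite M_set"
  unfolding M_set_eq_quad by (auto simp: finite_idx)

text \<open>The components of the basis vector \<open>m\<close> of \<open>M\<close>. The second and the last one carry the sign of
  a permutation moving \<open>s\<^sub>1\<^sub>2\<close> to \<open>m\<close>, well defined since the stabiliser of \<open>s\<^sub>1\<^sub>2\<close> is even.\<close>

definition M_comp :: "nat mpoly \<Rightarrow>
    nat mpoly \<times> nat mpoly \<times> ((5 \<Rightarrow> nat) set set \<Rightarrow>\<^sub>0 complex) \<times> ((5 \<Rightarrow> nat) set set \<Rightarrow>\<^sub>0 complex)" where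
  "M_comp m = (let g = SOME g. g \<in> carrier S5 \<and> \<rho> g (s_form 1 2) = m;
       d = double_class (g \<circ> base_pentagon)
     in (m, pscale (sgn_char g) m, Poly_Mapping.single d 1, Poly_Mapping.single d (sgn_char g)))"

lemma M_comp_orbit:
  assumes g: "g \<in> carrier S5"
  shows "M_comp (\<rho> g (s_form 1 2)) =
    (\<rho> g (s_form 1 2), pscale (sgn_char g) (\<rho> g (s_form 1 2)),
     Poly_Mapping.single (double_class (g \<circ> base_pentagon)) 1,
     Poly_Mapping.single (double_class (g \<circ> base_pentagon)) (sgn_char g))"
proof -
  let ?h = "SOME h. h \<in> carrier S5 \<and> \<rho> h (s_form 1 2) = \<rho> g (s_form 1 2)"
  have h: "?h \<in> carrier S5 \<and> \<rho> ?h (s_form 1 2) = \<rho> g (s_form 1 2)"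
    by (rule someI[of "\<lambda>h. h \<in> carrier S5 \<and> \<rho> h (s_form 1 2) = \<rho> g (s_form 1 2)" g]) (use g in simp)
  then obtain b where b: "?h = g \<circ> quint ^^ b" using rho_orbit_eq[OF g, of ?h] by auto
  have "sgn_char (quint ^^ b) = 1"
    using sgn_rep[of 1 2 0 b] by (simp add: idx_eq perm3_eq eta_values)
  then have "sgn_char ?h = sgn_char g"
    unfolding b using g by (simp only: sgn_S5_comp S5_power quint_S5 mult_1_right)
  moreover have "double_class (?h \<circ> base_pentagon) = double_class (g \<circ> base_pentagon)"
    unfolding b using double_class_affine[of g b 0] by simp
  ultimately show ?thesis unfolding M_comp_def Let_def by (simp only:)
qed

lemma M_comp_quad:
  assumes "(i, j) \<in> idx" "k < 4"
  shows "M_comp (quad i j k) = (quad i j k, pscale (eta i j * (- 1) ^ k) (quad i j k),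
     Poly_Mapping.single (dpent (i, j)) 1, Poly_Mapping.single (dpent (i, j)) (eta i j * (- 1) ^ k))"
proof -
  let ?g = "perm3 i j \<circ> quart ^^ k \<circ> quint ^^ 0"
  have "?g \<in> carrier S5"
    using assms by (simp only: S5_comp S5_perm3 S5_power quart_S5 quint_S5)
  from M_comp_orbit[OF this] show ?thesis
    by (simp only: rho_rep[OF assms] sgn_rep[OF assms] dpent_class[OF assms])
qed

abbreviation M_sum_rep where
  "M_sum_rep \<equiv> V_rep \<rho> \<boxplus> (V_rep \<rho> \<boxtimes> sgn_char) \<boxplus> D_rep \<boxplus> (D_rep \<boxtimes> sgn_char)"

lemma is_rep_D: "is_rep S5 D_rep"
  unfolding D_rep_def by (rule is_rep_perm[OF is_gset_double])

lemma D_rep_sel [simp]: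
  "rspace D_rep = {f. Poly_Mapping.keys f \<subseteq> double_pentagons}" "rscale D_rep = pscale"
  by (simp_all add: D_rep_def)

lemma is_rep_M_sum: "is_rep S5 M_sum_rep"
  by (intro is_rep_sum is_rep_twist is_rep_V is_rep_D is_char_sgn)

text \<open>A Fourier transform along each four-cycle \<open>quad i j\<close>: the \<open>D\<close>
  components see the sum and the alternating sum of the four coefficients, while the
  \<open>V\<close> components see only the differences of opposite ones. This separates the question
  of bijectivity for \<open>VV_sum\<close> from that for the \<open>D\<close> part.\<close>

lemma M_comp_sum:
  assumes A: "\<And>i j k. (i, j) \<in> idx \<Longrightarrow> k < 4 \<Longrightarrow> a (quad i j k) = A k (i, j)"
  shows "(\<Sum>m\<in>M_set. rscale M_sum_rep (a m) (M_comp m)) =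
    (fst (VV_sum (\<lambda>x. A 0 x - A 2 x) (\<lambda>x. A 1 x - A 3 x)),
     snd (VV_sum (\<lambda>x. A 0 x - A 2 x) (\<lambda>x. A 1 x - A 3 x)),
     \<Sum>x\<in>idx. Poly_Mapping.single (dpent x) (A 0 x + A 1 x + A 2 x + A 3 x),
     \<Sum>(i, j)\<in>idx. Poly_Mapping.single (dpent (i, j))
       (eta i j * (A 0 (i, j) - A 1 (i, j) + A 2 (i, j) - A 3 (i, j))))"
proof -
  have *: "rscale M_sum_rep (a (quad i j k)) (M_comp (quad i j k)) =
      (pscale (A k (i, j)) (quad i j k), pscale (A k (i, j) * (eta i j * (- 1) ^ k)) (quad i j k),
       Poly_Mapping.single (dpent (i, j)) (A k (i, j)),
       Poly_Mapping.single (dpent (i, j)) (A k (i, j) * (eta i j * (- 1) ^ k)))"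
    if "(i, j) \<in> idx" "k < 4" for i j k
    using that by (simp add: M_comp_quad A pscale_single)
  have "pscale (A 0 (i, j)) (quad i j 0) + pscale (A 1 (i, j)) (quad i j 1) +
      pscale (A 2 (i, j)) (quad i j 2) + pscale (A 3 (i, j)) (quad i j 3) =
      pscale (eta i j * (A 0 (i, j) - A 2 (i, j))) (s_form i j) + pscale (A 1 (i, j) - A 3 (i, j)) (sigma_form i j)"
    "pscale (A 0 (i, j) * (eta i j * (- 1) ^ 0)) (quad i j 0) +
     pscale (A 1 (i, j) * (eta i j * (- 1) ^ 1)) (quad i j 1) +
     pscale (A 2 (i, j) * (eta i j * (- 1) ^ 2)) (quad i j 2) +
     pscale (A 3 (i, j) * (eta i j * (- 1) ^ 3)) (quad i j 3) =
      pscale (A 0 (i, j) - A 2 (i, j)) (s_form i j) - pscale (eta i j * (A 1 (i, j) - A 3 (i, j))) (sigma_form i j)"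
    for i j
    by (rule poly_mapping_eqI; use sgn_char_cases[of "perm3 i j"] in
        \<open>auto simp: quad_def eta_perm3 lookup_add lookup_minus algebra_simps\<close>)+
  note sums = this
  have "rscale M_sum_rep (a (quad i j 0)) (M_comp (quad i j 0)) + rscale M_sum_rep (a (quad i j 1)) (M_comp (quad i j 1)) +
      rscale M_sum_rep (a (quad i j 2)) (M_comp (quad i j 2)) + rscale M_sum_rep (a (quad i j 3)) (M_comp (quad i j 3)) =
    (pscale (eta i j * (A 0 (i, j) - A 2 (i, j))) (s_form i j) + pscale (A 1 (i, j) - A 3 (i, j)) (sigma_form i j),
     pscale (A 0 (i, j) - A 2 (i, j)) (s_form i j) - pscale (eta i j * (A 1 (i, j) - A 3 (i, j))) (sigma_form i j),
     Poly_Mapping.single (dpent (i, j)) (A 0 (i, j) + A 1 (i, j) + A 2 (i, j) + A 3 (i, j)),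
     Poly_Mapping.single (dpent (i, j)) (eta i j * (A 0 (i, j) - A 1 (i, j) + A 2 (i, j) - A 3 (i, j))))"
    if "(i, j) \<in> idx" for i j
  proof -
    have "(0 :: nat) < 4" "(1 :: nat) < 4" "(2 :: nat) < 4" "(3 :: nat) < 4" by simp_all
    note all = this[THEN *[OF that]]
    have signs: "A 0 (i, j) * (eta i j * (- 1) ^ 0) + A 1 (i, j) * (eta i j * (- 1) ^ 1) +
        A 2 (i, j) * (eta i j * (- 1) ^ 2) + A 3 (i, j) * (eta i j * (- 1) ^ 3) =
      eta i j * (A 0 (i, j) - A 1 (i, j) + A 2 (i, j) - A 3 (i, j))"
      by (simp add: algebra_simps)
    show ?thesis
      by (simp only: all add_Pair sums single_add[symmetric] signs)
  qed
  then have "(\<Sum>m\<in>M_set. rscale M_sum_rep (a m) (M_comp m)) = (\<Sum>(i, j)\<in>idx.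
    (pscale (eta i j * (A 0 (i, j) - A 2 (i, j))) (s_form i j) + pscale (A 1 (i, j) - A 3 (i, j)) (sigma_form i j),
     pscale (A 0 (i, j) - A 2 (i, j)) (s_form i j) - pscale (eta i j * (A 1 (i, j) - A 3 (i, j))) (sigma_form i j),
     Poly_Mapping.single (dpent (i, j)) (A 0 (i, j) + A 1 (i, j) + A 2 (i, j) + A 3 (i, j)),
     Poly_Mapping.single (dpent (i, j)) (eta i j * (A 0 (i, j) - A 1 (i, j) + A 2 (i, j) - A 3 (i, j)))))"
    unfolding sum_M_set by (intro sum.cong refl) (auto simp only: split: prod.split)
  then show ?thesis
    by (simp only: VV_sum_def case_prod_unfold sum_Pair fst_conv snd_conv prod.collapse)
qed

lemma inj_dpent: "inj_on dpent idx"
  using dpent_bij by (simp add: bij_betw_def)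

lemma lookup_dpent_sum:
  assumes "x \<in> idx"
  shows "Poly_Mapping.lookup (\<Sum>y\<in>idx. Poly_Mapping.single (dpent y) (f y)) (dpent x) = f x"
proof -
  have "Poly_Mapping.lookup (\<Sum>y\<in>idx. Poly_Mapping.single (dpent y) (f y)) (dpent x) =
      (\<Sum>y\<in>idx. if y = x then f y else 0)"
    unfolding lookup_sum
    by (rule sum.cong[OF refl])
      (use assms inj_dpent in \<open>auto simp: lookup_single when_def inj_on_eq_iff\<close>)
  then show ?thesis using assms finite_idx by simp
qed

lemma double_pentagons_expand:
  assumes "Poly_Mapping.keys d \<subseteq> double_pentagons"
  shows "d = (\<Sum>x\<in>idx. Poly_Mapping.single (dpent x) (Poly_Mapping.lookup d (dpent x)))"
proof -
  have fin: "finite double_pentagons"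
    using bij_betw_finite[OF dpent_bij] finite_idx by simp
  have "d = (\<Sum>y\<in>Poly_Mapping.keys d. Poly_Mapping.single y (Poly_Mapping.lookup d y))"
    by (rule sum_single_lookup)
  also have "\<dots> = (\<Sum>y\<in>double_pentagons. Poly_Mapping.single y (Poly_Mapping.lookup d y))"
    by (rule sum.mono_neutral_left) (use assms fin in \<open>auto simp: in_keys_iff\<close>)
  finally show ?thesis unfolding sum_double_pentagons .
qed

lemma keys_dpent_sum: "Poly_Mapping.keys (\<Sum>x\<in>idx. Poly_Mapping.single (dpent x) (f x)) \<subseteq> double_pentagons"
proof -
  have "Poly_Mapping.keys (\<Sum>x\<in>idx. Poly_Mapping.single (dpent x) (f x)) \<subseteq>
      (\<Union>x\<in>idx. Poly_Mapping.keys (Poly_Mapping.single (dpent x) (f x)))"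
    by (rule keys_sum)
  also have "\<dots> \<subseteq> dpent ` idx" by (auto split: if_splits)
  also have "\<dots> = double_pentagons" using dpent_bij by (simp add: bij_betw_def)
  finally show ?thesis .
qed

lemma M_comp_indep:
  assumes "(\<Sum>m\<in>M_set. rscale M_sum_rep (a m) (M_comp m)) = 0"
  shows "\<forall>m\<in>M_set. a m = 0"
proof -
  define A where "A = (\<lambda>k (i, j). a (quad i j k))"
  have "a (quad i j k) = A k (i, j)" for i j k by (simp add: A_def)
  note comps = assms[unfolded M_comp_sum[of a A, OF this] zero_prod_def prod.inject]
  have "VV_sum (\<lambda>x. A 0 x - A 2 x) (\<lambda>x. A 1 x - A 3 x) = 0"
    using comps by (intro prod_eqI) simp_all
  then have diff: "A 0 x - A 2 x = 0" "A 1 x - A 3 x = 0" if "x \<in> idx" for x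
    using VV_sum_inj that by blast+
  have sum: "A 0 x + A 1 x + A 2 x + A 3 x = 0" if "x \<in> idx" for x
    using lookup_dpent_sum[OF that, of "\<lambda>x. A 0 x + A 1 x + A 2 x + A 3 x"] comps by simp
  have alt: "eta i j * (A 0 (i, j) - A 1 (i, j) + A 2 (i, j) - A 3 (i, j)) = 0" if "(i, j) \<in> idx" for i j
    using lookup_dpent_sum[OF that, of "\<lambda>(i, j). eta i j * (A 0 (i, j) - A 1 (i, j) + A 2 (i, j) - A 3 (i, j))"]
      comps by (simp add: case_prod_unfold)
  have "A 0 (i, j) = 0 \<and> A 1 (i, j) = 0 \<and> A 2 (i, j) = 0 \<and> A 3 (i, j) = 0" if ij: "(i, j) \<in> idx" for i j
  proof -
    have "eta i j \<noteq> 0" using eta_sq[of i j] by auto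
    then have "A 0 (i, j) - A 1 (i, j) + A 2 (i, j) - A 3 (i, j) = 0" using alt[OF ij] by simp
    then show ?thesis using diff[OF ij] sum[OF ij] by algebra
  qed
  then show ?thesis
    unfolding M_set_eq_quad A_def using less_4_cases by auto
qed

lemma M_comp_span:
  assumes "v \<in> rspace M_sum_rep"
  shows "\<exists>a. v = (\<Sum>m\<in>M_set. rscale M_sum_rep (a m) (M_comp m))"
proof -
  obtain v1 v2 d1 d2 where v: "v = (v1, v2, d1, d2)" by (metis prod.exhaust)
  have V: "v1 \<in> V_space" "v2 \<in> V_space" and d: "Poly_Mapping.keys d1 \<subseteq> double_pentagons"
    "Poly_Mapping.keys d2 \<subseteq> double_pentagons"
    using assms v by simp_all
  obtain u w where uw: "VV_sum u w = (v1, v2)" using VV_sum_surj[OF V] by blast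
  define l1 l2 where "l1 x = Poly_Mapping.lookup d1 (dpent x)" and
    "l2 = (\<lambda>(i, j). eta i j * Poly_Mapping.lookup d2 (dpent (i, j)))" for x
  \<comment> \<open>Inverse of the four-term transform: \<open>l1\<close> is to be the sum and
    \<open>l2\<close> the alternating sum of the coefficients, the latter freed of its factor
    \<open>eta\<close>, while \<open>u\<close> and \<open>w\<close> are the differences of opposite
    coefficients.\<close>
  define B where "B k x = (if k = 0 then (l1 x + l2 x) / 4 + u x / 2 else if k = 1 then (l1 x - l2 x) / 4 + w x / 2
    else if k = 2 then (l1 x + l2 x) / 4 - u x / 2 else (l1 x - l2 x) / 4 - w x / 2)" for k :: nat and x
  define a where "a m = (case inv_into (idx \<times> {..<4}) (\<lambda>((i, j), k). quad i j k) m of (x, k) \<Rightarrow> B k x)" for m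
  have a: "a (quad i j k) = B k (i, j)" if "(i, j) \<in> idx" "k < 4" for i j k
    using inv_into_f_f[OF quad_inj, of "((i, j), k)"] that by (simp add: a_def)
  have VV: "VV_sum (\<lambda>x. B 0 x - B 2 x) (\<lambda>x. B 1 x - B 3 x) = (v1, v2)"
    by (simp add: B_def flip: uw)
  have "(\<Sum>x\<in>idx. Poly_Mapping.single (dpent x) (B 0 x + B 1 x + B 2 x + B 3 x)) =
      (\<Sum>x\<in>idx. Poly_Mapping.single (dpent x) (Poly_Mapping.lookup d1 (dpent x)))"
    by (simp add: B_def l1_def field_simps)
  then have D1: "(\<Sum>x\<in>idx. Poly_Mapping.single (dpent x) (B 0 x + B 1 x + B 2 x + B 3 x)) = d1"
    by (simp only: double_pentagons_expand[OF d(1), symmetric])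
  have "eta i j * (B 0 (i, j) - B 1 (i, j) + B 2 (i, j) - B 3 (i, j)) = Poly_Mapping.lookup d2 (dpent (i, j))"
    for i j
  proof -
    have "B 0 (i, j) - B 1 (i, j) + B 2 (i, j) - B 3 (i, j) = l2 (i, j)"
      by (simp add: B_def field_simps)
    then show ?thesis by (simp add: l2_def eta_sq flip: mult.assoc)
  qed
  then have D2: "(\<Sum>(i, j)\<in>idx. Poly_Mapping.single (dpent (i, j))
      (eta i j * (B 0 (i, j) - B 1 (i, j) + B 2 (i, j) - B 3 (i, j)))) = d2"
    using double_pentagons_expand[OF d(2)] by (simp add: case_prod_unfold)
  have "v = (\<Sum>m\<in>M_set. rscale M_sum_rep (a m) (M_comp m))"
    by (simp only: M_comp_sum[of a B, OF a] v VV D1 D2 fst_conv snd_conv)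
  then show ?thesis by blast
qed

lemma M_comp_sum_mem: "(\<Sum>m\<in>M_set. rscale M_sum_rep (a m) (M_comp m)) \<in> rspace M_sum_rep"
proof -
  define A where "A = (\<lambda>k (i, j). a (quad i j k))"
  have "a (quad i j k) = A k (i, j)" for i j k by (simp add: A_def)
  note sum = M_comp_sum[of a A, OF this]
  show ?thesis
    unfolding sum using VV_sum_in_V keys_dpent_sum[of "\<lambda>x. A 0 x + A 1 x + A 2 x + A 3 x"]
      keys_dpent_sum[of "\<lambda>(i, j). eta i j * (A 0 (i, j) - A 1 (i, j) + A 2 (i, j) - A 3 (i, j))"]
    by (simp add: case_prod_unfold)
qed

lemma M_iso: "M_rep \<rho> \<simeq> M_sum_rep"
  unfolding M_rep_def
proof (rule perm_rep_iso[OF S5_group is_gset_M finite_M_set])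
  show "vector_space (rscale M_sum_rep)" by (rule is_repD(1)[OF is_rep_M_sum])
  show "rspace M_sum_rep = range (\<lambda>a. \<Sum>m\<in>M_set. rscale M_sum_rep (a m) (M_comp m))"
    using M_comp_span M_comp_sum_mem by blast
  show "\<forall>m\<in>M_set. a m = 0" if "(\<Sum>m\<in>M_set. rscale M_sum_rep (a m) (M_comp m)) = 0" for a
    using that by (rule M_comp_indep)
  fix g assume g: "g \<in> carrier S5"
  show "linear_between M_sum_rep M_sum_rep (ract M_sum_rep g)"
    by (rule is_repD(3)[OF is_rep_M_sum g])
  fix m assume "m \<in> M_set"
  then obtain h where h: "h \<in> carrier S5" "m = \<rho> h (s_form 1 2)" unfolding M_set_orbit by blast
  have "M_comp (\<rho> g m) = M_comp (\<rho> (g \<circ> h) (s_form 1 2))" using g h by (simp add: rho_comp)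
  also have "\<dots> = ract M_sum_rep g (M_comp m)"
    unfolding h(2) M_comp_orbit[OF S5_comp[OF g h(1)]] M_comp_orbit[OF h(1)]
    using g h(1)
    by (simp add: rho_comp rho_pscale rho_mem sgn_S5_comp D_rep_def perm_rep_act_single pscale_single
        double_act_class comp_assoc)
  finally show "M_comp (\<rho> g m) = ract M_sum_rep g (M_comp m)" .
qed

section \<open>From D to W, and the decompositions\<close>

lemma eps_twist: "eps_rep \<boxtimes> sgn_char = triv_rep"
  by (simp add: char_rep_def rep_twist_def sgn_char_sq fun_eq_iff flip: mult.assoc)

lemma W_eps_iso_D_twist: "W_rep \<rho> \<boxplus> eps_rep \<simeq> D_rep \<boxtimes> sgn_char"
  by (rule rep_iso_trans[OF W_eps_iso_W' rep_iso_sym[OF D_twist_iso_W']])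

lemma D_iso: "D_rep \<simeq> (W_rep \<rho> \<boxtimes> sgn_char) \<boxplus> triv_rep"
proof -
  have "D_rep \<simeq> D_rep \<boxtimes> sgn_char \<boxtimes> sgn_char"
    by (rule rep_iso_sym[OF rep_iso_twist_twist[OF is_rep_D is_char_sgn sgn_char_sq]])
  also have "D_rep \<boxtimes> sgn_char \<boxtimes> sgn_char \<simeq> (W_rep \<rho> \<boxplus> eps_rep) \<boxtimes> sgn_char"
    by (rule rep_iso_twist[OF rep_iso_sym[OF W_eps_iso_D_twist] is_char_sgn])
  finally show ?thesis by (simp only: rep_sum_twist eps_twist)
qed

end

text \<open>The first conjunct is the parenthetical identification of the set underlying
  \<open>M\<close> with the oriented pentagons. In the last one the summands are matched one by one:
  the twist of \<open>V\<close> becomes \<open>V\<close> by \<open>V_iso_twist\<close>, and the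
  summands on double pentagons are rewritten by \<open>D_iso\<close> and
  \<open>W_eps_iso_D_twist\<close>.\<close>

theorem theorem3p6:
  fixes \<rho> :: "(nat \<Rightarrow> nat) \<Rightarrow> nat mpoly \<Rightarrow> nat mpoly"
  assumes "del_pezzo_action \<rho>"
  shows "gset_iso S5 M_set \<rho> oriented_pentagons oriented_act \<and>
    W'_rep \<rho> \<simeq> W_rep \<rho> \<boxplus> eps_rep \<and>
    W_rep \<rho> \<boxplus> eps_rep \<simeq> D_rep \<boxtimes> sgn_char \<and>
    M_rep \<rho> \<simeq> V_rep \<rho> \<boxplus> (V_rep \<rho> \<boxtimes> sgn_char) \<boxplus> D_rep \<boxplus> (D_rep \<boxtimes> sgn_char) \<and>
    V_rep \<rho> \<boxplus> (V_rep \<rho> \<boxtimes> sgn_char) \<boxplus> D_rep \<boxplus> (D_rep \<boxtimes> sgn_char)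
      \<simeq> V_rep \<rho> \<boxplus> V_rep \<rho> \<boxplus> ((W_rep \<rho> \<boxtimes> sgn_char) \<boxplus> triv_rep) \<boxplus> (W_rep \<rho> \<boxplus> eps_rep)"
proof -
  interpret del_pezzo \<rho> by (rule del_pezzo.intro[OF assms])
  show ?thesis
    by (intro conjI M_gset_iso rep_iso_sym[OF W_eps_iso_W'] W_eps_iso_D_twist M_iso rep_iso_sum
        rep_iso_refl is_rep_V rep_iso_sym[OF V_iso_twist] D_iso rep_iso_sym[OF W_eps_iso_D_twist])
qed

end
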